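(* Let $k,n\ge 2$ be integers with $(n-1)(k-1)>2$ and let $K$ be an algebraically closed field whose characteristic is zero or strictly greater than $k^{n-1}$. Let $\lambda_1,\dots,\lambda_{n-2}\in K\setminus\{0,1\}$ be pairwise different and let $F_{k,n}=C^k(\lambda_1,\dots,\lambda_{n-2})\subset\mathbb{P}^n$. Then: (1) The set of hyper-osculating points of $F_{k,n}$ is the set $F(H_0)$. (2) If $P\in F(H_0)$, then $b_1(P)=k-2$ and $b_l(P)=k-1$ for all $2\le l\le n-1$.
   Context: $C^k(\lambda_1,\dots,\lambda_{n-2})$ is the curve in $\mathbb{P}^n$ with homogeneous coordinates $[x_1:\cdots:x_{n+1}]$ defined by the $n-1$ equations $\lambda_i x_1^k+x_2^k+x_{3+i}^k=0$, $0\le i\le n-2$, where $\lambda_0:=1$. It is a non-singular irreducible projective curve. $H_0\cong\mathbb{Z}_k^n$ is the group of automorphisms of this curve generated by the transformations multiplying a single homogeneous coordinate by a primitive $k$-th root of unity. $F(H_0)$ is the set of fixed points on the curve of these generators, i.e. the set of points of $F_{k,n}$ with some coordinate equal to $0$. Let $C\subset\mathbb{P}^n$ be a smooth projective curve. For an $s$-plane $\Pi$, $\mathrm{mult}_P(\Pi\cap C)$ is the order of contact of $\Pi$ and $C$ at $P\in C$. The osculating $s$-plane $\Pi(s,P)$ of $C$ at $P$ is the unique $s$-plane with $\mathrm{mult}_P(\Pi(s,P)\cap C)\ge s+1$. A point $P$ is hyper-osculating if $\mathrm{mult}_P(\Pi(n-1,P)\cap C)>n$. The $s$-th associated curve is the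 map $f_s:C\to\mathbb{G}(s,n)\subset\mathbb{P}^N$, $N=\binom{n+1}{s+1}-1$, into the Grassmannian of $s$-planes (Plücker embedded) sending a general point to its osculating $s$-plane; $b_s(P)$ denotes its ramification index at $P$. For $C=F_{k,n}$ (a curve of degree $k^{n-1}$ in $\mathbb{P}^n$), under the hypothesis that the characteristic of $K$ is zero or strictly greater than $k^{n-1}$, $b_s(P)=h_{s+1}-h_s-1$ for $0\le s\le n-1$, where $0=h_0<h_1<\cdots<h_n$ are the Hermite invariants at $P$, i.e. the orders of contact at $P$ of $C$ with hyperplanes of $\mathbb{P}^n$ (the vanishing orders at $P$ of the linear forms restricted to $C$).
   Formalization: The osculating s-plane at P is taken to be the unique s-plane of maximal contact with the curve at P (contact at least s+1), since for n≥3 the hyperplane with contact at least n is not unique at points of F(H_0), so the definition by that bound alone is ill-defined there. *)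

theory Defs
  imports
    "HOL-Library.Function_Algebras"
    "HOL-Library.Poly_Mapping"
    "HOL-Library.Extended_Nat"
    "HOL-Computational_Algebra.Polynomial"
    "Jordan_Normal_Form.Determinant"
begin

section \<open>Projective space and its linear subspaces\<close>

text \<open>
  The space \<open>K\<^sup>n\<^sup>+\<^sup>1\<close> underlying \<open>\<bbbP>\<^sup>n\<close> consists of the functions supported on \<open>{1..n + 1}\<close>.
  An \<open>s\<close>-plane of \<open>\<bbbP>\<^sup>n\<close> is identified with the linear subspace of dimension \<open>s + 1\<close> that it is
  the projectivisation of; in particular a point of \<open>\<bbbP>\<^sup>n\<close> is a line \<open>P\<close> through the origin, and the nonzero
  \<open>v \<in> P\<close> are its homogeneous coordinate vectors.
\<close>

global_interpretation fun_space: vector_space "\<lambda>(c::'a::field) (v::'i \<Rightarrow> 'a) i. c * v i"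
  by unfold_locales (simp_all add: fun_eq_iff algebra_simps)

definition coord_space :: "nat \<Rightarrow> (nat \<Rightarrow> 'a::field) set" where
  "coord_space n = {v. \<forall>i. i \<notin> {1..n + 1} \<longrightarrow> v i = 0}"

definition planes :: "nat \<Rightarrow> nat \<Rightarrow> (nat \<Rightarrow> 'a::field) set set" where
  "planes n s = {W. W \<subseteq> coord_space n \<and> fun_space.subspace W \<and> fun_space.dim W = s + 1}"

definition points :: "nat \<Rightarrow> (nat \<Rightarrow> 'a::field) set set" where
  "points n = planes n 0"

definition plucker_index :: "nat \<Rightarrow> nat \<Rightarrow> nat set set" where
  "plucker_index n s = {J. J \<subseteq> {1..n + 1} \<and> card J = s + 1}"

text \<open>
  Plucker coordinates are homogeneous: \<open>p\<close> is a Plucker vector of the \<open>s\<close>-plane \<open>W\<close> iff it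
  consists of the maximal minors of the matrix whose rows are some basis of \<open>W\<close>.
\<close>

definition is_plucker_vector ::
    "nat \<Rightarrow> nat \<Rightarrow> (nat \<Rightarrow> 'a::field) set \<Rightarrow> (nat set \<Rightarrow> 'a) \<Rightarrow> bool" where
  "is_plucker_vector n s W p \<longleftrightarrow> W \<in> planes n s \<and>
     (\<exists>w :: nat \<Rightarrow> nat \<Rightarrow> 'a. fun_space.span (w ` {..s}) = W \<and>
        (\<forall>J \<in> plucker_index n s.
           p J = det (mat (s + 1) (s + 1) (\<lambda>(i, j). w i (sorted_list_of_set J ! j)))))"


section \<open>Polynomials in the coordinates\<close>

type_synonym 'a mpoly = "(nat \<Rightarrow>\<^sub>0 nat) \<Rightarrow>\<^sub>0 'a"

definition polys :: "nat \<Rightarrow> 'a::zero mpoly set" where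
  "polys n = {F. \<forall>m \<in> Poly_Mapping.keys F. Poly_Mapping.keys m \<subseteq> {1..n + 1}}"

definition forms :: "nat \<Rightarrow> nat \<Rightarrow> 'a::zero mpoly set" where
  "forms n d = {F \<in> polys n. \<forall>m \<in> Poly_Mapping.keys F.
     (\<Sum>i \<in> Poly_Mapping.keys m. Poly_Mapping.lookup m i) = d}"

definition poly_at :: "'a::comm_semiring_1 mpoly \<Rightarrow> (nat \<Rightarrow> 'a) \<Rightarrow> 'a" where
  "poly_at F v = (\<Sum>m \<in> Poly_Mapping.keys F. Poly_Mapping.lookup F m *
     (\<Prod>i \<in> Poly_Mapping.keys m. v i ^ Poly_Mapping.lookup m i))"

definition vanishes_on :: "'a::comm_semiring_1 mpoly \<Rightarrow> (nat \<Rightarrow> 'a) set \<Rightarrow> bool" where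
  "vanishes_on F W \<longleftrightarrow> (\<forall>v \<in> W. poly_at F v = 0)"

definition vanishing_ideal :: "nat \<Rightarrow> (nat \<Rightarrow> 'a::field) set set \<Rightarrow> 'a mpoly set" where
  "vanishing_ideal n X = {F \<in> polys n. \<forall>P \<in> X. vanishes_on F P}"

text \<open>The \<open>m\<close>-th power of the ideal \<open>I\<close> of \<open>polys n\<close>; for \<open>m = 0\<close> this is the unit ideal.\<close>

definition ideal_power :: "nat \<Rightarrow> 'a::field mpoly set \<Rightarrow> nat \<Rightarrow> 'a mpoly set" where
  "ideal_power n I m =
     {(\<Sum>j<r. c j * (\<Prod>i<m. f j i)) | (r :: nat) c f.
        \<forall>j<r. c j \<in> polys n \<and> (\<forall>i<m. f j i \<in> I)}"


section \<open>Order of contact and osculating planes\<close>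

text \<open>
  Let \<open>P\<close> be a point of the smooth curve \<open>C \<subseteq> \<bbbP>\<^sup>n\<close> and \<open>F\<close> a form of degree \<open>d\<close>. If \<open>L\<close> is a
  linear form with \<open>L(P) \<noteq> 0\<close>, then \<open>F / L\<^sup>d\<close> lies in the \<open>m\<close>-th power of the maximal ideal of
  the local ring \<open>\<O>\<close> of \<open>C\<close> at \<open>P\<close> iff, after clearing denominators, some multiple \<open>G F\<close> with
  \<open>G(P) \<noteq> 0\<close> lies in \<open>I(P)\<^sup>m + I(C)\<close>. As \<open>\<O>\<close> is a discrete valuation ring, the supremum of
  these \<open>m\<close> is the vanishing order of \<open>F\<close> along \<open>C\<close> at \<open>P\<close>, which is infinite iff \<open>F\<close> vanishes
  on the component of \<open>C\<close> through \<open>P\<close>.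
\<close>

definition vanishes_to_order ::
    "nat \<Rightarrow> (nat \<Rightarrow> 'a::field) set set \<Rightarrow> (nat \<Rightarrow> 'a) set \<Rightarrow> 'a mpoly \<Rightarrow> nat \<Rightarrow> bool" where
  "vanishes_to_order n C P F m \<longleftrightarrow>
     (\<exists>e. \<exists>G \<in> forms n e. \<not> vanishes_on G P \<and>
        (\<exists>A \<in> ideal_power n (vanishing_ideal n {P}) m. \<exists>B \<in> vanishing_ideal n C.
           G * F = A + B))"

definition vanishing_order ::
    "nat \<Rightarrow> (nat \<Rightarrow> 'a::field) set set \<Rightarrow> (nat \<Rightarrow> 'a) set \<Rightarrow> 'a mpoly \<Rightarrow> enat" where
  "vanishing_order n C P F = Sup {enat m | m. vanishes_to_order n C P F m}"

text \<open>
  The order of contact of a plane \<open>W\<close> with \<open>C\<close> at \<open>P\<close>: the order in \<open>\<O>\<close> of the ideal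
  generated by the linear equations of \<open>W\<close>.
\<close>

definition contact_order ::
    "nat \<Rightarrow> (nat \<Rightarrow> 'a::field) set set \<Rightarrow> (nat \<Rightarrow> 'a) set \<Rightarrow> (nat \<Rightarrow> 'a) set \<Rightarrow> enat" where
  "contact_order n C P W = Inf {vanishing_order n C P L | L. L \<in> forms n 1 \<and> vanishes_on L W}"

text \<open>
  At a general point there is only one \<open>s\<close>-plane with order of contact at least \<open>s + 1\<close>. At
  special points there may be several (at an ordinary inflection point of a space curve every
  plane containing the tangent line has contact at least \<open>3\<close>); the osculating \<open>s\<close>-plane is then
  the unique one among them whose order of contact is maximal.
\<close>

definition osculating_plane ::
    "nat \<Rightarrow> (nat \<Rightarrow> 'a::field) set set \<Rightarrow> nat \<Rightarrow> (nat \<Rightarrow> 'a) set \<Rightarrow> (nat \<Rightarrow> 'a) set" where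
  "osculating_plane n C s P = (THE W. W \<in> planes n s \<and>
     contact_order n C P W \<ge> enat (s + 1) \<and>
     (\<forall>W' \<in> planes n s. contact_order n C P W' \<le> contact_order n C P W))"

definition hyper_osculating_points ::
    "nat \<Rightarrow> (nat \<Rightarrow> 'a::field) set set \<Rightarrow> (nat \<Rightarrow> 'a) set set" where
  "hyper_osculating_points n C =
     {P \<in> C. contact_order n C P (osculating_plane n C (n - 1) P) > enat n}"


section \<open>Associated curves and their ramification\<close>

text \<open>
  A family of forms of equal degree, indexed by the Plucker coordinates and not all vanishing
  at \<open>P\<close>, represents the \<open>s\<close>-th associated curve \<open>f\<^sub>s\<close> near \<open>P\<close> if it computes the osculating
  \<open>s\<close>-plane at all but finitely many points of \<open>C\<close>. For irreducible \<open>C\<close> this determines the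
  germ of the morphism \<open>f\<^sub>s\<close> at \<open>P\<close>.
\<close>

definition represents_associated_curve ::
    "nat \<Rightarrow> (nat \<Rightarrow> 'a::field) set set \<Rightarrow> nat \<Rightarrow> (nat \<Rightarrow> 'a) set \<Rightarrow> (nat set \<Rightarrow> 'a mpoly) \<Rightarrow> bool" where
  "represents_associated_curve n C s P G \<longleftrightarrow>
     (\<exists>d. \<forall>J \<in> plucker_index n s. G J \<in> forms n d) \<and>
     (\<exists>J \<in> plucker_index n s. \<not> vanishes_on (G J) P) \<and>
     finite {Q \<in> C. \<not> (\<forall>v \<in> Q - {0}.
       is_plucker_vector n s (osculating_plane n C s Q) (\<lambda>J. poly_at (G J) v))}"

text \<open>
  The order at \<open>P\<close> of the pullback under the map \<open>[G J]\<^sub>J\<close> of the maximal ideal of its image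
  point, i.e. the least vanishing order of the pullback of a hyperplane through that point.
\<close>

definition pullback_order ::
    "nat \<Rightarrow> (nat \<Rightarrow> 'a::field) set set \<Rightarrow> (nat \<Rightarrow> 'a) set \<Rightarrow> 'i set \<Rightarrow> ('i \<Rightarrow> 'a mpoly) \<Rightarrow> enat" where
  "pullback_order n C P A G = Inf {vanishing_order n C P F | F c.
     F = (\<Sum>J \<in> A. Poly_Mapping.single 0 (c J) * G J) \<and> vanishes_on F P}"

text \<open>
  The ramification index is normalised to be \<open>0\<close> where \<open>f\<^sub>s\<close> is an immersion: in a local
  parameter \<open>t\<close> at \<open>P\<close>, \<open>f\<^sub>s\<close> is constant up to terms of exact order \<open>b + 1\<close>.
\<close>

definition ramification_index ::
    "nat \<Rightarrow> (nat \<Rightarrow> 'a::field) set set \<Rightarrow> nat \<Rightarrow> (nat \<Rightarrow> 'a) set \<Rightarrow> nat" where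
  "ramification_index n C s P = (THE b. \<exists>G. represents_associated_curve n C s P G \<and>
     pullback_order n C P (plucker_index n s) G = enat (b + 1))"


section \<open>Generalized Fermat curves\<close>

text \<open>The parameter \<open>\<lambda>\<^sub>0 = 1\<close> is built in, so the value of \<open>l\<close> at \<open>0\<close> is irrelevant.\<close>

definition fermat_curve :: "nat \<Rightarrow> nat \<Rightarrow> (nat \<Rightarrow> 'a::field) \<Rightarrow> (nat \<Rightarrow> 'a) set set" where
  "fermat_curve k n l = {P \<in> points n. \<forall>v \<in> P. \<forall>i \<le> n - 2.
     (if i = 0 then 1 else l i) * v 1 ^ k + v 2 ^ k + v (3 + i) ^ k = 0}"

definition is_primitive_root :: "nat \<Rightarrow> 'a::field \<Rightarrow> bool" where
  "is_primitive_root k z \<longleftrightarrow> z ^ k = 1 \<and> (\<forall>m. 0 < m \<and> m < k \<longrightarrow> z ^ m \<noteq> 1)"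

definition H0_generators :: "nat \<Rightarrow> nat \<Rightarrow> ((nat \<Rightarrow> 'a::field) \<Rightarrow> (nat \<Rightarrow> 'a)) set" where
  "H0_generators k n =
     {(\<lambda>v. v(j := z * v j)) | j z. j \<in> {1..n + 1} \<and> is_primitive_root k z}"

definition H0_fixed_points :: "nat \<Rightarrow> nat \<Rightarrow> (nat \<Rightarrow> 'a::field) \<Rightarrow> (nat \<Rightarrow> 'a) set set" where
  "H0_fixed_points k n l = {P \<in> fermat_curve k n l. \<exists>g \<in> H0_generators k n. g ` P = P}"

end

theory Submission
  imports Defs "HOL-Computational_Algebra.Computational_Algebra"
begin

text \<open>
  The \<open>k\<close>-th powers \<open>u\<^sub>i = x\<^sub>i\<^sup>k\<close> map the curve onto a line in \<open>\<bbbP>\<^sup>n\<close>, so near a point \<open>[v]\<close> it is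
  parametrised by the power series \<open>v\<^sub>i (1 + c\<^sub>i t)\<^sup>1\<^sup>/\<^sup>k\<close> with pairwise different \<open>c\<^sub>i\<close>; at a point with
  \<open>v\<^sub>j = 0\<close> one takes \<open>t\<close> in coordinate \<open>j\<close> and \<open>v\<^sub>i (1 + c\<^sub>i t\<^sup>k)\<^sup>1\<^sup>/\<^sup>k\<close> in the others. The characteristic is
  large enough for the first \<open>n + 1\<close> coefficients of \<open>(1 + x)\<^sup>1\<^sup>/\<^sup>k\<close> to be nonzero, so by a Vandermonde
  argument linear forms have the vanishing orders \<open>0, 1, \<dots>, n\<close> in the first case and
  \<open>0, 1, k, 2k, \<dots>, (n - 1)k\<close> in the second. This gives the hyper-osculating points.

  Away from the fixed points the osculating \<open>s\<close>-plane has the Plucker coordinates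
  \<open>E\<^sub>J \<Prod>\<^bsub>i \<notin> J\<^esub> x\<^sub>i\<^sup>k\<^sup>s\<^sup>-\<^sup>1\<close> with nonzero constants \<open>E\<^sub>J\<close>. They do not all vanish at a fixed point, hence
  represent the associated curve there, and its ramification can be read off: the terms with
  \<open>j \<in> J\<close> are power series in \<open>t\<^sup>k\<close>, those with \<open>j \<notin> J\<close> start with \<open>t\<^sup>k\<^sup>s\<^sup>-\<^sup>1\<close>.
\<close>

section \<open>Evaluation of polynomials in a power series ring\<close>

text \<open>Contact is defined through ideals, by membership of a multiple of the form in
  \<open>I(P)^m + I(C)\<close>, but it is computed from coefficients of a formal branch, so the two
  have to be matched. A branch consists of power series, not of points; that a polynomial vanishing
  at all points of the curve also vanishes along it needs an argument. The symmetry provides it: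
  scaling coordinates by \<open>k\<close>-th roots of unity splits the polynomial into parts that
  depend, up to a common monomial, only on the \<open>k\<close>-th powers, and these are linear in
  one parameter. Conversely, high order along the branch must produce membership in the ideal; for
  this a single linear form is shown to generate the maximal ideal at the point.

  The associated curve is given only off finitely many points and up to the choice of the
  representing forms. Exceptional points can be removed by linear forms that do not vanish along the
  branch, so any two representations differ along it by an invertible series, and one explicit
  representation decides the ramification.\<close>

lemma poly_mapping_sum_single:
  "F = (\<Sum>m \<in> Poly_Mapping.keys F. Poly_Mapping.single m (Poly_Mapping.lookup F m))"
  by (rule poly_mapping_eqI)
     (auto simp: lookup_sum lookup_single when_def in_keys_iff sum.delta)

definition monom_at :: "(nat \<Rightarrow>\<^sub>0 nat) \<Rightarrow> (nat \<Rightarrow> 'b::comm_semiring_1) \<Rightarrow> 'b" where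
  "monom_at m w = (\<Prod>i \<in> Poly_Mapping.keys m. w i ^ Poly_Mapping.lookup m i)"

lemma monom_at_superset:
  assumes "finite S" "Poly_Mapping.keys m \<subseteq> S"
  shows "monom_at m w = (\<Prod>i \<in> S. w i ^ Poly_Mapping.lookup m i)"
  unfolding monom_at_def
  by (rule prod.mono_neutral_left) (use assms in \<open>auto simp: in_keys_iff\<close>)

lemma monom_at_add: "monom_at (a + b) w = monom_at a w * monom_at b w"
proof -
  let ?S = "Poly_Mapping.keys a \<union> Poly_Mapping.keys b"
  have "Poly_Mapping.keys (a + b) \<subseteq> ?S" by (rule keys_add)
  then show ?thesis
    by (simp add: monom_at_superset[of ?S] lookup_add power_add prod.distrib)
qed

lemma monom_at_0 [simp]: "monom_at 0 w = 1"
  by (simp add: monom_at_def)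

lemma monom_at_single [simp]: "monom_at (Poly_Mapping.single i e) w = w i ^ e"
  by (cases "e = 0") (auto simp: monom_at_def)

text \<open>The coefficient map \<open>h\<close> lets one definition serve twice: the identity gives
  values at points, \<open>fps_const\<close> gives pullbacks along a branch.\<close>

definition eval_at ::
    "('a::comm_ring_1 \<Rightarrow> 'b::comm_ring_1) \<Rightarrow> 'a mpoly \<Rightarrow> (nat \<Rightarrow> 'b) \<Rightarrow> 'b" where
  "eval_at h F w = (\<Sum>m \<in> Poly_Mapping.keys F. h (Poly_Mapping.lookup F m) * monom_at m w)"

context comm_ring_hom
begin

lemma eval_at_superset:
  assumes "finite S" "Poly_Mapping.keys F \<subseteq> S"
  shows "eval_at hom F w = (\<Sum>m \<in> S. hom (Poly_Mapping.lookup F m) * monom_at m w)"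
  unfolding eval_at_def
  by (rule sum.mono_neutral_left) (use assms in \<open>auto simp: in_keys_iff\<close>)

lemma eval_at_0 [simp]: "eval_at hom 0 w = 0"
  by (simp add: eval_at_def)

lemma eval_at_single [simp]: "eval_at hom (Poly_Mapping.single m a) w = hom a * monom_at m w"
  by (cases "a = 0") (auto simp: eval_at_def)

lemma eval_at_1 [simp]: "eval_at hom 1 w = 1"
  using eval_at_single[of 0 1 w] by simp

lemma eval_at_add: "eval_at hom (F + G) w = eval_at hom F w + eval_at hom G w"
proof -
  let ?S = "Poly_Mapping.keys F \<union> Poly_Mapping.keys G"
  have "Poly_Mapping.keys (F + G) \<subseteq> ?S" by (rule keys_add)
  then show ?thesis
    by (simp add: eval_at_superset[of ?S] lookup_add hom_add distrib_right sum.distrib)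
qed

lemma eval_at_uminus: "eval_at hom (- F) w = - eval_at hom F w"
  using eval_at_add[of F "- F" w] by (simp add: eq_neg_iff_add_eq_0 add.commute)

lemma eval_at_diff: "eval_at hom (F - G) w = eval_at hom F w - eval_at hom G w"
  using eval_at_add[of F "- G" w] by (simp add: eval_at_uminus)

lemma eval_at_sum: "eval_at hom (sum f A) w = (\<Sum>x\<in>A. eval_at hom (f x) w)"
  by (induction A rule: infinite_finite_induct) (auto simp: eval_at_add)

lemma eval_at_mult: "eval_at hom (F * G) w = eval_at hom F w * eval_at hom G w"
proof -
  have "F * G = (\<Sum>a \<in> Poly_Mapping.keys F. \<Sum>b \<in> Poly_Mapping.keys G.
      Poly_Mapping.single (a + b) (Poly_Mapping.lookup F a * Poly_Mapping.lookup G b))"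
    by (subst (1) poly_mapping_sum_single[of F], subst (1) poly_mapping_sum_single[of G])
       (simp add: sum_product mult_single)
  then have "eval_at hom (F * G) w = (\<Sum>a \<in> Poly_Mapping.keys F. \<Sum>b \<in> Poly_Mapping.keys G.
      hom (Poly_Mapping.lookup F a * Poly_Mapping.lookup G b) * monom_at (a + b) w)"
    by (simp only: eval_at_sum eval_at_single)
  then show ?thesis
    by (simp add: hom_mult monom_at_add eval_at_def sum_product mult_ac)
qed

lemma eval_at_prod: "eval_at hom (prod f A) w = (\<Prod>x\<in>A. eval_at hom (f x) w)"
  by (induction A rule: infinite_finite_induct) (auto simp: eval_at_mult)

lemma eval_at_power: "eval_at hom (F ^ e) w = eval_at hom F w ^ e"
  by (induction e) (auto simp: eval_at_mult)

end

lemma poly_at_eq: "poly_at F v = eval_at (\<lambda>x. x) F v"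
  by (simp add: poly_at_def eval_at_def monom_at_def)

lemma comm_ring_hom_id: "comm_ring_hom (\<lambda>x::'a::comm_ring_1. x)"
  by unfold_locales auto

lemma comm_ring_hom_fps_const: "comm_ring_hom (fps_const :: 'a::comm_ring_1 \<Rightarrow> 'a fps)"
  by unfold_locales auto

lemmas poly_at_simps = comm_ring_hom.eval_at_0[OF comm_ring_hom_id, folded poly_at_eq] comm_ring_hom.eval_at_1[OF comm_ring_hom_id, folded poly_at_eq]
  comm_ring_hom.eval_at_single[OF comm_ring_hom_id, folded poly_at_eq] comm_ring_hom.eval_at_add[OF comm_ring_hom_id, folded poly_at_eq]
  comm_ring_hom.eval_at_diff[OF comm_ring_hom_id, folded poly_at_eq] comm_ring_hom.eval_at_mult[OF comm_ring_hom_id, folded poly_at_eq]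
  comm_ring_hom.eval_at_prod[OF comm_ring_hom_id, folded poly_at_eq] comm_ring_hom.eval_at_sum[OF comm_ring_hom_id, folded poly_at_eq]
  comm_ring_hom.eval_at_power[OF comm_ring_hom_id, folded poly_at_eq]

abbreviation pullback :: "'a::comm_ring_1 mpoly \<Rightarrow> (nat \<Rightarrow> 'a fps) \<Rightarrow> 'a fps" where
  "pullback \<equiv> eval_at fps_const"

lemmas pullback_simps = comm_ring_hom.eval_at_0[OF comm_ring_hom_fps_const] comm_ring_hom.eval_at_1[OF comm_ring_hom_fps_const]
  comm_ring_hom.eval_at_single[OF comm_ring_hom_fps_const] comm_ring_hom.eval_at_add[OF comm_ring_hom_fps_const] comm_ring_hom.eval_at_diff[OF comm_ring_hom_fps_const]
  comm_ring_hom.eval_at_mult[OF comm_ring_hom_fps_const] comm_ring_hom.eval_at_prod[OF comm_ring_hom_fps_const] comm_ring_hom.eval_at_sum[OF comm_ring_hom_fps_const] comm_ring_hom.eval_at_power[OF comm_ring_hom_fps_const]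

lemma fps_nth_0_prod: "fps_nth (prod f A) 0 = (\<Prod>x\<in>A. fps_nth (f x) 0)"
  for f :: "'i \<Rightarrow> 'a::comm_ring_1 fps"
  by (induction A rule: infinite_finite_induct) auto

lemma pullback_nth_0: "fps_nth (pullback F \<gamma>) 0 = poly_at F (\<lambda>i. fps_nth (\<gamma> i) 0)"
  by (simp add: eval_at_def poly_at_def monom_at_def fps_sum_nth fps_nth_0_prod
      fps_nth_power_0)

section \<open>Forms\<close>

lemma polys_0 [simp]: "0 \<in> polys n"
  by (auto simp: polys_def)

lemma polys_add: "F \<in> polys n \<Longrightarrow> G \<in> polys n \<Longrightarrow> F + G \<in> polys n"
  using keys_add[of F G] by (auto simp: polys_def)

lemma polys_mult: "F \<in> polys n \<Longrightarrow> G \<in> polys n \<Longrightarrow> F * G \<in> polys n"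
proof -
  assume *: "F \<in> polys n" "G \<in> polys n"
  show ?thesis unfolding polys_def
  proof safe
    fix m i assume "m \<in> Poly_Mapping.keys (F * G)" and i: "i \<in> Poly_Mapping.keys m"
    then obtain a b where "m = a + b" "a \<in> Poly_Mapping.keys F" "b \<in> Poly_Mapping.keys G"
      using keys_mult[of F G] by blast
    then show "i \<in> {1..n + 1}" using * i subsetD[OF keys_add[of a b]] unfolding polys_def by blast
  qed
qed

lemma mdeg_superset:
  assumes "finite S" "Poly_Mapping.keys m \<subseteq> S"
  shows "(\<Sum>i \<in> Poly_Mapping.keys m. Poly_Mapping.lookup m i) = (\<Sum>i\<in>S. Poly_Mapping.lookup m i)"
  by (rule sum.mono_neutral_left) (use assms in \<open>auto simp: in_keys_iff\<close>)

lemma mdeg_add: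
  fixes a b :: "nat \<Rightarrow>\<^sub>0 nat"
  shows "(\<Sum>i \<in> Poly_Mapping.keys (a + b). Poly_Mapping.lookup (a + b) i) =
   (\<Sum>i \<in> Poly_Mapping.keys a. Poly_Mapping.lookup a i) + (\<Sum>i \<in> Poly_Mapping.keys b. Poly_Mapping.lookup b i)"
proof -
  let ?S = "Poly_Mapping.keys a \<union> Poly_Mapping.keys b"
  have "Poly_Mapping.keys (a + b) \<subseteq> ?S" by (rule keys_add)
  then have "(\<Sum>i \<in> Poly_Mapping.keys (a + b). Poly_Mapping.lookup (a + b) i)
      = (\<Sum>i \<in> ?S. Poly_Mapping.lookup (a + b) i)"
    by (intro mdeg_superset) auto
  then show ?thesis
    by (simp add: mdeg_superset[of ?S a] mdeg_superset[of ?S b] lookup_add sum.distrib)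
qed

lemma formsD: "F \<in> forms n d \<Longrightarrow> F \<in> polys n"
  by (simp add: forms_def)

lemma forms_0 [simp]: "0 \<in> forms n d"
  by (auto simp: forms_def)

lemma forms_add: "F \<in> forms n d \<Longrightarrow> G \<in> forms n d \<Longrightarrow> F + G \<in> forms n d"
  using keys_add[of F G] by (auto simp: forms_def polys_add)

lemma forms_uminus: "F \<in> forms n d \<Longrightarrow> - F \<in> forms n d" for F :: "'a::comm_ring_1 mpoly"
  by (auto simp: forms_def polys_def in_keys_iff)

lemma forms_diff: "F \<in> forms n d \<Longrightarrow> G \<in> forms n d \<Longrightarrow> F - G \<in> forms n d"
  for F :: "'a::comm_ring_1 mpoly"
  using forms_add[of F n d "- G"] forms_uminus[of G n d] by simp

lemma forms_sum: "(\<And>x. x \<in> A \<Longrightarrow> f x \<in> forms n d) \<Longrightarrow> sum f A \<in> forms n d"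
  by (induction A rule: infinite_finite_induct) (auto simp: forms_add)

lemma forms_mult: "F \<in> forms n d \<Longrightarrow> G \<in> forms n e \<Longrightarrow> F * G \<in> forms n (d + e)"
proof -
  assume *: "F \<in> forms n d" "G \<in> forms n e"
  { fix m assume "m \<in> Poly_Mapping.keys (F * G)"
    then obtain a b where "m = a + b" "a \<in> Poly_Mapping.keys F" "b \<in> Poly_Mapping.keys G"
      using keys_mult[of F G] by blast
    then have "(\<Sum>i \<in> Poly_Mapping.keys m. Poly_Mapping.lookup m i) = d + e"
      using * mdeg_add[of a b] by (auto simp: forms_def) }
  with * show ?thesis by (auto simp: forms_def polys_mult)
qed

lemma forms_const: "Poly_Mapping.single 0 c \<in> forms n 0"
  by (auto simp: forms_def polys_def)

lemma forms_1 [simp]: "(1 :: 'a::comm_ring_1 mpoly) \<in> forms n 0"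
  using forms_const[of "1::'a" n] by simp

lemma forms_scale: "F \<in> forms n d \<Longrightarrow> Poly_Mapping.single 0 c * F \<in> forms n d"
  using forms_mult[OF forms_const, of F n d c] by simp

lemma forms_power: "F \<in> forms n d \<Longrightarrow> F ^ e \<in> forms n (d * e)" for F :: "'a::comm_ring_1 mpoly"
  by (induction e) (auto dest: forms_mult[of F n d])

lemma forms_prod:
  fixes f :: "'i \<Rightarrow> 'a::comm_ring_1 mpoly"
  shows "finite A \<Longrightarrow> (\<And>x. x \<in> A \<Longrightarrow> f x \<in> forms n (d x)) \<Longrightarrow> prod f A \<in> forms n (sum d A)"
  by (induction A rule: finite_induct) (auto simp: forms_mult)

definition mvar :: "nat \<Rightarrow> 'a::comm_ring_1 mpoly" where
  "mvar i = Poly_Mapping.single (Poly_Mapping.single i 1) 1"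

lemma mvar_forms: "i \<in> {1..n + 1} \<Longrightarrow> mvar i \<in> forms n 1"
  by (auto simp: mvar_def forms_def polys_def)

lemma poly_at_mvar [simp]: "poly_at (mvar i) v = v i"
  by (simp add: mvar_def poly_at_simps)

lemma pullback_mvar [simp]: "pullback (mvar i) \<gamma> = \<gamma> i"
  by (simp add: mvar_def pullback_simps)

lemma poly_at_const [simp]: "poly_at (Poly_Mapping.single 0 c) v = c" for c :: "'a::comm_ring_1"
  by (simp add: poly_at_simps)

lemma pullback_const [simp]: "pullback (Poly_Mapping.single 0 c) \<gamma> = fps_const c"
  by (simp add: pullback_simps)

definition linear_form :: "nat \<Rightarrow> (nat \<Rightarrow> 'a::comm_ring_1) \<Rightarrow> 'a mpoly" where
  "linear_form n a = (\<Sum>i = 1..n + 1. Poly_Mapping.single 0 (a i) * mvar i)"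

lemma linear_form_forms: "linear_form n a \<in> forms n 1"
  unfolding linear_form_def by (intro forms_sum forms_scale mvar_forms)

lemma poly_at_linear_form: "poly_at (linear_form n a) v = (\<Sum>i = 1..n + 1. a i * v i)"
  by (simp add: linear_form_def poly_at_simps del: One_nat_def sum.cl_ivl_Suc)

lemma pullback_linear_form:
  "pullback (linear_form n a) \<gamma> = (\<Sum>i = 1..n + 1. fps_const (a i) * \<gamma> i)"
  by (simp add: linear_form_def pullback_simps del: One_nat_def sum.cl_ivl_Suc)

text \<open>Splitting off one variable is the induction step on the degree, both for recognising
  linear forms and for reducing monomials modulo \<open>tau\<close>.\<close>

lemma mdeg_Suc_split:
  fixes m :: "nat \<Rightarrow>\<^sub>0 nat"
  assumes "(\<Sum>i \<in> Poly_Mapping.keys m. Poly_Mapping.lookup m i) = Suc d"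
  obtains i m' where "i \<in> Poly_Mapping.keys m" "m = Poly_Mapping.single i 1 + m'"
    "(\<Sum>i \<in> Poly_Mapping.keys m'. Poly_Mapping.lookup m' i) = d"
proof -
  from assms have "Poly_Mapping.keys m \<noteq> {}" by auto
  then obtain i where i: "i \<in> Poly_Mapping.keys m" by blast
  define m' where "m' = m - Poly_Mapping.single i 1"
  have m: "m = Poly_Mapping.single i 1 + m'"
    using i by (intro poly_mapping_eqI)
      (auto simp: m'_def lookup_add lookup_minus lookup_single when_def in_keys_iff)
  have "(\<Sum>i \<in> Poly_Mapping.keys m'. Poly_Mapping.lookup m' i) = d"
    using assms mdeg_add[of "Poly_Mapping.single i 1" m'] unfolding m[symmetric] by simp
  with i m show ?thesis using that by blast
qed

lemma mdeg_0D: "(\<Sum>i \<in> Poly_Mapping.keys m. Poly_Mapping.lookup m i) = (0::nat) \<Longrightarrow> m = 0"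
  by (rule poly_mapping_eqI) (auto simp: in_keys_iff)

lemma linear_formE:
  assumes "L \<in> forms n 1"
  obtains a where "L = linear_form n (a :: nat \<Rightarrow> 'a::comm_ring_1)"
proof
  let ?a = "\<lambda>i. Poly_Mapping.lookup L (Poly_Mapping.single i 1)"
  have sub: "Poly_Mapping.keys L \<subseteq> (\<lambda>i. Poly_Mapping.single i 1) ` {1..n + 1}"
  proof
    fix m assume m: "m \<in> Poly_Mapping.keys L"
    then obtain i m' where "i \<in> Poly_Mapping.keys m" "m = Poly_Mapping.single i 1 + m'"
      "(\<Sum>i \<in> Poly_Mapping.keys m'. Poly_Mapping.lookup m' i) = 0"
      using assms mdeg_Suc_split[of m 0] by (auto simp: forms_def)
    then show "m \<in> (\<lambda>i. Poly_Mapping.single i 1) ` {1..n + 1}"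
      using assms m mdeg_0D[of m'] by (auto simp: forms_def polys_def)
  qed
  have "L = (\<Sum>m \<in> Poly_Mapping.keys L. Poly_Mapping.single m (Poly_Mapping.lookup L m))"
    by (rule poly_mapping_sum_single)
  also have "\<dots> = (\<Sum>m \<in> (\<lambda>i. Poly_Mapping.single i 1) ` {1..n + 1}.
      Poly_Mapping.single m (Poly_Mapping.lookup L m))"
    by (rule sum.mono_neutral_left) (use sub in \<open>auto simp: in_keys_iff\<close>)
  also have "\<dots> = (\<Sum>i = 1..n + 1. Poly_Mapping.single (Poly_Mapping.single i 1) (?a i))"
    by (rule sum.reindex_cong[OF _ refl]) (auto simp: inj_on_def dest!: arg_cong[where f=Poly_Mapping.keys])
  also have "\<dots> = linear_form n ?a"
    by (simp add: linear_form_def mvar_def mult_single del: One_nat_def sum.cl_ivl_Suc)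
  finally show "L = linear_form n ?a" .
qed

lemma monom_at_scale:
  "monom_at m (\<lambda>i. c * v i) = c ^ (\<Sum>i \<in> Poly_Mapping.keys m. Poly_Mapping.lookup m i) * monom_at m v"
  by (simp add: monom_at_def power_mult_distrib prod.distrib power_sum)

lemma poly_at_scale:
  fixes F :: "'a::comm_ring_1 mpoly"
  assumes "F \<in> forms n d"
  shows "poly_at F (\<lambda>i. c * v i) = c ^ d * poly_at F v"
proof -
  have "poly_at F (\<lambda>i. c * v i) = (\<Sum>m\<in>Poly_Mapping.keys F. Poly_Mapping.lookup F m * (c ^ d * monom_at m v))"
    unfolding poly_at_eq eval_at_def
    by (rule sum.cong) (use assms in \<open>auto simp: forms_def monom_at_scale\<close>)
  also have "\<dots> = c ^ d * poly_at F v"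
    by (simp add: poly_at_eq eval_at_def sum_distrib_left mult_ac)
  finally show ?thesis .
qed

section \<open>Linear algebra\<close>

lemma fun_subspace_iff: "fun_space.subspace W \<longleftrightarrow> 0 \<in> W \<and> (\<forall>x\<in>W. \<forall>y\<in>W. x + y \<in> W) \<and>
    (\<forall>c. \<forall>x\<in>W. (\<lambda>i. c * x i) \<in> W)" for W :: "('i \<Rightarrow> 'a::field) set"
  by (simp add: fun_space.subspace_def)

definition dot :: "nat \<Rightarrow> (nat \<Rightarrow> 'a::field) \<Rightarrow> (nat \<Rightarrow> 'a) \<Rightarrow> 'a" where
  "dot n a v = (\<Sum>i = 1..n + 1. a i * v i)"

lemma dot_simps: "dot n a 0 = 0" "dot n a (x + y) = dot n a x + dot n a y"
  "dot n a (\<lambda>i. c * x i) = c * dot n a x"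
  by (simp_all add: dot_def distrib_left sum.distrib sum_distrib_left mult_ac
      del: One_nat_def sum.cl_ivl_Suc)

lemma subspace_dot_0: "fun_space.subspace {v. dot n a v = 0}"
  by (simp add: fun_subspace_iff dot_simps)

lemma dot_span_0:
  assumes "v \<in> fun_space.span S" "\<And>x. x \<in> S \<Longrightarrow> dot n a x = 0"
  shows "dot n a v = 0"
  using fun_space.span_minimal[OF _ subspace_dot_0, of S n a] assms by auto

definition unit :: "nat \<Rightarrow> nat \<Rightarrow> 'a::field" where
  "unit j = (\<lambda>i. if i = j then 1 else 0)"

lemma subspace_coord_space: "fun_space.subspace (coord_space n)"
  by (auto simp: fun_subspace_iff coord_space_def)

lemma fun_sum_apply: "(sum f A) x = (\<Sum>i\<in>A. f i x)" for f :: "'i \<Rightarrow> 'b \<Rightarrow> 'a::comm_monoid_add"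
  by (induction A rule: infinite_finite_induct) auto

lemma coord_space_expand:
  assumes "v \<in> coord_space n"
  shows "v = (\<Sum>j = 1..n + 1. (\<lambda>i. v j * unit j i))"
  using assms by (auto simp: fun_eq_iff fun_sum_apply unit_def coord_space_def if_distrib
      cong: if_cong simp del: sum.cl_ivl_Suc One_nat_def)

lemma unit_in_coord_space: "j \<in> {1..n + 1} \<Longrightarrow> unit j \<in> coord_space n"
  by (auto simp: unit_def coord_space_def)

lemma coord_space_eq_span:
  "(coord_space n :: (nat \<Rightarrow> 'a::field) set) = fun_space.span (unit ` {1..n + 1})"
proof
  show "fun_space.span (unit ` {1..n + 1}) \<subseteq> (coord_space n :: (nat \<Rightarrow> 'a) set)"
    by (intro fun_space.span_minimal subspace_coord_space) (auto intro!: unit_in_coord_space)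
  show "(coord_space n :: (nat \<Rightarrow> 'a) set) \<subseteq> fun_space.span (unit ` {1..n + 1})"
  proof
    fix v :: "nat \<Rightarrow> 'a" assume v: "v \<in> coord_space n"
    have "(\<Sum>j = 1..n + 1. (\<lambda>i. v j * unit j i)) \<in> fun_space.span (unit ` {1..n + 1})"
      by (intro fun_space.span_sum fun_space.span_scale fun_space.span_base imageI)
    then show "v \<in> fun_space.span (unit ` {1..n + 1})"
      using coord_space_expand[OF v] by simp
  qed
qed

lemma independent_unit: "fun_space.independent (unit ` J :: (nat \<Rightarrow> 'a::field) set)"
  unfolding fun_space.dependent_def
proof clarify
  fix j assume "j \<in> J" and "unit j \<in> fun_space.span (unit ` J - {unit j} :: (nat \<Rightarrow> 'a) set)"
  moreover have "fun_space.span (unit ` J - {unit j}) \<subseteq> {v :: nat \<Rightarrow> 'a. v j = 0}"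
    by (rule fun_space.span_minimal) (auto simp: unit_def fun_subspace_iff)
  ultimately show False by (auto simp: unit_def)
qed

lemma dim_coord_space: "fun_space.dim (coord_space n :: (nat \<Rightarrow> 'a::field) set) = n + 1"
proof -
  have "inj_on (unit :: nat \<Rightarrow> nat \<Rightarrow> 'a) {1..n + 1}"
    by (auto simp: inj_on_def unit_def fun_eq_iff split: if_splits)
  then show ?thesis
    unfolding coord_space_eq_span fun_space.dim_span_eq_card_independent[OF independent_unit]
    by (simp add: card_image)
qed

text \<open>A basis of \<open>W\<close> stays independent after adding \<open>x\<close>, so a
  functional exists that is 0 on \<open>W\<close> and 1 at \<open>x\<close>; on
  \<open>coord_space n\<close> it is \<open>dot\<close> with its values at the unit vectors. This
  turns a failing inclusion of planes into a linear form, for which there are vanishing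
  orders.\<close>

lemma separating_functional:
  fixes W :: "(nat \<Rightarrow> 'a::field) set"
  assumes W: "fun_space.subspace W" "W \<subseteq> coord_space n" and x: "x \<in> coord_space n" "x \<notin> W"
  obtains a where "\<And>v. v \<in> W \<Longrightarrow> dot n a v = 0" "dot n a x \<noteq> 0"
proof -
  interpret vp: vector_space_pair "\<lambda>(c::'a) (v::nat \<Rightarrow> 'a) i. c * v i" "(*) :: 'a \<Rightarrow> 'a \<Rightarrow> 'a"
    by unfold_locales (simp_all add: algebra_simps)
  obtain B where B: "B \<subseteq> W" "fun_space.independent B" "W \<subseteq> fun_space.span B"
    using fun_space.basis_exists by metis
  have "fun_space.span B = W"
    using B W fun_space.span_minimal by blast
  then have "fun_space.independent (insert x B)"
    using x B(2) by (intro fun_space.independent_insertI) auto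
  then obtain g where g: "Vector_Spaces.linear (\<lambda>(c::'a) (v::nat \<Rightarrow> 'a) i. c * v i) (*) g"
    and gv: "\<forall>v\<in>insert x B. g v = (if v = x then 1 else 0)"
    using vp.linear_independent_extend[where f = "\<lambda>v. if v = x then 1 else 0"] by blast
  have add: "g (u + v) = g u + g v" and scale: "g (\<lambda>i. c * v i) = c * g v" for u v c
    using g unfolding Vector_Spaces.linear_iff by blast+
  have g0: "g 0 = 0" using scale[of 0 0] by (simp add: zero_fun_def)
  have gsum: "g (sum f A) = (\<Sum>j\<in>A. g (f j))" for f :: "nat \<Rightarrow> nat \<Rightarrow> 'a" and A
    by (induction A rule: infinite_finite_induct) (simp_all only: sum.infinite sum.empty sum.insert g0 add not_False_eq_True)
  have dot: "dot n (\<lambda>i. g (unit i)) v = g v" if "v \<in> coord_space n" for v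
  proof -
    have "g v = g (\<Sum>j = 1..n + 1. (\<lambda>i. v j * unit j i))"
      using coord_space_expand[OF that] by simp
    also have "\<dots> = dot n (\<lambda>i. g (unit i)) v"
      unfolding gsum scale dot_def by (simp only: mult.commute)
    finally show ?thesis by simp
  qed
  have "B \<subseteq> {v. g v = 0}" using gv x B(1) by auto
  moreover have "fun_space.subspace {v. g v = 0}"
    by (auto simp: fun_subspace_iff g0 add scale)
  ultimately have "W \<subseteq> {v. g v = 0}"
    using B(3) fun_space.span_minimal by blast
  then have "dot n (\<lambda>i. g (unit i)) v = 0" if "v \<in> W" for v
  proof -
    have "v \<in> coord_space n" "g v = 0"
      using that W(2) \<open>W \<subseteq> {v. g v = 0}\<close> by blast+
    then show ?thesis using dot[of v] by simp
  qed
  moreover have "dot n (\<lambda>i. g (unit i)) x \<noteq> 0"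
    using dot[OF x(1)] gv by simp
  ultimately show ?thesis by (rule that)
qed

text \<open>Dual form of spanning: for jets, the assumption on \<open>a\<close> becomes a
  Vandermonde system.\<close>

lemma span_eq_coord_space_iff_dual:
  assumes "\<And>i. i \<in> I \<Longrightarrow> e i \<in> coord_space n"
    and "\<And>a. (\<And>i. i \<in> I \<Longrightarrow> dot n a (e i) = 0) \<Longrightarrow> (\<And>i. i \<in> {1..n + 1} \<Longrightarrow> a i = 0)"
  shows "fun_space.span (e ` I) = coord_space n"
proof (rule ccontr)
  assume neq: "\<not> ?thesis"
  have sub: "fun_space.span (e ` I) \<subseteq> coord_space n"
    using assms(1) by (intro fun_space.span_minimal subspace_coord_space) auto
  with neq obtain x where "x \<in> coord_space n" "x \<notin> fun_space.span (e ` I)" by auto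
  then obtain a where a: "\<And>v. v \<in> fun_space.span (e ` I) \<Longrightarrow> dot n a v = 0" "dot n a x \<noteq> 0"
    using separating_functional[OF fun_space.subspace_span sub] by metis
  then have "a i = 0" if "i \<in> {1..n + 1}" for i
    using assms(2)[of a i] that by (auto intro: fun_space.span_base)
  then have "dot n a x = 0" by (simp add: dot_def)
  with a show False by simp
qed

lemma independent_if_card_eq_dim:
  assumes "finite S" "card S \<le> fun_space.dim (fun_space.span S)"
  shows "fun_space.independent S"
proof
  assume "fun_space.dependent S"
  then obtain a where a: "a \<in> S" "a \<in> fun_space.span (S - {a})"
    by (auto simp: fun_space.dependent_def)
  then have "fun_space.span S \<subseteq> fun_space.span (S - {a})"
    by (intro fun_space.span_minimal) (auto intro: fun_space.span_base)
  then have "fun_space.dim (fun_space.span S) \<le> card (S - {a})"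
    using assms(1) by (intro fun_space.dim_le_card) auto
  with assms a show False by (metis card_Diff1_less not_le order.trans)
qed

lemma subspace_eq_if_dim_eq:
  assumes "fun_space.subspace V" "fun_space.subspace W" "V \<subseteq> W"
    "fun_space.dim V = fun_space.dim W" "fun_space.dim W > 0"
  shows "V = W"
proof (rule ccontr)
  assume "V \<noteq> W"
  then obtain x where x: "x \<in> W" "x \<notin> V" using assms(3) by auto
  obtain A where A: "A \<subseteq> V" "fun_space.independent A" "V \<subseteq> fun_space.span A" "card A = fun_space.dim V"
    using fun_space.basis_exists by metis
  obtain B where B: "B \<subseteq> W" "fun_space.independent B" "W \<subseteq> fun_space.span B" "card B = fun_space.dim W"
    using fun_space.basis_exists by metis
  \<comment> \<open>An infinite set has \<open>card\<close> 0, so the positive dimension is what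
    makes these bases finite.\<close>
  have fin: "finite A" "finite B" using A(4) B(4) assms by (auto intro: card_ge_0_finite)
  have "fun_space.span A = V" using A assms(1) fun_space.span_minimal by blast
  then have "fun_space.independent (insert x A)"
    using x A(2) by (intro fun_space.independent_insertI) auto
  moreover have "insert x A \<subseteq> fun_space.span B" using x A(1) B(3) assms(3) by auto
  ultimately have "card (insert x A) \<le> card B"
    using fun_space.independent_span_bound[OF fin(2)] by blast
  moreover have "x \<notin> A" using A(1) x(2) by auto
  ultimately show False using A(4) B(4) fin assms(4) by simp
qed

lemma span_image_in_planes:
  assumes "fun_space.independent (w ` {..s})" "inj_on w {..s}" "w ` {..s} \<subseteq> coord_space n"
  shows "fun_space.span (w ` {..s}) \<in> planes n s"
  using assms fun_space.span_minimal[OF _ subspace_coord_space, of "w ` {..s}" n]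
  by (auto simp: planes_def fun_space.dim_span_eq_card_independent card_image
      simp del: fun_space.dim_span)

lemma pointsE:
  assumes "P \<in> points n"
  obtains v where "v \<noteq> 0" "v \<in> coord_space n" "P = fun_space.span {v}"
proof -
  have P: "P \<subseteq> coord_space n" "fun_space.subspace P" "fun_space.dim P = 1"
    using assms by (auto simp: points_def planes_def)
  obtain B where B: "B \<subseteq> P" "fun_space.independent B" "P \<subseteq> fun_space.span B" "card B = fun_space.dim P"
    using fun_space.basis_exists by metis
  then obtain v where v: "B = {v}" using P by (auto simp: card_1_singleton_iff)
  then have "v \<noteq> 0" "P = fun_space.span {v}"
    using B P fun_space.span_minimal[of B P] by auto
  with that v B P show ?thesis by auto
qed

lemma span_singleton_in_points: "v \<noteq> 0 \<Longrightarrow> v \<in> coord_space n \<Longrightarrow> fun_space.span {v} \<in> points n"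
  using span_image_in_planes[of "\<lambda>_. v" 0 n] by (simp add: points_def)

lemma span_singleton_eq: "fun_space.span {v} = range (\<lambda>c i. c * v i)"
  by (rule fun_space.span_singleton)

section \<open>Osculating planes from a flag\<close>

lemma poly_at_linear_form_dot: "poly_at (linear_form n a) v = dot n a v"
  by (simp add: poly_at_linear_form dot_def)

lemma contact_order_le_dot:
  assumes "\<And>v. v \<in> W \<Longrightarrow> dot n a v = 0"
  shows "contact_order n C P W \<le> vanishing_order n C P (linear_form n a)"
proof -
  have "vanishes_on (linear_form n a) W"
    using assms by (simp add: vanishes_on_def poly_at_linear_form_dot)
  then show ?thesis
    unfolding contact_order_def using linear_form_forms by (intro Inf_lower) blast
qed

context
  fixes n :: nat and e :: "nat \<Rightarrow> nat \<Rightarrow> 'a::field"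
  assumes span_e: "fun_space.span (e ` {..n}) = coord_space n"
begin

lemma flag_basis: "fun_space.independent (e ` {..n})" "inj_on e {..n}"
proof -
  have "n + 1 \<le> card (e ` {..n})"
    using dim_coord_space[of n, where ?'a='a] fun_space.dim_le_card[of "coord_space n" "e ` {..n}"] span_e
    by simp
  then have c: "card (e ` {..n}) = n + 1"
    using card_image_le[of "{..n}" e] by simp
  then show "inj_on e {..n}" by (intro eq_card_imp_inj_on) auto
  show "fun_space.independent (e ` {..n})"
    using c dim_coord_space[of n, where ?'a='a] span_e
    by (intro independent_if_card_eq_dim) auto
qed

lemma flag_planes: assumes "s \<le> n" shows "fun_space.span (e ` {..s}) \<in> planes n s"
proof (rule span_image_in_planes)
  show "fun_space.independent (e ` {..s})"
    using flag_basis(1) by (rule fun_space.independent_mono) (use assms in auto)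
  show "inj_on e {..s}"
    using flag_basis(2) by (rule inj_on_subset) (use assms in auto)
  show "e ` {..s} \<subseteq> coord_space n"
    unfolding span_e[symmetric] using assms by (auto intro: fun_space.span_base)
qed

lemma flag_not_mem:
  assumes "s < n"
  shows "e (Suc s) \<notin> fun_space.span (e ` {..s})"
proof
  assume *: "e (Suc s) \<in> fun_space.span (e ` {..s})"
  have "e ` {..s} \<subseteq> e ` {..n} - {e (Suc s)}"
    using inj_onD[OF flag_basis(2)] assms by fastforce
  then have "e (Suc s) \<in> fun_space.span (e ` {..n} - {e (Suc s)})"
    using * fun_space.span_mono by blast
  with flag_basis(1) assms show False by (auto simp: fun_space.dependent_def)
qed

context
  fixes C :: "(nat \<Rightarrow> 'a) set set" and P :: "(nat \<Rightarrow> 'a) set" and h :: "nat \<Rightarrow> nat"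
  assumes order_ge: "\<And>L r. L \<in> forms n 1 \<Longrightarrow> r \<le> n \<Longrightarrow> (\<And>i. i < r \<Longrightarrow> poly_at L (e i) = 0) \<Longrightarrow>
      enat (h r) \<le> vanishing_order n C P L"
    and order_le: "\<And>L r. L \<in> forms n 1 \<Longrightarrow> r \<le> n \<Longrightarrow> poly_at L (e r) \<noteq> 0 \<Longrightarrow>
      vanishing_order n C P L \<le> enat (h r)"
    and h_mono: "strict_mono h"
begin

text \<open>Here \<open>h\<close> plays the role of the Hermite invariants: a linear form has order
  \<open>h r\<close> for the first \<open>r\<close> with a nonzero value at \<open>e r\<close>.
  Equations of the plane vanish at \<open>e 0, ..., e s\<close>, whence the lower bound; since
  \<open>e (Suc s)\<close> lies outside, some equation is nonzero there and attains it.\<close>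

lemma contact_order_flag:
  assumes "s < n"
  shows "contact_order n C P (fun_space.span (e ` {..s})) = enat (h (s + 1))"
proof (rule antisym)
  have W: "fun_space.span (e ` {..s}) \<subseteq> coord_space n"
    using flag_planes[of s] assms by (auto simp: planes_def)
  have "e (Suc s) \<in> coord_space n"
    unfolding span_e[symmetric] using assms by (auto intro: fun_space.span_base)
  then obtain a where a: "\<And>v. v \<in> fun_space.span (e ` {..s}) \<Longrightarrow> dot n a v = 0" "dot n a (e (Suc s)) \<noteq> 0"
    using separating_functional[OF fun_space.subspace_span W _ flag_not_mem[OF assms]] by metis
  then have "vanishing_order n C P (linear_form n a) \<le> enat (h (s + 1))"
    using assms by (intro order_le linear_form_forms) (auto simp: poly_at_linear_form_dot)
  moreover have "contact_order n C P (fun_space.span (e ` {..s})) \<le> vanishing_order n C P (linear_form n a)"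
    using a(1) by (rule contact_order_le_dot)
  ultimately show "contact_order n C P (fun_space.span (e ` {..s})) \<le> enat (h (s + 1))" by order
next
  have "enat (h (s + 1)) \<le> vanishing_order n C P L"
    if "L \<in> forms n 1" "vanishes_on L (fun_space.span (e ` {..s}))" for L
    by (rule order_ge) (use that assms in \<open>auto simp: vanishes_on_def fun_space.span_base\<close>)
  then show "enat (h (s + 1)) \<le> contact_order n C P (fun_space.span (e ` {..s}))"
    unfolding contact_order_def by (intro Inf_greatest) blast
qed

text \<open>By equality of dimensions, another plane misses some \<open>e r\<close> with
  \<open>r \<le> s\<close>. An equation that is nonzero at \<open>e r\<close> has order at most
  \<open>h r\<close>, already below \<open>h (s + 1)\<close>.\<close>

lemma contact_order_not_flag:
  assumes "s < n" "W \<in> planes n s" "W \<noteq> fun_space.span (e ` {..s})"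
  shows "contact_order n C P W < enat (h (s + 1))"
proof -
  have W: "W \<subseteq> coord_space n" "fun_space.subspace W" "fun_space.dim W = s + 1"
    using assms(2) by (auto simp: planes_def)
  have "fun_space.dim (fun_space.span (e ` {..s})) = s + 1"
    using flag_planes[of s] assms(1) unfolding planes_def by simp
  then have eq: "fun_space.span (e ` {..s}) = W" if "fun_space.span (e ` {..s}) \<subseteq> W"
    using subspace_eq_if_dim_eq[OF fun_space.subspace_span W(2) that] W(3) by linarith
  have "\<not> fun_space.span (e ` {..s}) \<subseteq> W"
    using eq assms(3) by blast
  then obtain r where r: "r \<le> s" "e r \<notin> W"
    using fun_space.span_minimal[OF _ W(2), of "e ` {..s}"] by auto
  have "e r \<in> coord_space n"
    unfolding span_e[symmetric] using assms r by (auto intro: fun_space.span_base)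
  then obtain a where a: "\<And>v. v \<in> W \<Longrightarrow> dot n a v = 0" "dot n a (e r) \<noteq> 0"
    using separating_functional[OF W(2,1) _ r(2)] by metis
  then have "vanishing_order n C P (linear_form n a) \<le> enat (h r)"
    using assms r by (intro order_le linear_form_forms) (auto simp: poly_at_linear_form_dot)
  moreover have "contact_order n C P W \<le> vanishing_order n C P (linear_form n a)"
    using a(1) by (rule contact_order_le_dot)
  moreover have "h r < h (s + 1)" using h_mono r by (auto simp: strict_mono_def)
  ultimately show ?thesis by (metis enat_ord_simps(2) order.strict_trans1 order.trans)
qed

text \<open>The strict inequality for all other planes gives the uniqueness that \<open>THE\<close>
  asks for, and strict monotonicity of \<open>h\<close> gives contact at least
  \<open>s + 1\<close>.\<close>

lemma osculating_plane_flag: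
  assumes "s < n"
  shows "osculating_plane n C s P = fun_space.span (e ` {..s})"
  unfolding osculating_plane_def
proof (rule the_equality)
  have "s + 1 \<le> h (s + 1)" using h_mono by (simp add: strict_mono_imp_increasing)
  moreover have "contact_order n C P W' \<le> enat (h (s + 1))" if "W' \<in> planes n s" for W'
    using contact_order_not_flag[OF assms that] contact_order_flag[OF assms] by fastforce
  ultimately show "fun_space.span (e ` {..s}) \<in> planes n s \<and>
     contact_order n C P (fun_space.span (e ` {..s})) \<ge> enat (s + 1) \<and>
     (\<forall>W' \<in> planes n s. contact_order n C P W' \<le> contact_order n C P (fun_space.span (e ` {..s})))"
    using flag_planes[of s] assms by (auto simp: contact_order_flag)
next
  fix W assume W: "W \<in> planes n s \<and> contact_order n C P W \<ge> enat (s + 1) \<and>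
     (\<forall>W' \<in> planes n s. contact_order n C P W' \<le> contact_order n C P W)"
  then have "enat (h (s + 1)) \<le> contact_order n C P W"
    using flag_planes[of s] assms by (metis contact_order_flag less_imp_le)
  with contact_order_not_flag[OF assms, of W] W show "W = fun_space.span (e ` {..s})" by fastforce
qed

end

end

section \<open>Roots of unity and of power series\<close>

text \<open>Over a finite field, 1 plus the product of all \<open>X - a\<close> would be a
  nonconstant polynomial without a root.\<close>

lemma infinite_UNIV_alg_closed: "infinite (UNIV :: 'a::alg_closed_field set)"
proof
  assume fin: "finite (UNIV :: 'a set)"
  define p :: "'a poly" where "p = (\<Prod>a\<in>UNIV. [:- a, 1:]) + 1"
  have deg: "degree (\<Prod>a\<in>UNIV. [:- a, 1::'a:]) = card (UNIV :: 'a set)"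
    by (subst degree_prod_eq_sum_degree) auto
  moreover have "card (UNIV :: 'a set) > 0" using fin by (simp add: card_gt_0_iff)
  ultimately have "degree p > 0" unfolding p_def by (subst degree_add_eq_left) auto
  then obtain x where "poly p x = 0" using alg_closed_imp_poly_has_root by blast
  moreover have "(\<Prod>a\<in>UNIV. x - a) = 0"
    using fin by (intro prod_zero) auto
  ultimately show False by (simp add: p_def poly_prod)
qed

lemma power_mod_eq: "z ^ k = 1 \<Longrightarrow> z ^ (e mod k) = z ^ e" for z :: "'a::monoid_mult"
proof -
  assume "z ^ k = 1"
  then have "z ^ (k * (e div k) + e mod k) = z ^ (e mod k)"
    by (simp only: power_add power_mult power_one mult_1)
  then show ?thesis by simp
qed

lemma primitive_root_dvd:
  assumes "is_primitive_root k z" "k > 0" "z ^ e = 1"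
  shows "k dvd e"
proof (rule ccontr)
  assume "\<not> k dvd e"
  then have "0 < e mod k" "e mod k < k" using assms(2) by (auto simp: dvd_eq_mod_eq_0)
  then show False
    using assms power_mod_eq[of z k e] by (auto simp: is_primitive_root_def)
qed

lemma is_primitive_rootI:
  assumes "z ^ k = 1" "\<And>e. z ^ e = 1 \<Longrightarrow> k dvd e"
  shows "is_primitive_root k z"
  using assms by (auto simp: is_primitive_root_def dest!: assms(2) dvd_imp_le)

text \<open>Any root of \<open>1 + X + ... + X^(q-1)\<close> will do: the value of this polynomial
  at 1 is \<open>q\<close>, which is nonzero in the field.\<close>

lemma prime_root_of_unity:
  assumes "prime q" "of_nat q \<noteq> (0::'a::alg_closed_field)"
  obtains w :: "'a::alg_closed_field" where "w ^ q = 1" "w \<noteq> 1"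
proof -
  define p :: "'a poly" where "p = (\<Sum>i<q. monom 1 i)"
  have q: "q \<ge> 2" using assms(1) by (rule prime_ge_2_nat)
  have "coeff p (q - 1) \<noteq> 0"
    using q by (simp add: p_def coeff_sum)
  then have "degree p \<ge> q - 1" by (rule le_degree)
  with q obtain w where "poly p w = 0"
    using alg_closed_imp_poly_has_root[of p] by fastforce
  then have *: "(\<Sum>i<q. w ^ i) = 0" by (simp add: p_def poly_sum poly_monom)
  then have "w ^ q = 1" using power_diff_1_eq[of w q] by simp
  moreover from * assms(2) have "w \<noteq> 1" by auto
  ultimately show ?thesis using that by blast
qed

text \<open>Write \<open>k = q * m\<close> with \<open>q\<close> prime and take a
  \<open>q\<close>-th root \<open>y\<close> of a primitive \<open>m\<close>-th root of unity. Its
  order divides \<open>k\<close> and is a multiple of \<open>m\<close>. If \<open>q\<close> divides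
  \<open>m\<close>, it is \<open>k\<close>; otherwise \<open>y\<close> may have order
  \<open>m\<close> only, and a nontrivial \<open>q\<close>-th root of unity corrects this.\<close>

lemma primitive_root_exists:
  assumes "of_nat k \<noteq> (0::'a::alg_closed_field)"
  shows "\<exists>z::'a. is_primitive_root k z"
  using assms
proof (induction k rule: less_induct)
  case (less k)
  show ?case
  proof (cases "k = 1")
    case True
    then show ?thesis by (auto simp: is_primitive_root_def)
  next
    case False
    then obtain q where q: "prime q" "q dvd k" using prime_factor_nat by blast
    then obtain m where k: "k = q * m" by (elim dvdE)
    have nz: "of_nat q \<noteq> (0::'a)" "of_nat m \<noteq> (0::'a)" using less.prems k by auto
    then have "m > 0" by (cases m) auto
    then have "m < k" using q(1) k prime_gt_1_nat[of q] by simp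
    with less.IH nz obtain z :: 'a where z: "is_primitive_root m z" by blast
    obtain y where y: "y ^ q = z" using nth_root_exists[of q z] q(1) prime_gt_0_nat by blast
    have pow_k: "x ^ k = 1" if "x ^ q = z" for x
      using that z by (simp add: k power_mult is_primitive_root_def)
    have m_dvd: "m dvd e" if "x ^ q = z" "x ^ e = 1" for x e
    proof -
      have "z ^ e = 1" using that by (metis mult.commute power_mult power_one)
      then show ?thesis using z \<open>m > 0\<close> primitive_root_dvd by blast
    qed
    show ?thesis
    proof (cases "q dvd m")
      case True
      have "k dvd e" if e: "y ^ e = 1" for e
      proof -
        obtain f where f: "e = q * f" using m_dvd[OF y e] True by (meson dvdE dvd_trans)
        have "z ^ f = 1" using e y by (simp add: f power_mult)
        then have "m dvd f" using z \<open>m > 0\<close> primitive_root_dvd by blast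
        then show ?thesis by (simp add: f k)
      qed
      then show ?thesis using is_primitive_rootI pow_k[OF y] by blast
    next
      case False
      obtain w :: 'a where w: "w ^ q = 1" "w \<noteq> 1"
        using prime_root_of_unity[OF q(1) nz(1)] by blast
      have cop: "coprime q m" using False q(1) by (simp add: prime_imp_coprime)
      have unit_pow: "u = 1" if u: "u ^ q = 1" "u ^ f = 1" "coprime f q" for u :: 'a and f
      proof -
        obtain x t where "f * x = q * t + 1"
          using coprime_bezout_strong[OF u(3)] prime_gt_1_nat[OF q(1)] by auto
        then have "u ^ (f * x) = u ^ (q * t + 1)" by simp
        then show ?thesis using u(1,2) by (simp add: power_mult power_add)
      qed
      \<comment> \<open>Multiplying \<open>y\<close> by \<open>w\<close> keeps the
        \<open>q\<close>-th power but changes the \<open>m\<close>-th one, because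
        \<open>w ^ m \<noteq> 1\<close> when \<open>q\<close> does not divide
        \<open>m\<close>.\<close>
      obtain x where x: "x ^ q = z" "x ^ m \<noteq> 1"
      proof (cases "y ^ m = 1")
        case True
        have "w ^ m \<noteq> 1" using unit_pow[of w m] w cop by (auto simp: coprime_commute)
        then show ?thesis
          using that[of "w * y"] True y w by (simp add: power_mult_distrib)
      qed (use that y in blast)
      have "k dvd e" if e: "x ^ e = 1" for e
      proof -
        obtain f where f: "e = m * f" using m_dvd[OF x(1) e] by (elim dvdE)
        have "(x ^ m) ^ q = 1" "(x ^ m) ^ f = 1"
          using pow_k[OF x(1)] e by (simp_all add: k f power_mult[symmetric] mult.commute)
        then have "\<not> coprime f q" using x(2) unit_pow by blast
        then have "q dvd f" using q(1) by (meson coprime_commute prime_imp_coprime)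
        then show ?thesis by (auto simp: f k)
      qed
      then show ?thesis using is_primitive_rootI pow_k[OF x(1)] by blast
    qed
  qed
qed

text \<open>A primitive root has \<open>k\<close> different powers, more than a nonzero polynomial
  of this degree has roots. It serves to separate the characters of the group of \<open>k\<close>-th
  roots of unity.\<close>

lemma poly_zero_if_roots_of_unity:
  fixes p :: "'a::alg_closed_field poly"
  assumes k: "of_nat k \<noteq> (0::'a)" and p: "\<And>z. z ^ k = 1 \<Longrightarrow> poly p z = 0" "degree p < k"
  shows "p = 0"
proof (rule ccontr)
  assume "p \<noteq> 0"
  obtain z :: 'a where z: "is_primitive_root k z" using primitive_root_exists[OF k] by blast
  have z1: "z ^ k = 1" using z by (simp add: is_primitive_root_def)
  have z0: "z \<noteq> 0" using z1 k by (cases k) auto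
  have le: "i \<le> j \<Longrightarrow> i < k \<Longrightarrow> j < k \<Longrightarrow> z ^ i = z ^ j \<Longrightarrow> i = j" for i j
  proof -
    assume *: "i \<le> j" "i < k" "j < k" "z ^ i = z ^ j"
    then have "z ^ i * z ^ (j - i) = z ^ i * 1"
      by (metis le_add_diff_inverse mult.right_neutral power_add)
    then have "z ^ (j - i) = 1" using z0 by simp
    then have "k dvd j - i" using z k primitive_root_dvd[of k z "j - i"] by (cases k) auto
    then show "i = j" using * by (auto dest: dvd_imp_le)
  qed
  have "inj_on (\<lambda>i. z ^ i) {..<k}"
    by (rule inj_onI) (metis le lessThan_iff nle_le)
  then have "k = card ((\<lambda>i. z ^ i) ` {..<k})" by (simp add: card_image)
  also have "\<dots> \<le> card {x. poly p x = 0}"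
  proof (rule card_mono)
    show "finite {x. poly p x = 0}" using \<open>p \<noteq> 0\<close> by (rule poly_roots_finite)
    show "(\<lambda>i. z ^ i) ` {..<k} \<subseteq> {x. poly p x = 0}"
      using p(1) z1 by (auto simp flip: power_mult) (metis mult.commute power_mult power_one)
  qed
  also have "\<dots> \<le> degree p" using \<open>p \<noteq> 0\<close> by (rule card_poly_roots_bound)
  finally show False using p(2) by simp
qed

text \<open>Vandermonde by interpolation: combine the equations with the coefficients of the
  polynomial \<open>q\<close> that vanishes at every \<open>c j\<close> except \<open>c i\<close>;
  only the term of \<open>a i\<close> survives.\<close>

lemma power_sums_zero_imp_zero:
  fixes c :: "'i \<Rightarrow> 'a::field"
  assumes I: "finite I" "inj_on c I" "card I \<le> N"
    and sum: "\<And>j. j < N \<Longrightarrow> (\<Sum>i\<in>I. a i * c i ^ j) = 0"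
    and i: "i \<in> I"
  shows "a i = 0"
proof -
  define q where "q = (\<Prod>j\<in>I - {i}. [:- c j, 1:])"
  have "degree q = card (I - {i})"
    unfolding q_def by (subst degree_prod_eq_sum_degree) auto
  then have deg: "degree q < N" using I i by (metis card_Diff1_less order.strict_trans2)
  have "0 = (\<Sum>j\<le>degree q. coeff q j * (\<Sum>i\<in>I. a i * c i ^ j))"
    using sum deg by simp
  also have "\<dots> = (\<Sum>i\<in>I. a i * poly q (c i))"
    unfolding poly_altdef sum_distrib_left by (subst sum.swap) (simp add: mult_ac)
  also have "\<dots> = (\<Sum>j\<in>{i}. a j * poly q (c j))"
  proof (rule sum.mono_neutral_right)
    show "\<forall>j\<in>I - {i}. a j * poly q (c j) = 0"
      using I(1) by (auto simp: q_def poly_prod intro!: prod_zero)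
  qed (use I i in auto)
  finally have "a i * poly q (c i) = 0" by simp
  moreover have "poly q (c i) \<noteq> 0"
    using I i by (auto simp: q_def poly_prod inj_on_def)
  ultimately show ?thesis by simp
qed

text \<open>The \<open>k\<close>-th root of \<open>1 + X\<close> with constant term 1, as a
  compositional inverse. This makes sense as soon as \<open>k\<close> is nonzero in the field,
  whereas the binomial series for the exponent \<open>1/k\<close> would divide by factorials, which
  may vanish in positive characteristic.\<close>

definition root_series :: "nat \<Rightarrow> 'a::field fps" where
  "root_series k = 1 + fps_inv ((1 + fps_X) ^ k - 1)"

lemma fps_nth_1_power: "fps_nth (f ^ k) 1 = of_nat k * fps_nth f 0 ^ (k - 1) * fps_nth f 1"
  for f :: "'a::comm_ring_1 fps"
proof (induction k)
  case (Suc k)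
  have "fps_nth (f ^ Suc k) 1 = fps_nth f 0 * fps_nth (f ^ k) 1 + fps_nth f 1 * fps_nth f 0 ^ k"
    by (simp add: fps_mult_nth fps_nth_power_0)
  with Suc show ?case by (cases k) (simp_all add: algebra_simps)
qed simp

lemma root_series_power:
  assumes "of_nat k \<noteq> (0::'a::field)"
  shows "root_series k ^ k = 1 + (fps_X :: 'a fps)"
proof -
  let ?a = "(1 + fps_X) ^ k - 1 :: 'a fps"
  let ?g = "fps_inv ?a"
  have g0: "fps_nth ?g 0 = 0" by (simp add: fps_inv_def)
  have "fps_nth ?a 1 = of_nat k" unfolding fps_sub_nth fps_nth_1_power by simp
  then have "?a oo ?g = fps_X"
    using assms by (intro fps_inv_right) (auto simp: fps_nth_power_0)
  moreover have "?a oo ?g = root_series k ^ k - 1"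
    using g0 by (simp add: root_series_def fps_compose_sub_distrib fps_compose_power[symmetric]
        fps_compose_add_distrib)
  ultimately show ?thesis by (simp add: algebra_simps)
qed

lemma root_series_nth_0 [simp]: "fps_nth (root_series k) 0 = 1"
  by (simp add: root_series_def fps_inv_def)

text \<open>Differentiating \<open>f ^ k = 1 + X\<close> and multiplying by \<open>f\<close> gives
  \<open>k * (1 + X) * f' = f\<close>; compare coefficients.\<close>

lemma root_series_nth_Suc:
  assumes k: "of_nat k \<noteq> (0::'a::field)"
  shows "of_nat k * of_nat (Suc j) * fps_nth (root_series k) (Suc j) =
    (1 - of_nat (j * k)) * (fps_nth (root_series k) j :: 'a)"
proof -
  let ?f = "root_series k :: 'a fps"
  obtain k' where k': "k = Suc k'" using k by (cases k) auto
  have "fps_deriv (?f ^ k) = fps_deriv (1 + fps_X)" by (simp only: root_series_power[OF k])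
  then have "of_nat k * fps_deriv ?f * ?f ^ (k - 1) = 1"
    by (simp add: fps_deriv_power fps_of_nat)
  then have "of_nat k * fps_deriv ?f * ?f ^ (k - 1) * ?f = ?f" by simp
  then have "of_nat k * fps_deriv ?f * ?f ^ k = ?f"
    by (simp add: k' algebra_simps)
  then have "of_nat k * fps_deriv ?f + of_nat k * (fps_X * fps_deriv ?f) = ?f"
    by (simp add: root_series_power[OF k] algebra_simps)
  then have "fps_nth (of_nat k * fps_deriv ?f + of_nat k * (fps_X * fps_deriv ?f)) j = fps_nth ?f j"
    by simp
  then show ?thesis
    by (cases j) (simp_all add: fps_of_nat[symmetric] algebra_simps)
qed

lemma root_series_nth_nonzero:
  assumes k: "of_nat k \<noteq> (0::'a::field)" and "\<And>i. i < j \<Longrightarrow> of_nat (i * k) \<noteq> (1::'a)"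
  shows "fps_nth (root_series k :: 'a fps) j \<noteq> 0"
  using assms(2)
proof (induction j)
  case (Suc j)
  then have "(1 - of_nat (j * k)) * fps_nth (root_series k :: 'a fps) j \<noteq> 0" by auto
  then show ?case using root_series_nth_Suc[OF k, of j] by auto
qed simp

section \<open>Polynomials vanishing on the curve vanish along its branches\<close>

lemma monom_at_upd:
  "monom_at m (x(i := z * x i)) = z ^ Poly_Mapping.lookup m i * monom_at m x"
  for x :: "nat \<Rightarrow> 'b::comm_semiring_1"
proof -
  let ?S = "insert i (Poly_Mapping.keys m)"
  have "monom_at m (x(i := z * x i)) = (\<Prod>j\<in>?S. (x(i := z * x i)) j ^ Poly_Mapping.lookup m j)"
    by (intro monom_at_superset) auto
  also have "\<dots> = (z * x i) ^ Poly_Mapping.lookup m i * (\<Prod>j\<in>?S - {i}. x j ^ Poly_Mapping.lookup m j)"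
    by (subst prod.remove[of _ i]) (auto intro!: prod.cong)
  also have "\<dots> = z ^ Poly_Mapping.lookup m i * (\<Prod>j\<in>?S. x j ^ Poly_Mapping.lookup m j)"
    by (subst (2) prod.remove[of _ i]) (auto simp: power_mult_distrib mult_ac)
  also have "(\<Prod>j\<in>?S. x j ^ Poly_Mapping.lookup m j) = monom_at m x"
    by (rule monom_at_superset[symmetric]) auto
  finally show ?thesis .
qed

text \<open>The exponents modulo \<open>k\<close> grade the polynomials by the characters of the group of coordinate
  scalings by \<open>k\<close>-th roots of unity, so an invariant set kills every homogeneous part.\<close>

lemma residue_part_vanishes:
  fixes X :: "(nat \<Rightarrow> 'a::alg_closed_field) set" and b :: "(nat \<Rightarrow>\<^sub>0 nat) \<Rightarrow> 'a"
  assumes k: "of_nat k \<noteq> (0::'a)"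
    and inv: "\<And>x z i. x \<in> X \<Longrightarrow> z ^ k = 1 \<Longrightarrow> x(i := z * x i) \<in> X"
    and zero: "\<And>x. x \<in> X \<Longrightarrow> (\<Sum>m\<in>M. b m * monom_at m x) = 0"
    and fin: "finite M" "finite S"
  shows "\<And>x. x \<in> X \<Longrightarrow>
    (\<Sum>m | m \<in> M \<and> (\<forall>i\<in>S. Poly_Mapping.lookup m i mod k = \<rho> i). b m * monom_at m x) = 0"
  using fin(2)
proof (induction S rule: finite_induct)
  case empty
  then show ?case using zero by simp
next
  case (insert i S)
  define M' where "M' = {m \<in> M. \<forall>i\<in>S. Poly_Mapping.lookup m i mod k = \<rho> i}"
  define B where "B t = (\<Sum>m | m \<in> M' \<and> Poly_Mapping.lookup m i mod k = t. b m * monom_at m x)" for t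
  have finM': "finite M'" using fin(1) by (simp add: M'_def)
  have k0: "k > 0" using k by (cases k) auto
  \<comment> \<open>The value of \<open>p\<close> at \<open>z\<close> is the sum at the point whose
    coordinate \<open>i\<close> has been scaled by \<open>z\<close>, and \<open>B t\<close> is its
    part of weight \<open>t\<close>. The induction hypothesis makes every \<open>k\<close>-th root
    of unity a root of \<open>p\<close>.\<close>
  define p where "p = (\<Sum>t<k. monom (B t) t)"
  have coeff: "coeff p t = (if t < k then B t else 0)" for t
    by (simp add: p_def coeff_sum if_distrib cong: if_cong)
  have "p = 0"
  proof (rule poly_zero_if_roots_of_unity[OF k])
    have "degree p \<le> k - 1" by (rule degree_le) (use k0 in \<open>auto simp: coeff\<close>)
    then show "degree p < k" using k0 by simp
    fix z :: 'a assume z: "z ^ k = 1"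
    have "0 = (\<Sum>m\<in>M'. b m * monom_at m (x(i := z * x i)))"
      unfolding M'_def by (rule insert.IH[OF inv[OF insert.prems z], symmetric])
    also have "\<dots> = (\<Sum>m\<in>M'. z ^ (Poly_Mapping.lookup m i mod k) * (b m * monom_at m x))"
      by (simp add: monom_at_upd power_mod_eq[OF z] mult_ac)
    also have "\<dots> = (\<Sum>t<k. \<Sum>m | m \<in> M' \<and> Poly_Mapping.lookup m i mod k = t.
        z ^ (Poly_Mapping.lookup m i mod k) * (b m * monom_at m x))"
      by (rule sum.group[symmetric]) (use finM' k0 in auto)
    also have "\<dots> = (\<Sum>t<k. B t * z ^ t)"
      unfolding B_def sum_distrib_right
      by (rule sum.cong[OF refl], rule sum.cong) (auto simp: mult_ac)
    also have "\<dots> = poly p z" by (simp add: p_def poly_sum poly_monom)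
    finally show "poly p z = 0" by simp
  qed
  then have B0: "t < k \<Longrightarrow> B t = 0" for t using coeff[of t] by simp
  show ?case
  proof (cases "\<rho> i < k")
    case True
    have "{m. m \<in> M \<and> (\<forall>j\<in>insert i S. Poly_Mapping.lookup m j mod k = \<rho> j)} =
        {m. m \<in> M' \<and> Poly_Mapping.lookup m i mod k = \<rho> i}" by (auto simp: M'_def)
    then show ?thesis using B0[OF True] by (simp add: B_def)
  next
    case False
    then have "{m. m \<in> M \<and> (\<forall>j\<in>insert i S. Poly_Mapping.lookup m j mod k = \<rho> j)} = {}"
      using k0 by (metis (mono_tags, lifting) empty_Collect_eq insertI1 mod_less_divisor)
    then show ?thesis by (simp only: sum.empty)
  qed
qed

lemma fps_of_poly_linear_compose:
  "fps_nth T 0 = 0 \<Longrightarrow> fps_of_poly [:a, b:] oo T = fps_const a + fps_const b * T"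
  for a b :: "'a::idom"
  by (simp add: fps_of_poly_pCons fps_compose_add_distrib fps_compose_mult_distrib)

lemma monom_at_residue:
  assumes "finite I" "Poly_Mapping.keys m \<subseteq> I" "\<And>i. i \<in> I \<Longrightarrow> Poly_Mapping.lookup m i mod k = \<rho> i"
  shows "monom_at m w = (\<Prod>i\<in>I. w i ^ \<rho> i) * (\<Prod>i\<in>I. (w i ^ k) ^ (Poly_Mapping.lookup m i div k))"
proof -
  have "w i ^ Poly_Mapping.lookup m i = w i ^ \<rho> i * (w i ^ k) ^ (Poly_Mapping.lookup m i div k)"
    if "i \<in> I" for i
    using assms(3)[OF that, symmetric] by (simp flip: power_mult power_add)
  then show ?thesis
    by (simp add: monom_at_superset[OF assms(1,2)] prod.distrib)
qed

text \<open>The points with \<open>x i ^ k = a i + b i * \<tau>\<close> are stable under scaling by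
  \<open>k\<close>-th roots of unity, so \<open>F\<close> may be treated one residue class of
  exponents at a time. Such a class is a common monomial times a polynomial \<open>R\<close> in
  \<open>\<tau>\<close>. The monomial is nonzero for all but finitely many \<open>\<tau>\<close>, so
  \<open>R = 0\<close>; replacing \<open>\<tau>\<close> by the series \<open>T\<close> then gives
  the claim.\<close>

lemma pullback_eq_0:
  fixes F :: "'a::alg_closed_field mpoly" and \<gamma> :: "nat \<Rightarrow> 'a fps"
  assumes k: "of_nat k \<noteq> (0::'a)" and I: "finite I"
    and F: "\<And>m. m \<in> Poly_Mapping.keys F \<Longrightarrow> Poly_Mapping.keys m \<subseteq> I"
    and zero: "\<And>x \<tau>. (\<And>i. i \<notin> I \<Longrightarrow> x i = 0) \<Longrightarrow> (\<And>i. i \<in> I \<Longrightarrow> x i ^ k = a i + b i * \<tau>) \<Longrightarrow>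
      poly_at F x = 0"
    and ab: "\<And>i. i \<in> I \<Longrightarrow> a i \<noteq> 0 \<or> b i \<noteq> 0"
    and \<gamma>: "\<And>i. i \<in> I \<Longrightarrow> \<gamma> i ^ k = fps_const (a i) + fps_const (b i) * T" "fps_nth T 0 = 0"
  shows "pullback F \<gamma> = 0"
proof -
  define X where "X = {x. (\<forall>i. i \<notin> I \<longrightarrow> x i = 0) \<and> (\<exists>\<tau>. \<forall>i\<in>I. x i ^ k = a i + b i * \<tau>)}"
  define M where "M = Poly_Mapping.keys F"
  define f where "f m = Poly_Mapping.lookup F m" for m
  have inv: "x(i := z * x i) \<in> X" if "x \<in> X" "z ^ k = 1" for x z i
    using that by (auto simp: X_def power_mult_distrib)
  have zeroX: "(\<Sum>m\<in>M. f m * monom_at m x) = 0" if "x \<in> X" for x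
    using that zero unfolding X_def poly_at_eq eval_at_def M_def f_def by blast
  have finM: "finite M" by (simp add: M_def)
  define res where "res m = (\<lambda>i. if i \<in> I then Poly_Mapping.lookup m i mod k else 0)" for m :: "nat \<Rightarrow>\<^sub>0 nat"
  have part: "(\<Sum>m | m \<in> M \<and> res m = \<rho>. fps_const (f m) * monom_at m \<gamma>) = 0" for \<rho>
  proof -
    let ?M = "{m \<in> M. res m = \<rho>}"
    define R where "R = (\<Sum>m\<in>?M. smult (f m) (\<Prod>i\<in>I. [:a i, b i:] ^ (Poly_Mapping.lookup m i div k)))"
    have mon: "monom_at m w = (\<Prod>i\<in>I. w i ^ \<rho> i) * (\<Prod>i\<in>I. (w i ^ k) ^ (Poly_Mapping.lookup m i div k))"
      if "m \<in> ?M" for m and w :: "nat \<Rightarrow> 'b::comm_semiring_1"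
      by (rule monom_at_residue[OF I]) (use that F in \<open>auto simp: res_def M_def\<close>)
    have root: "poly R \<tau> = 0" if \<tau>: "\<And>i. i \<in> I \<Longrightarrow> poly [:a i, b i:] \<tau> \<noteq> 0" for \<tau>
    proof -
      have "\<forall>i. \<exists>y. y ^ k = a i + b i * \<tau>"
        using k by (intro allI nth_root_exists) (auto intro: Nat.gr0I)
      then obtain y where y: "\<And>i. y i ^ k = a i + b i * \<tau>" by metis
      define x where "x = (\<lambda>i. if i \<in> I then y i else 0)"
      have xk: "i \<in> I \<Longrightarrow> x i ^ k = a i + b i * \<tau>" for i by (simp add: x_def y)
      have "x \<in> X" using xk by (auto simp: X_def x_def)
      have x0: "(\<Prod>i\<in>I. x i ^ \<rho> i) \<noteq> 0"
      proof -
        have "x i \<noteq> 0" if "i \<in> I" for i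
          using xk[OF that] \<tau>[OF that] k by (cases "x i = 0") (auto simp: mult.commute power_0_left split: if_splits)
        then show ?thesis using I by simp
      qed
      \<comment> \<open>\<open>residue_part_vanishes\<close> prescribes residues on \<open>I\<close>
        only. If the class is nonempty, \<open>\<rho>\<close> is 0 off \<open>I\<close> and the two
        descriptions agree.\<close>
      have "{m \<in> M. \<forall>i\<in>I. Poly_Mapping.lookup m i mod k = \<rho> i} = ?M \<or> ?M = {}"
      proof (cases "?M = {}")
        case False
        then have "\<rho> i = 0" if "i \<notin> I" for i using that by (auto simp: res_def)
        then show ?thesis by (auto simp: res_def fun_eq_iff)
      qed simp
      then have "0 = (\<Sum>m\<in>?M. f m * monom_at m x)"
        using residue_part_vanishes[OF k inv zeroX finM I \<open>x \<in> X\<close>, of \<rho>] by (elim disjE) (simp_all only: sum.empty)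
      also have "\<dots> = (\<Sum>m\<in>?M. (\<Prod>i\<in>I. x i ^ \<rho> i) *
          (f m * (\<Prod>i\<in>I. (a i + b i * \<tau>) ^ (Poly_Mapping.lookup m i div k))))"
        by (rule sum.cong) (auto simp: mon xk mult_ac intro!: prod.cong)
      also have "\<dots> = (\<Prod>i\<in>I. x i ^ \<rho> i) * poly R \<tau>"
        by (simp add: R_def poly_sum poly_prod sum_distrib_left mult_ac)
      finally show "poly R \<tau> = 0" using x0 by simp
    qed
    have "R = 0"
    proof (rule ccontr)
      assume "R \<noteq> 0"
      have "UNIV = {\<tau>. poly R \<tau> = 0} \<union> (\<Union>i\<in>I. {\<tau>. poly [:a i, b i:] \<tau> = 0})"
        using root by blast
      moreover have "finite ({\<tau>. poly R \<tau> = 0} \<union> (\<Union>i\<in>I. {\<tau>. poly [:a i, b i:] \<tau> = 0}))"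
        using \<open>R \<noteq> 0\<close> I ab by (intro finite_UnI finite_UN_I poly_roots_finite) auto
      ultimately show False using infinite_UNIV_alg_closed by metis
    qed
    have "(\<Sum>m\<in>?M. fps_const (f m) * monom_at m \<gamma>) = (\<Sum>m\<in>?M. (\<Prod>i\<in>I. \<gamma> i ^ \<rho> i) *
          (fps_const (f m) * (\<Prod>i\<in>I. (fps_const (a i) + fps_const (b i) * T) ^ (Poly_Mapping.lookup m i div k))))"
      by (rule sum.cong) (auto simp: mon \<gamma>(1) mult_ac intro!: prod.cong)
    also have "\<dots> = (\<Prod>i\<in>I. \<gamma> i ^ \<rho> i) * (fps_of_poly R oo T)"
      by (simp add: R_def fps_of_poly_sum fps_of_poly_smult fps_of_poly_prod fps_of_poly_power
          fps_compose_sum_distrib fps_compose_mult_distrib[OF \<gamma>(2)] fps_compose_prod_distrib[OF \<gamma>(2)]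
          fps_compose_power[OF \<gamma>(2), symmetric] fps_of_poly_linear_compose[OF \<gamma>(2)] sum_distrib_left)
    finally show ?thesis using \<open>R = 0\<close> by simp
  qed
  have "pullback F \<gamma> = (\<Sum>m\<in>M. fps_const (f m) * monom_at m \<gamma>)"
    by (simp add: eval_at_def M_def f_def)
  also have "\<dots> = (\<Sum>\<rho>\<in>res ` M. \<Sum>m | m \<in> M \<and> res m = \<rho>. fps_const (f m) * monom_at m \<gamma>)"
    by (rule sum.image_gen[OF finM])
  also have "\<dots> = 0" by (simp add: part)
  finally show ?thesis .
qed

section \<open>Order of vanishing along a branch\<close>

lemma fps_mult_nth_eq_0:
  fixes f g :: "'a::comm_ring_1 fps"
  shows "(\<And>i. i < m \<Longrightarrow> fps_nth f i = 0) \<Longrightarrow> i < m \<Longrightarrow> fps_nth (g * f) i = 0"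
  by (auto simp: fps_mult_nth intro!: sum.neutral)

lemma fps_mult_nth_eq_0_Suc:
  fixes f g :: "'a::comm_ring_1 fps"
  assumes "\<And>i. i < m \<Longrightarrow> fps_nth f i = 0" "fps_nth g 0 = 0" "i < Suc m"
  shows "fps_nth (f * g) i = 0"
proof -
  have "fps_nth f j * fps_nth g (i - j) = 0" if "j \<le> i" for j
    using that assms by (cases "j = m") auto
  then show ?thesis by (auto simp: fps_mult_nth intro!: sum.neutral)
qed

lemma fps_prod_nth_eq_0:
  fixes f :: "nat \<Rightarrow> 'a::comm_ring_1 fps"
  assumes "\<And>j. j < m \<Longrightarrow> fps_nth (f j) 0 = 0" "i < m"
  shows "fps_nth (\<Prod>j<m. f j) i = 0"
  using assms
proof (induction m arbitrary: i)
  case (Suc m)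
  then show ?case unfolding prod.lessThan_Suc by (intro fps_mult_nth_eq_0_Suc[of m]) auto
qed simp

text \<open>Factoring \<open>f\<close> as \<open>X\<close> times its shift isolates the lowest
  possible term. With \<open>f\<close> the pullback of \<open>tau\<close>, this coefficient reveals
  whether a quotient by \<open>tau ^ m\<close> vanishes at the point.\<close>

lemma fps_power_mult_nth:
  fixes f g :: "'a::comm_ring_1 fps"
  assumes "fps_nth f 0 = 0"
  shows "fps_nth (f ^ m * g) m = fps_nth f 1 ^ m * fps_nth g 0"
proof -
  have f: "f = fps_X * fps_shift 1 f"
    using assms by (intro fps_ext) (auto simp: fps_X_mult_nth)
  have "f ^ m * g = fps_X ^ m * (fps_shift 1 f ^ m * g)"
    by (subst f) (simp only: power_mult_distrib mult.assoc)
  then show ?thesis by (simp add: fps_X_power_mult_nth fps_nth_power_0)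
qed

lemma vanishing_ideal_add:
  "A \<in> vanishing_ideal n X \<Longrightarrow> B \<in> vanishing_ideal n X \<Longrightarrow> A + B \<in> vanishing_ideal n X"
  for A :: "'a::field mpoly"
  by (auto simp: vanishing_ideal_def vanishes_on_def polys_add poly_at_simps)

lemma vanishing_ideal_mult:
  "A \<in> polys n \<Longrightarrow> B \<in> vanishing_ideal n X \<Longrightarrow> A * B \<in> vanishing_ideal n X"
  for A :: "'a::field mpoly"
  by (auto simp: vanishing_ideal_def vanishes_on_def polys_mult poly_at_simps)

lemma vanishing_ideal_0 [simp]: "0 \<in> vanishing_ideal n (X :: (nat \<Rightarrow> 'a::field) set set)"
  by (auto simp: vanishing_ideal_def vanishes_on_def poly_at_simps)

abbreviation mconst :: "'a::comm_ring_1 \<Rightarrow> 'a mpoly" where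
  "mconst c \<equiv> Poly_Mapping.single 0 c"

section \<open>The curve, its parameters and the line of \<open>k\<close>-th powers\<close>

locale fermat =
  fixes k n :: nat and l :: "nat \<Rightarrow> 'a::alg_closed_field"
  assumes k2: "k \<ge> 2" and n2: "n \<ge> 2"
    and char: "CHAR('a) = 0 \<or> CHAR('a) > k ^ (n - 1)"
    and l01: "\<forall>i \<in> {1..n - 2}. l i \<noteq> 0 \<and> l i \<noteq> 1"
    and inj_l: "inj_on l {1..n - 2}"
begin

lemma of_nat_nonzero: "0 < m \<Longrightarrow> m \<le> k ^ (n - 1) \<Longrightarrow> of_nat m \<noteq> (0::'a)"
  using char by (auto simp: of_nat_eq_0_iff_char_dvd dest: dvd_imp_le)

lemma k_nonzero: "of_nat k \<noteq> (0::'a)"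
proof (rule of_nat_nonzero)
  show "k \<le> k ^ (n - 1)" using k2 n2 self_le_power[of k "n - 1"] by simp
qed (use k2 in simp)

text \<open>Rests on \<open>m + 1 \<le> 2 ^ m\<close>. It places the numbers
  \<open>j * k - 1\<close> with \<open>0 < j < n\<close> below a positive characteristic; they occur
  as factors in the coefficients of \<open>root_series\<close> and as exponents of the associated
  forms.\<close>

lemma bound_le: "(n - 1) * k \<le> k ^ (n - 1)"
proof -
  obtain m where n: "n = m + 2" using n2 by (metis add.commute le_Suc_ex)
  have "m + 1 \<le> 2 ^ m" by (induction m) auto
  also have "\<dots> \<le> k ^ m" using k2 by (rule power_mono) simp
  finally have "(m + 1) * k \<le> k ^ m * k" by (intro mult_le_mono) auto
  then show ?thesis by (simp add: n mult.commute)
qed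

lemma mult_k_minus_1_nonzero: "0 < j \<Longrightarrow> j < n \<Longrightarrow> of_nat (j * k - 1) \<noteq> (0::'a)"
proof (rule of_nat_nonzero)
  assume j: "0 < j" "j < n"
  then have "1 * 2 \<le> j * k" using k2 by (intro mult_le_mono) auto
  then show "0 < j * k - 1" by simp
  have "j * k \<le> (n - 1) * k" using j by (intro mult_le_mono) auto
  with bound_le have "j * k \<le> k ^ (n - 1)" by (rule order_trans[rotated])
  then show "j * k - 1 \<le> k ^ (n - 1)" by linarith
qed

lemma mult_k_neq_1: "j < n \<Longrightarrow> of_nat (j * k) \<noteq> (1::'a)"
proof (cases "j = 0")
  case False
  assume "j < n"
  have "1 * 1 \<le> j * k" using k2 False by (intro mult_le_mono) auto
  then have "j * k = Suc (j * k - 1)" by linarith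
  then have "of_nat (j * k) = of_nat (j * k - 1) + (1::'a)"
    by (metis add.commute of_nat_Suc)
  then show ?thesis using mult_k_minus_1_nonzero[of j] False \<open>j < n\<close> by simp
qed simp

lemma root_series_nonzero: "j \<le> n \<Longrightarrow> fps_nth (root_series k :: 'a fps) j \<noteq> 0"
  by (rule root_series_nth_nonzero[OF k_nonzero]) (use mult_k_neq_1 in auto)

text \<open>The equations say that \<open>u\<^sub>i = x\<^sub>i\<^sup>k\<close> is \<open>al i * u\<^sub>1 + be i * u\<^sub>2\<close>: the curve is the preimage
  of a line under the \<open>k\<close>-th power map.\<close>

definition al :: "nat \<Rightarrow> 'a" where
  "al i = (if i = 1 then 1 else if i = 2 then 0 else if i = 3 then - 1 else - l (i - 3))"

definition be :: "nat \<Rightarrow> 'a" where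
  "be i = (if i = 1 then 0 else if i = 2 then 1 else - 1)"

text \<open>The pairs \<open>(al i, be i)\<close> are \<open>n + 1\<close> points of a projective
  line. Nonzero minors say that they are pairwise different, which is the content of the conditions
  on \<open>l\<close>.\<close>

definition minor :: "nat \<Rightarrow> nat \<Rightarrow> 'a" where
  "minor i j = al i * be j - al j * be i"

lemma minor_nonzero:
  assumes "i \<in> {1..n + 1}" "j \<in> {1..n + 1}" "i \<noteq> j"
  shows "minor i j \<noteq> 0"
proof -
  have l0: "l (m - 3) \<noteq> 0" "l (m - 3) \<noteq> 1" if "m \<in> {1..n + 1}" "m > 3" for m
  proof -
    have "m - 3 \<in> {1..n - 2}" using that by auto
    with l01 show "l (m - 3) \<noteq> 0" "l (m - 3) \<noteq> 1" by blast+
  qed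
  have li: "l (i - 3) \<noteq> l (j - 3)" if "i > 3" "j > 3"
  proof
    assume "l (i - 3) = l (j - 3)"
    moreover have "i - 3 \<in> {1..n - 2}" "j - 3 \<in> {1..n - 2}" using assms that by auto
    ultimately have "i - 3 = j - 3" using inj_l by (auto dest: inj_onD)
    with that assms(3) show False by linarith
  qed
  consider "i = 1" | "i = 2" | "i = 3" | "i > 3" using assms(1) by fastforce
  then show ?thesis
  proof cases
    case 4
    consider "j = 1" | "j = 2" | "j = 3" | "j > 3" using assms(2) by fastforce
    then show ?thesis using 4 l0[OF assms(1)] li by cases (auto simp: minor_def al_def be_def)
  qed (use assms(2,3) l0[OF assms(2)] in \<open>auto simp: minor_def al_def be_def\<close>)
qed

definition on_line :: "(nat \<Rightarrow> 'a) \<Rightarrow> bool" where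
  "on_line u \<longleftrightarrow> (\<forall>i\<in>{1..n + 1}. u i = al i * u 1 + be i * u 2)"

abbreviation "curve \<equiv> fermat_curve k n l"

lemma on_line_iff:
  "on_line (\<lambda>i. v i ^ k) \<longleftrightarrow> (\<forall>i \<le> n - 2. (if i = 0 then 1 else l i) * v 1 ^ k + v 2 ^ k + v (3 + i) ^ k = 0)"
proof
  assume L: "on_line (\<lambda>i. v i ^ k)"
  show "\<forall>i \<le> n - 2. (if i = 0 then 1 else l i) * v 1 ^ k + v 2 ^ k + v (3 + i) ^ k = 0"
  proof (intro allI impI)
    fix i assume "i \<le> n - 2"
    then have "3 + i \<in> {1..n + 1}" using n2 by auto
    with L have "v (3 + i) ^ k = al (3 + i) * v 1 ^ k + be (3 + i) * v 2 ^ k"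
      unfolding on_line_def by blast
    then show "(if i = 0 then 1 else l i) * v 1 ^ k + v 2 ^ k + v (3 + i) ^ k = 0"
      by (auto simp: al_def be_def)
  qed
next
  assume E: "\<forall>i \<le> n - 2. (if i = 0 then 1 else l i) * v 1 ^ k + v 2 ^ k + v (3 + i) ^ k = 0"
  show "on_line (\<lambda>i. v i ^ k)"
    unfolding on_line_def
  proof
    fix j assume j: "j \<in> {1..n + 1}"
    show "v j ^ k = al j * v 1 ^ k + be j * v 2 ^ k"
    proof (cases "j \<ge> 3")
      case True
      then have "v j ^ k = - ((if j - 3 = 0 then 1 else l (j - 3)) * v 1 ^ k + v 2 ^ k)"
        using E[rule_format, of "j - 3"] j n2 by (subst eq_neg_iff_add_eq_0) (auto simp: add_ac)
      then show ?thesis using True by (auto simp: al_def be_def)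
    next
      case False
      with j have "j = 1 \<or> j = 2" by auto
      then show ?thesis by (auto simp: al_def be_def)
    qed
  qed
qed

lemma on_line_scale: "on_line u \<Longrightarrow> on_line (\<lambda>i. c * u i)"
  unfolding on_line_def
proof
  fix i assume u: "\<forall>i\<in>{1..n + 1}. u i = al i * u 1 + be i * u 2" and "i \<in> {1..n + 1}"
  then have "u i = al i * u 1 + be i * u 2" by blast
  then show "c * u i = al i * (c * u 1) + be i * (c * u 2)" by (simp add: algebra_simps)
qed

lemma on_line_add_scale: "on_line u \<Longrightarrow> on_line w \<Longrightarrow> on_line (\<lambda>i. u i + w i * t)"
  unfolding on_line_def
proof
  fix i assume *: "\<forall>i\<in>{1..n + 1}. u i = al i * u 1 + be i * u 2"
      "\<forall>i\<in>{1..n + 1}. w i = al i * w 1 + be i * w 2" and "i \<in> {1..n + 1}"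
  then have "u i = al i * u 1 + be i * u 2" "w i = al i * w 1 + be i * w 2" by blast+
  then show "u i + w i * t = al i * (u 1 + w 1 * t) + be i * (u 2 + w 2 * t)"
    by (simp add: algebra_simps)
qed

lemma curve_span_iff:
  assumes "v \<noteq> 0" "v \<in> coord_space n"
  shows "fun_space.span {v} \<in> curve \<longleftrightarrow> on_line (\<lambda>i. v i ^ k)"
proof -
  have "fun_space.span {v} \<in> curve \<longleftrightarrow> (\<forall>x \<in> fun_space.span {v}. on_line (\<lambda>i. x i ^ k))"
    using span_singleton_in_points[OF assms] unfolding fermat_curve_def on_line_iff by blast
  also have "\<dots> \<longleftrightarrow> on_line (\<lambda>i. v i ^ k)"
  proof
    assume *: "\<forall>x \<in> fun_space.span {v}. on_line (\<lambda>i. x i ^ k)"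
    then show "on_line (\<lambda>i. v i ^ k)" using fun_space.span_base[of v "{v}"] by blast
  next
    assume *: "on_line (\<lambda>i. v i ^ k)"
    show "\<forall>x \<in> fun_space.span {v}. on_line (\<lambda>i. x i ^ k)"
      using on_line_scale[OF *] by (auto simp: span_singleton_eq power_mult_distrib)
  qed
  finally show ?thesis .
qed

lemma curveE:
  assumes "P \<in> curve"
  obtains v where "v \<noteq> 0" "v \<in> coord_space n" "P = fun_space.span {v}" "on_line (\<lambda>i. v i ^ k)"
proof -
  have "P \<in> points n" using assms by (simp add: fermat_curve_def)
  then obtain v where "v \<noteq> 0" "v \<in> coord_space n" "P = fun_space.span {v}" by (rule pointsE)
  with that assms curve_span_iff show ?thesis by blast
qed

text \<open>Three linear forms on a two-dimensional space are related with their
  \<open>2 x 2\<close> minors as coefficients.\<close>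

lemma on_line_relation:
  assumes "on_line u" "{i, j, m} \<subseteq> {1..n + 1}"
  shows "minor j m * u i + minor m i * u j + minor i j * u m = 0"
proof -
  have "u i = al i * u 1 + be i * u 2" "u j = al j * u 1 + be j * u 2" "u m = al m * u 1 + be m * u 2"
    using assms unfolding on_line_def by blast+
  then show ?thesis by (simp add: minor_def) (simp add: algebra_simps)
qed

lemma on_line_cross:
  assumes "on_line u" "on_line w" "i \<in> {1..n + 1}" "j \<in> {1..n + 1}"
  shows "u i * w j - u j * w i = minor i j * (u 1 * w 2 - u 2 * w 1)"
proof -
  have "u i = al i * u 1 + be i * u 2" "u j = al j * u 1 + be j * u 2"
    "w i = al i * w 1 + be i * w 2" "w j = al j * w 1 + be j * w 2"
    using assms unfolding on_line_def by blast+
  then show ?thesis by (simp add: minor_def) (simp add: algebra_simps)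
qed

lemma on_line_at_most_one_zero:
  assumes "on_line u" "i \<in> {1..n + 1}" "j \<in> {1..n + 1}" "i \<noteq> j" "u i = 0" "u j = 0" "m \<in> {1..n + 1}"
  shows "u m = 0"
proof -
  have "minor i j * u m = 0" using on_line_relation[of u i j m] assms by simp
  then show ?thesis using minor_nonzero assms by simp
qed

text \<open>Two vanishing coordinates would force every third one to vanish through the three-term
  relation, as minors are nonzero. So a point has either no zero coordinate or exactly one, and
  these are the two kinds of branches.\<close>

lemma curve_zero_unique:
  assumes "on_line (\<lambda>i. v i ^ k)" "v \<noteq> 0" "v \<in> coord_space n"
    and "i \<in> {1..n + 1}" "j \<in> {1..n + 1}" "v i = 0" "v j = 0"
  shows "i = j"
proof (rule ccontr)
  assume "i \<noteq> j"
  then have "v m = 0" if "m \<in> {1..n + 1}" for m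
    using on_line_at_most_one_zero[OF assms(1,4,5) _ _ _ that] assms k2 by simp
  then show False using assms(2,3) by (auto simp: fun_eq_iff coord_space_def)
qed

end

section \<open>A formal branch of the curve at the point spanned by \<open>v\<close>\<close>

locale fermat_branch = fermat k n l for k n :: nat and l :: "nat \<Rightarrow> 'a::alg_closed_field" +
  fixes v w :: "nat \<Rightarrow> 'a" and r :: nat
  assumes v0: "v \<noteq> 0" and v_coord: "v \<in> coord_space n" and v_line: "on_line (\<lambda>i. v i ^ k)"
    and w_line: "on_line w" and cross: "v 1 ^ k * w 2 - v 2 ^ k * w 1 \<noteq> 0"
    and r_cases: "r = 1 \<and> (\<forall>i\<in>{1..n + 1}. v i \<noteq> 0) \<or> r = k \<and> (\<exists>j\<in>{1..n + 1}. v j = 0 \<and> w j = 1)"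
begin

abbreviation "P \<equiv> fun_space.span {v}"

definition slope :: "nat \<Rightarrow> 'a" where "slope i = w i / v i ^ k"

text \<open>The line of \<open>k\<close>-th powers is run through as
  \<open>v i ^ k + w i * T\<close> with \<open>T = X ^ r\<close>. Factoring out
  \<open>v i ^ k\<close> leaves \<open>1 + slope i * T\<close>, whose root is
  \<open>root_series\<close>. At a zero coordinate the root of \<open>T\<close> itself is needed;
  there \<open>r = k\<close> and \<open>w i = 1\<close>, so \<open>X\<close> is one.\<close>

definition branch :: "nat \<Rightarrow> 'a fps" where
  "branch i = (if i \<notin> {1..n + 1} then 0 else if v i = 0 then fps_X
     else fps_const (v i) * (root_series k oo (fps_const (slope i) * fps_X ^ r)))"

lemma v_outside: "i \<notin> {1..n + 1} \<Longrightarrow> v i = 0"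
  using v_coord by (auto simp: coord_space_def)

lemma zero_unique:
  assumes "i \<in> {1..n + 1}" "j \<in> {1..n + 1}" "v i = 0" "v j = 0"
  shows "i = j"
  using curve_zero_unique[OF v_line v0 v_coord assms] .

lemma r_pos: "r > 0" using r_cases k2 by auto

lemma zero_coord: "i \<in> {1..n + 1} \<Longrightarrow> v i = 0 \<Longrightarrow> r = k \<and> w i = 1"
  using r_cases zero_unique by blast

text \<open>Equal slopes annihilate a \<open>2 x 2\<close> determinant of coordinates, which is the
  product of \<open>minor i j\<close> and the nonzero quantity \<open>cross\<close>.\<close>

lemma slope_inj:
  assumes "i \<in> {1..n + 1}" "j \<in> {1..n + 1}" "v i \<noteq> 0" "v j \<noteq> 0" "slope i = slope j"
  shows "i = j"
proof (rule ccontr)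
  assume "i \<noteq> j"
  have "v i ^ k * w j - v j ^ k * w i = 0"
    using assms(3-5) by (simp add: slope_def divide_simps mult.commute)
  then show False
    using on_line_cross[OF v_line w_line assms(1,2)] minor_nonzero[OF assms(1,2) \<open>i \<noteq> j\<close>] cross by simp
qed

lemma branch_nth:
  assumes "i \<in> {1..n + 1}" "v i \<noteq> 0"
  shows "fps_nth (branch i) m =
    (if r dvd m then v i * fps_nth (root_series k) (m div r) * slope i ^ (m div r) else 0)"
proof -
  have "fps_nth (root_series k oo (fps_const (slope i) * fps_X ^ r)) m =
      (\<Sum>j=0..m. fps_nth (root_series k) j * (slope i ^ j * (if m = r * j then 1 else 0)))"
    by (simp add: fps_compose_nth power_mult_distrib fps_X_power_nth power_mult[symmetric])
  also have "\<dots> = (\<Sum>j=0..m. if j = m div r \<and> r dvd m then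
      fps_nth (root_series k) (m div r) * slope i ^ (m div r) else 0)"
    using r_pos by (intro sum.cong) auto
  also have "\<dots> = (if r dvd m then fps_nth (root_series k) (m div r) * slope i ^ (m div r) else 0)"
    by (auto simp: sum.delta)
  finally show ?thesis using assms by (simp add: branch_def)
qed

lemma branch_nth_0: "fps_nth (branch i) 0 = v i"
  using branch_nth[of i 0] v_outside[of i] by (cases "v i = 0") (auto simp: branch_def)

lemma branch_power:
  assumes i: "i \<in> {1..n + 1}"
  shows "branch i ^ k = fps_const (v i ^ k) + fps_const (w i) * fps_X ^ r"
proof (cases "v i = 0")
  case True
  then have "branch i = fps_X" using i by (simp add: branch_def)
  then show ?thesis using zero_coord[OF i True] True k2 by (simp add: power_0_left)
next
  case False
  let ?S = "fps_const (slope i) * fps_X ^ r"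
  have S0: "fps_nth ?S 0 = 0" using r_pos by simp
  have "branch i ^ k = fps_const (v i) ^ k * (root_series k ^ k oo ?S)"
    using i False by (simp add: branch_def power_mult_distrib fps_compose_power[OF S0])
  also have "\<dots> = fps_const (v i) ^ k * (1 + ?S)"
    using S0 by (simp add: root_series_power[OF k_nonzero] fps_compose_add_distrib)
  also have "\<dots> = fps_const (v i ^ k) + fps_const (v i ^ k * slope i) * fps_X ^ r"
    by (simp add: fps_const_power algebra_simps flip: fps_const_mult)
  also have "v i ^ k * slope i = w i" using False by (simp add: slope_def)
  finally show ?thesis .
qed

lemma P_in_curve: "P \<in> curve"
  using curve_span_iff[OF v0 v_coord] v_line by simp

lemma pullback_vanishing_ideal:
  assumes "B \<in> vanishing_ideal n curve"
  shows "pullback B branch = 0"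
proof (rule pullback_eq_0[OF k_nonzero, where I = "{1..n + 1}"])
  show "branch i ^ k = fps_const (v i ^ k) + fps_const (w i) * fps_X ^ r" if "i \<in> {1..n + 1}" for i
    using that by (rule branch_power)
  show "v i ^ k \<noteq> 0 \<or> w i \<noteq> 0" if "i \<in> {1..n + 1}" for i
    using zero_coord[OF that] by (cases "v i = 0") auto
  show "Poly_Mapping.keys m \<subseteq> {1..n + 1}" if "m \<in> Poly_Mapping.keys B" for m
    using that assms by (auto simp: vanishing_ideal_def polys_def)
  fix x \<tau> assume x: "\<And>i. i \<notin> {1..n + 1} \<Longrightarrow> x i = 0"
    "\<And>i. i \<in> {1..n + 1} \<Longrightarrow> x i ^ k = v i ^ k + w i * \<tau>"
  have x_coord: "x \<in> coord_space n" using x(1) by (auto simp: coord_space_def)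
  have "on_line (\<lambda>i. v i ^ k + w i * \<tau>)" using on_line_add_scale[OF v_line w_line] .
  moreover have "1 \<in> {1..n + 1}" "2 \<in> {1..n + 1}" using n2 by auto
  ultimately have "on_line (\<lambda>i. x i ^ k)"
    unfolding on_line_def using x(2) by (metis (no_types, lifting))
  then have "x = 0 \<or> fun_space.span {x} \<in> curve" using curve_span_iff[OF _ x_coord] by blast
  \<comment> \<open>A zero vector \<open>x\<close> spans no point, but it lies in
    \<open>P\<close>.\<close>
  then have "\<exists>Q\<in>curve. x \<in> Q"
    using P_in_curve fun_space.span_zero[of "{v}"] by (auto intro: fun_space.span_base)
  then show "poly_at B x = 0" using assms by (auto simp: vanishing_ideal_def vanishes_on_def)
qed (use r_pos in auto)

lemma pullback_0_at: "fps_nth (pullback F branch) 0 = poly_at F v"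
  unfolding pullback_nth_0 branch_nth_0 ..

lemma vanishes_on_P_iff:
  assumes "F \<in> forms n d"
  shows "vanishes_on F P \<longleftrightarrow> poly_at F v = 0"
proof
  show "vanishes_on F P \<Longrightarrow> poly_at F v = 0"
    by (auto simp: vanishes_on_def intro: fun_space.span_base)
  show "poly_at F v = 0 \<Longrightarrow> vanishes_on F P"
    by (auto simp: vanishes_on_def span_singleton_eq poly_at_scale[OF assms])
qed

section \<open>A uniformiser at the point\<close>

definition special :: nat where
  "special = (if \<exists>j\<in>{1..n + 1}. v j = 0 then (SOME j. j \<in> {1..n + 1} \<and> v j = 0) else 2)"

text \<open>\<open>special\<close> carries the local parameter: it is the vanishing coordinate if
  there is one and an arbitrary choice otherwise. \<open>base\<close> is a different coordinate,
  hence nonzero at \<open>v\<close>, and serves to dehomogenise.\<close>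

definition base :: nat where
  "base = (if special = 1 then 2 else 1)"

lemma special: "special \<in> {1..n + 1}" "\<And>i. i \<in> {1..n + 1} \<Longrightarrow> i \<noteq> special \<Longrightarrow> v i \<noteq> 0"
proof -
  have "special \<in> {1..n + 1} \<and> (\<forall>i. i \<in> {1..n + 1} \<longrightarrow> i \<noteq> special \<longrightarrow> v i \<noteq> 0)"
  proof (cases "\<exists>j\<in>{1..n + 1}. v j = 0")
    case True
    then have "special \<in> {1..n + 1} \<and> v special = 0"
      unfolding special_def by (auto intro: someI2)
    then show ?thesis using zero_unique by blast
  next
    case False
    then show ?thesis using n2 by (auto simp: special_def)
  qed
  then show "special \<in> {1..n + 1}" "\<And>i. i \<in> {1..n + 1} \<Longrightarrow> i \<noteq> special \<Longrightarrow> v i \<noteq> 0" by blast+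
qed

lemma base: "base \<in> {1..n + 1}" "base \<noteq> special" "v base \<noteq> 0"
proof -
  show "base \<in> {1..n + 1}" "base \<noteq> special" using n2 by (auto simp: base_def)
  then show "v base \<noteq> 0" using special(2) by blast
qed

definition line_at :: "nat \<Rightarrow> 'a mpoly" where
  "line_at i = mvar i - mconst (v i / v base) * mvar base"

abbreviation "tau \<equiv> line_at special"

lemma line_at_forms: "i \<in> {1..n + 1} \<Longrightarrow> line_at i \<in> forms n 1"
  unfolding line_at_def using base(1) by (intro forms_diff forms_scale mvar_forms)

lemma poly_at_line_at: "poly_at (line_at i) v = 0"
  using base(3) unfolding line_at_def poly_at_simps(5) by (simp add: poly_at_simps(6))

lemma tau_nth_0: "fps_nth (pullback tau branch) 0 = 0"
  by (simp add: pullback_0_at poly_at_line_at)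

text \<open>Thus \<open>tau\<close> has order exactly one along the branch. If
  \<open>v special = 0\<close>, it is the coordinate \<open>special\<close>, which pulls back to
  \<open>fps_X\<close>; otherwise its linear coefficient is a multiple of a difference of
  slopes.\<close>

lemma tau_nth_1: "fps_nth (pullback tau branch) 1 \<noteq> 0"
proof -
  have eq: "fps_nth (pullback tau branch) 1 =
      fps_nth (branch special) 1 - v special / v base * fps_nth (branch base) 1"
    by (simp add: line_at_def pullback_simps(5,6))
  show ?thesis
  proof (cases "v special = 0")
    case True
    then show ?thesis using special(1) unfolding eq by (simp add: branch_def)
  next
    case False
    then have "\<forall>i\<in>{1..n + 1}. v i \<noteq> 0" using special(2) by blast
    then have "r = 1" using r_cases by blast
    then have "fps_nth (pullback tau branch) 1 =
        v special * fps_nth (root_series k) 1 * (slope special - slope base)"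
      unfolding eq using branch_nth[OF special(1) False, of 1] branch_nth[OF base(1,3), of 1] base(3)
      by (simp add: algebra_simps)
    moreover have "slope special \<noteq> slope base"
      using slope_inj[OF special(1) base(1) False base(3)] base(2) by auto
    moreover have "fps_nth (root_series k) 1 \<noteq> (0::'a)"
      using root_series_nonzero[of 1] n2 by simp
    ultimately show ?thesis using False by simp
  qed
qed

text \<open>The maximal ideal of the local ring at \<open>P\<close> is generated by \<open>tau\<close>.\<close>

definition divisible_by_tau :: "'a mpoly \<Rightarrow> nat \<Rightarrow> bool" where
  "divisible_by_tau F d \<longleftrightarrow> (\<exists>e h G H B. G \<in> forms n e \<and> H \<in> forms n h \<and> B \<in> vanishing_ideal n curve \<and>
     poly_at G v \<noteq> 0 \<and> h + 1 = d + e \<and> G * F = tau * H + B)"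

text \<open>The multiplier is \<open>mvar base\<close> instead of 1 because
  \<open>h + 1 = d + e\<close> has no solution with \<open>d = e = 0\<close>.\<close>

lemma divisible_by_tau_0: "divisible_by_tau 0 d"
  unfolding divisible_by_tau_def
  by (rule exI[of _ 1], rule exI[of _ d], rule exI[of _ "mvar base"], rule exI[of _ 0], rule exI[of _ 0])
     (use base mvar_forms[OF base(1)] in auto)

lemma divisible_by_tau_add:
  assumes "divisible_by_tau F d" "divisible_by_tau F' d"
  shows "divisible_by_tau (F + F') d"
proof -
  obtain e h G H B where 1: "G \<in> forms n e" "H \<in> forms n h" "B \<in> vanishing_ideal n curve"
    "poly_at G v \<noteq> 0" "h + 1 = d + e" "G * F = tau * H + B"
    using assms(1) unfolding divisible_by_tau_def by blast
  obtain e' h' G' H' B' where 2: "G' \<in> forms n e'" "H' \<in> forms n h'" "B' \<in> vanishing_ideal n curve"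
    "poly_at G' v \<noteq> 0" "h' + 1 = d + e'" "G' * F' = tau * H' + B'"
    using assms(2) unfolding divisible_by_tau_def by blast
  have "G * G' * (F + F') = G' * (G * F) + G * (G' * F')" by (simp add: algebra_simps)
  also have "\<dots> = tau * (G' * H + G * H') + (G' * B + G * B')"
    unfolding 1(6) 2(6) by (simp add: algebra_simps)
  finally have eq: "G * G' * (F + F') = tau * (G' * H + G * H') + (G' * B + G * B')" .
  \<comment> \<open>The degree equation in \<open>divisible_by_tau\<close> is there for this
    purpose: both summands of the new quotient get the same degree, so their sum is again a
    form.\<close>
  have deg: "e + h' = e' + h" using 1(5) 2(5) by simp
  have H: "G' * H + G * H' \<in> forms n (e' + h)"
    using forms_mult[OF 2(1) 1(2)] forms_mult[OF 1(1) 2(2)] deg by (intro forms_add) simp_all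
  have B: "G' * B + G * B' \<in> vanishing_ideal n curve"
    using 1 2 by (intro vanishing_ideal_add vanishing_ideal_mult) (auto dest: formsD)
  show ?thesis
    unfolding divisible_by_tau_def
    using forms_mult[OF 1(1) 2(1)] H B eq 1(4,5) 2(4)
    by (intro exI[of _ "e + e'"] exI[of _ "e' + h"] exI[of _ "G * G'"] exI) (auto simp: poly_at_simps)
qed

lemma divisible_by_tau_sum:
  "(\<And>x. x \<in> A \<Longrightarrow> divisible_by_tau (f x) d) \<Longrightarrow> divisible_by_tau (sum f A) d"
  by (induction A rule: infinite_finite_induct) (auto simp: divisible_by_tau_0 divisible_by_tau_add)

lemma divisible_by_tau_mult:
  assumes "M \<in> forms n d'" "divisible_by_tau F d"
  shows "divisible_by_tau (M * F) (d' + d)"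
proof -
  obtain e h G H B where 1: "G \<in> forms n e" "H \<in> forms n h" "B \<in> vanishing_ideal n curve"
    "poly_at G v \<noteq> 0" "h + 1 = d + e" "G * F = tau * H + B"
    using assms(2) unfolding divisible_by_tau_def by blast
  have "G * (M * F) = M * (G * F)" by (simp add: algebra_simps)
  also have "\<dots> = tau * (M * H) + M * B" unfolding 1(6) by (simp add: algebra_simps)
  finally have "G * (M * F) = tau * (M * H) + M * B" .
  then show ?thesis
    unfolding divisible_by_tau_def
    using 1 forms_mult[OF assms(1) 1(2)] vanishing_ideal_mult[OF formsD[OF assms(1)] 1(3)]
    by (intro exI[of _ e] exI[of _ "d' + h"] exI[of _ G] exI) auto
qed

definition fermat_relation :: "nat \<Rightarrow> nat \<Rightarrow> nat \<Rightarrow> 'a mpoly" where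
  "fermat_relation i j m = mconst (minor j m) * mvar i ^ k + mconst (minor m i) * mvar j ^ k +
     mconst (minor i j) * mvar m ^ k"

lemma fermat_relation_vanishing:
  assumes "{i, j, m} \<subseteq> {1..n + 1}"
  shows "fermat_relation i j m \<in> vanishing_ideal n curve"
proof -
  have "fermat_relation i j m \<in> polys n"
    unfolding fermat_relation_def
    using assms by (intro polys_add formsD[OF forms_scale[OF forms_power[OF mvar_forms]]]) auto
  moreover have "poly_at (fermat_relation i j m) x = 0" if "Q \<in> curve" "x \<in> Q" for Q x
  proof -
    have "on_line (\<lambda>i. x i ^ k)"
      using that unfolding on_line_iff fermat_curve_def by blast
    then show ?thesis
      using on_line_relation[OF _ assms] by (simp add: fermat_relation_def poly_at_simps)
  qed
  ultimately show ?thesis by (auto simp: vanishing_ideal_def vanishes_on_def)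
qed

text \<open>The quotient of a difference of \<open>k\<close>-th powers by \<open>line_at i\<close>,
  as a geometric sum. Its value at \<open>v\<close> is \<open>k * v i ^ (k - 1)\<close>, so it is a
  unit of the local ring whenever \<open>v i \<noteq> 0\<close>.\<close>

definition cofactor :: "nat \<Rightarrow> 'a mpoly" where
  "cofactor i = (\<Sum>j<k. (mconst (v i / v base) * mvar base) ^ (k - Suc j) * mvar i ^ j)"

lemma cofactor: "line_at i * cofactor i = mvar i ^ k - mconst ((v i / v base) ^ k) * mvar base ^ k"
proof -
  have "mvar i ^ k - (mconst (v i / v base) * mvar base) ^ k = line_at i * cofactor i"
    unfolding line_at_def cofactor_def by (rule power_diff_sumr2)
  moreover have "mconst c ^ e = mconst (c ^ e)" for c :: 'a and e
    by (induction e) (auto simp: mult_single)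
  ultimately show ?thesis by (simp add: power_mult_distrib)
qed

lemma cofactor_forms: "i \<in> {1..n + 1} \<Longrightarrow> cofactor i \<in> forms n (k - 1)"
  unfolding cofactor_def
proof (rule forms_sum)
  fix j assume i: "i \<in> {1..n + 1}" and j: "j \<in> {..<k}"
  have "(mconst (v i / v base) * mvar base) ^ (k - Suc j) * mvar i ^ j \<in> forms n (1 * (k - Suc j) + 1 * j)"
    using i base(1) by (intro forms_mult forms_power forms_scale mvar_forms)
  then show "(mconst (v i / v base) * mvar base) ^ (k - Suc j) * mvar i ^ j \<in> forms n (k - 1)"
    using j by simp
qed

lemma poly_at_cofactor: "poly_at (cofactor i) v = of_nat k * v i ^ (k - 1)"
proof -
  have "poly_at (cofactor i) v = (\<Sum>j<k. v i ^ (k - Suc j) * v i ^ j)"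
    using base(3) by (simp add: cofactor_def poly_at_simps)
  also have "\<dots> = (\<Sum>j<k. v i ^ (k - 1))"
    by (intro sum.cong) (auto simp flip: power_add)
  finally show ?thesis by simp
qed

text \<open>Modulo the equation of the curve in the coordinates \<open>i\<close>,
  \<open>special\<close>, \<open>base\<close>, the products of \<open>line_at i\<close> and of
  \<open>tau\<close> with their cofactors are proportional. Since \<open>v i \<noteq> 0\<close> in
  the main case, the cofactor of \<open>line_at i\<close> can serve as the multiplier
  \<open>G\<close>.\<close>

lemma divisible_by_tau_line_at:
  assumes i: "i \<in> {1..n + 1}"
  shows "divisible_by_tau (line_at i) 1"
proof -
  consider "i = base" | "i = special" | "i \<noteq> base" "i \<noteq> special" by blast
  then show ?thesis
  proof cases
    case 1
    then have "line_at i = 0" using base(3) by (simp add: line_at_def)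
    then show ?thesis by (simp add: divisible_by_tau_0)
  next
    case 2
    then show ?thesis
      unfolding divisible_by_tau_def
      by (intro exI[of _ 0] exI[of _ "1 :: 'a mpoly"] exI[of _ "0 :: 'a mpoly"]) (auto simp: poly_at_simps)
  next
    case 3
    let ?A = "minor special base" and ?A' = "minor base i" and ?R = "fermat_relation i special base"
    let ?t = "\<lambda>i. (v i / v base) ^ k"
    \<comment> \<open>The relation at the point \<open>v\<close> itself, divided by
      \<open>v base ^ k\<close>, cancels all multiples of \<open>mvar base ^ k\<close>
      below.\<close>
    have "?A * v i ^ k + ?A' * v special ^ k + minor i special * v base ^ k = 0"
      using on_line_relation[OF v_line] i special(1) base(1) by simp
    then have "?A * ?t i + ?A' * ?t special + minor i special = 0"
      using base(3) by (simp add: divide_simps mult.commute)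
    then have c: "mconst ?A * mconst (?t i) + mconst ?A' * mconst (?t special) + mconst (minor i special) = 0"
      by (simp add: mult_single single_add[symmetric])
    have "mconst ?A * (line_at i * cofactor i) + mconst ?A' * (tau * cofactor special) =
        ?R - (mconst ?A * mconst (?t i) + mconst ?A' * mconst (?t special) + mconst (minor i special)) * mvar base ^ k"
      unfolding cofactor fermat_relation_def by (simp add: algebra_simps)
    then have "mconst ?A * (line_at i * cofactor i) + mconst ?A' * (tau * cofactor special) = ?R"
      unfolding c by simp
    then have eq: "(mconst ?A * cofactor i) * line_at i = tau * (mconst (- ?A') * cofactor special) + ?R"
      by (simp add: algebra_simps single_uminus)
    have "v i \<noteq> 0" using special(2) i 3 by blast
    then have "poly_at (mconst ?A * cofactor i) v \<noteq> 0"
      using k_nonzero minor_nonzero[OF special(1) base(1)] base(2)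
      by (simp add: poly_at_simps(6) poly_at_cofactor)
    then show ?thesis
      unfolding divisible_by_tau_def
      using eq forms_scale[OF cofactor_forms[OF i]] forms_scale[OF cofactor_forms[OF special(1)]]
        fermat_relation_vanishing[of i special base] i special(1) base(1) k2
      by (intro exI[of _ "k - 1"] exI[of _ "mconst ?A * cofactor i"]
          exI[of _ "mconst (- ?A') * cofactor special"] exI[of _ ?R]) auto
  qed
qed

end

lemma mconst_sum: "mconst (sum g A) = (\<Sum>x\<in>A. mconst (g x))"
  by (induction A rule: infinite_finite_induct) (auto simp: single_add)

context fermat_branch
begin

text \<open>The variables are exchanged one by one for their multiples of \<open>mvar base\<close>;
  each exchange costs a multiple of some \<open>line_at i\<close>.\<close>

lemma divisible_by_tau_monom:
  assumes "Poly_Mapping.keys m \<subseteq> {1..n + 1}"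
    "(\<Sum>i \<in> Poly_Mapping.keys m. Poly_Mapping.lookup m i) = d"
  shows "divisible_by_tau
    (Poly_Mapping.single m 1 - mconst (monom_at m v / v base ^ d) * mvar base ^ d) d"
  using assms
proof (induction d arbitrary: m)
  case 0
  then show ?case using mdeg_0D[of m] by (simp add: divisible_by_tau_0)
next
  case (Suc d)
  obtain i m' where i: "i \<in> Poly_Mapping.keys m" and m: "m = Poly_Mapping.single i 1 + m'"
    and deg: "(\<Sum>i \<in> Poly_Mapping.keys m'. Poly_Mapping.lookup m' i) = d"
    using Suc.prems(2) by (rule mdeg_Suc_split)
  have "Poly_Mapping.keys m' \<subseteq> Poly_Mapping.keys m"
    unfolding m by (auto simp: in_keys_iff lookup_add)
  then have IH: "divisible_by_tau
      (Poly_Mapping.single m' 1 - mconst (monom_at m' v / v base ^ d) * mvar base ^ d) d"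
    using Suc deg by auto
  have i': "i \<in> {1..n + 1}" using i Suc.prems(1) by auto
  let ?c = "v i / v base" and ?c' = "monom_at m' v / v base ^ d"
  have c: "monom_at m v / v base ^ Suc d = ?c' * ?c"
    by (simp add: m monom_at_add mult_ac)
  have "Poly_Mapping.single m 1 - mconst (monom_at m v / v base ^ Suc d) * mvar base ^ Suc d =
      mvar i * (Poly_Mapping.single m' 1 - mconst ?c' * mvar base ^ d) +
      (mconst ?c' * mvar base ^ d) * line_at i"
  proof -
    have "mconst (?c' * ?c) = mconst ?c' * mconst ?c" by (simp add: mult_single)
    moreover have "Poly_Mapping.single m 1 = mvar i * Poly_Mapping.single m' (1 :: 'a)"
      by (simp add: mvar_def mult_single m)
    ultimately show ?thesis unfolding c line_at_def by (simp add: algebra_simps)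
  qed
  moreover have "divisible_by_tau (mvar i * (Poly_Mapping.single m' 1 - mconst ?c' * mvar base ^ d)) (Suc d)"
    using divisible_by_tau_mult[OF mvar_forms[OF i'] IH] by simp
  moreover have "divisible_by_tau ((mconst ?c' * mvar base ^ d) * line_at i) (Suc d)"
  proof -
    have "mconst ?c' * mvar base ^ d \<in> forms n (1 * d)"
      using base(1) by (intro forms_scale forms_power mvar_forms)
    then show ?thesis
      using divisible_by_tau_mult[OF _ divisible_by_tau_line_at[OF i']] by fastforce
  qed
  ultimately show ?case using divisible_by_tau_add by simp
qed

text \<open>Summing over the monomials of \<open>F\<close>, the subtracted multiples of
  \<open>mvar base ^ d\<close> add up to \<open>poly_at F v / v base ^ d\<close>, which is
  0.\<close>

lemma divisible_by_tau_form:
  assumes F: "F \<in> forms n d" and "poly_at F v = 0"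
  shows "divisible_by_tau F d"
proof -
  let ?K = "Poly_Mapping.keys F" and ?f = "Poly_Mapping.lookup F"
  let ?g = "\<lambda>m. Poly_Mapping.single m 1 - mconst (monom_at m v / v base ^ d) * mvar base ^ d"
  have "mconst (poly_at F v / v base ^ d) = (\<Sum>m\<in>?K. mconst (?f m) * mconst (monom_at m v / v base ^ d))"
    by (simp add: poly_at_eq eval_at_def sum_divide_distrib mult_single mconst_sum)
  then have 0: "(\<Sum>m\<in>?K. mconst (?f m) * mconst (monom_at m v / v base ^ d)) = 0"
    using assms(2) by simp
  have "(\<Sum>m\<in>?K. mconst (?f m) * ?g m) = (\<Sum>m\<in>?K. mconst (?f m) * Poly_Mapping.single m 1) -
      (\<Sum>m\<in>?K. mconst (?f m) * mconst (monom_at m v / v base ^ d)) * mvar base ^ d"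
    by (simp add: right_diff_distrib sum_subtractf sum_distrib_right mult.assoc)
  also have "\<dots> = F"
    unfolding 0 by (simp add: mult_single poly_mapping_sum_single[of F, symmetric])
  finally have F_eq: "F = (\<Sum>m\<in>?K. mconst (?f m) * ?g m)" ..
  have "divisible_by_tau (mconst (?f m) * ?g m) d" if "m \<in> ?K" for m
    using divisible_by_tau_mult[OF forms_const divisible_by_tau_monom, of m d "?f m"] F that
    by (auto simp: forms_def polys_def)
  then show ?thesis by (subst F_eq) (rule divisible_by_tau_sum)
qed

text \<open>Once \<open>tau ^ m\<close> is split off, coefficient \<open>m\<close> of the pullback
  is a nonzero multiple of the value of \<open>H\<close> at \<open>v\<close>. If it vanishes,
  \<open>H\<close> is divisible by \<open>tau\<close> once more.\<close>

lemma divide_by_tau_power: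
  assumes "F \<in> forms n d" "\<And>i. i < m \<Longrightarrow> fps_nth (pullback F branch) i = 0"
  shows "\<exists>e h. \<exists>G\<in>forms n e. \<exists>H\<in>forms n h. \<exists>B\<in>vanishing_ideal n curve.
    poly_at G v \<noteq> 0 \<and> G * F = tau ^ m * H + B"
  using assms(2)
proof (induction m)
  case 0
  show ?case
    by (rule exI[of _ 0], rule exI[of _ d], rule bexI[of _ 1], rule bexI[of _ F], rule bexI[of _ 0])
       (use assms(1) in \<open>auto simp: poly_at_simps\<close>)
next
  case (Suc m)
  then obtain e h G H B where 1: "G \<in> forms n e" "H \<in> forms n h" "B \<in> vanishing_ideal n curve"
    "poly_at G v \<noteq> 0" "G * F = tau ^ m * H + B"
    by (metis less_Suc_eq)
  have "pullback (G * F) branch = pullback (tau ^ m * H + B) branch" using 1(5) by simp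
  then have "pullback G branch * pullback F branch = pullback tau branch ^ m * pullback H branch"
    using pullback_vanishing_ideal[OF 1(3)] by (simp add: pullback_simps(4,6,9))
  moreover have "fps_nth (pullback G branch * pullback F branch) m = 0"
    using Suc.prems by (intro fps_mult_nth_eq_0[of "Suc m"]) auto
  ultimately have "fps_nth (pullback tau branch ^ m * pullback H branch) m = 0" by simp
  then have "poly_at H v = 0"
    using tau_nth_1 unfolding fps_power_mult_nth[OF tau_nth_0] pullback_0_at by simp
  then obtain e' h' G' H' B' where 2: "G' \<in> forms n e'" "H' \<in> forms n h'" "B' \<in> vanishing_ideal n curve"
    "poly_at G' v \<noteq> 0" "G' * H = tau * H' + B'"
    using divisible_by_tau_form[OF 1(2)] unfolding divisible_by_tau_def by blast
  have "(G' * G) * F = G' * (G * F)" by (simp only: mult.assoc)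
  also have "\<dots> = tau ^ m * (G' * H) + G' * B"
    unfolding 1(5) by (simp add: algebra_simps)
  also have "\<dots> = tau ^ Suc m * H' + (tau ^ m * B' + G' * B)"
    unfolding 2(5) by (simp add: algebra_simps)
  finally have eq: "(G' * G) * F = tau ^ Suc m * H' + (tau ^ m * B' + G' * B)" .
  have B: "tau ^ m * B' + G' * B \<in> vanishing_ideal n curve"
    using 1(3) 2(1,3) formsD[OF forms_power[OF line_at_forms[OF special(1)]]]
    by (intro vanishing_ideal_add vanishing_ideal_mult) (auto dest: formsD)
  show ?case
    by (rule exI[of _ "e' + e"], rule exI[of _ h'], rule bexI[OF _ forms_mult[OF 2(1) 1(1)]],
        rule bexI[OF _ 2(2)], rule bexI[OF _ B])
       (use eq 1(4) 2(4) in \<open>simp add: poly_at_simps(6)\<close>)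
qed

lemma pullback_ideal_power:
  assumes "A \<in> ideal_power n (vanishing_ideal n {P}) m" "i < m"
  shows "fps_nth (pullback A branch) i = 0"
proof -
  obtain q :: nat and c f where A: "A = (\<Sum>j<q. c j * (\<Prod>i<m. f j i))"
    and "\<forall>j<q. c j \<in> polys n \<and> (\<forall>i<m. f j i \<in> vanishing_ideal n {P})"
    using assms(1) unfolding ideal_power_def mem_Collect_eq by blast
  then have f: "f j i \<in> vanishing_ideal n {P}" if "j < q" "i < m" for j i using that by blast
  have "fps_nth (pullback (f j i) branch) 0 = 0" if "j < q" "i < m" for j i
    using f[OF that] fun_space.span_base[of v "{v}"]
    by (auto simp: pullback_0_at vanishing_ideal_def vanishes_on_def)
  then have "fps_nth (pullback (c j) branch * (\<Prod>i<m. pullback (f j i) branch)) i = 0" if "j < q" for j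
    using that assms(2) by (intro fps_mult_nth_eq_0[of m] fps_prod_nth_eq_0) auto
  then show ?thesis by (simp add: A pullback_simps(6,7,8) fps_sum_nth)
qed

text \<open>The match between ideals and series. Vanishing coefficients allow division by
  \<open>tau ^ m\<close>; conversely a multiplier \<open>G\<close> that is nonzero at
  \<open>v\<close> pulls back to an invertible series and can be cancelled.\<close>

theorem vanishes_to_order_iff:
  assumes F: "F \<in> forms n d"
  shows "vanishes_to_order n curve P F m \<longleftrightarrow> (\<forall>i<m. fps_nth (pullback F branch) i = 0)"
proof
  assume "\<forall>i<m. fps_nth (pullback F branch) i = 0"
  then obtain e h G H B where 1: "G \<in> forms n e" "H \<in> forms n h" "B \<in> vanishing_ideal n curve"
    "poly_at G v \<noteq> 0" "G * F = tau ^ m * H + B"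
    using divide_by_tau_power[OF F] by metis
  have tau: "tau \<in> vanishing_ideal n {P}"
    using formsD[OF line_at_forms[OF special(1)]] vanishes_on_P_iff[OF line_at_forms[OF special(1)]]
    by (simp add: vanishing_ideal_def poly_at_line_at)
  have "tau ^ m * H = (\<Sum>j<Suc 0. H * (\<Prod>i<m. tau))" by (simp add: mult.commute)
  then have "tau ^ m * H \<in> ideal_power n (vanishing_ideal n {P}) m"
    unfolding ideal_power_def mem_Collect_eq using tau formsD[OF 1(2)]
    by (intro exI[of _ "Suc 0"] exI[of _ "\<lambda>_. H"] exI[of _ "\<lambda>_ _. tau"]) simp
  then show "vanishes_to_order n curve P F m"
    unfolding vanishes_to_order_def using 1 vanishes_on_P_iff[OF 1(1)] by blast
next
  assume "vanishes_to_order n curve P F m"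
  then obtain e G A B where 1: "G \<in> forms n e" "\<not> vanishes_on G P"
    "A \<in> ideal_power n (vanishing_ideal n {P}) m" "B \<in> vanishing_ideal n curve" "G * F = A + B"
    unfolding vanishes_to_order_def by blast
  let ?G = "pullback G branch"
  have G0: "fps_nth ?G 0 \<noteq> 0" using 1(2) vanishes_on_P_iff[OF 1(1)] by (simp add: pullback_0_at)
  have "pullback (G * F) branch = pullback (A + B) branch" using 1(5) by simp
  then have "?G * pullback F branch = pullback A branch"
    using pullback_vanishing_ideal[OF 1(4)] by (simp add: pullback_simps(4,6))
  then have "inverse ?G * (?G * pullback F branch) = inverse ?G * pullback A branch" by simp
  then have "pullback F branch = inverse ?G * pullback A branch"
    using G0 by (simp add: inverse_mult_eq_1 flip: mult.assoc)
  then show "\<forall>i<m. fps_nth (pullback F branch) i = 0"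
    using pullback_ideal_power[OF 1(3)] by (metis fps_mult_nth_eq_0)
qed

lemma vanishing_order_ge:
  assumes "F \<in> forms n d" "\<And>i. i < m \<Longrightarrow> fps_nth (pullback F branch) i = 0"
  shows "enat m \<le> vanishing_order n curve P F"
  unfolding vanishing_order_def using assms by (intro Sup_upper) (auto simp: vanishes_to_order_iff)

lemma vanishing_order_le:
  assumes "F \<in> forms n d" "fps_nth (pullback F branch) m \<noteq> 0"
  shows "vanishing_order n curve P F \<le> enat m"
  unfolding vanishing_order_def using assms
  by (intro Sup_least) (auto simp: vanishes_to_order_iff intro: leI)

section \<open>Osculating flags of the curve\<close>

text \<open>The Taylor coefficient vectors of the branch, that is, divided derivatives, which are
  meaningful in every characteristic.\<close>

definition jet :: "nat \<Rightarrow> nat \<Rightarrow> 'a" where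
  "jet m = (\<lambda>i. fps_nth (branch i) m)"

lemma pullback_nth_linear:
  assumes "L \<in> forms n 1"
  shows "fps_nth (pullback L branch) m = poly_at L (jet m)"
proof -
  obtain a where L: "L = linear_form n a" using assms by (rule linear_formE)
  show ?thesis
    unfolding L pullback_linear_form poly_at_linear_form jet_def by (simp add: fps_sum_nth del: sum.cl_ivl_Suc One_nat_def)
qed

lemma jet_coord: "jet m \<in> coord_space n"
  by (auto simp: jet_def coord_space_def branch_def)

context
  fixes h :: "nat \<Rightarrow> nat"
  assumes h: "strict_mono h" and span: "fun_space.span ((\<lambda>i. jet (h i)) ` {..n}) = coord_space n"
    and gaps: "\<And>q m. q \<le> n \<Longrightarrow> m < h q \<Longrightarrow> jet m \<noteq> 0 \<Longrightarrow> \<exists>i<q. m = h i"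
begin

text \<open>Coefficient \<open>m\<close> of the pullback is the value of \<open>L\<close> at
  \<open>jet m\<close>. Below \<open>h q\<close> a jet is either one of those at which
  \<open>L\<close> vanishes or, by \<open>gaps\<close>, zero.\<close>

lemma linear_order_ge:
  assumes "L \<in> forms n 1" "q \<le> n" "\<And>i. i < q \<Longrightarrow> poly_at L (jet (h i)) = 0"
  shows "enat (h q) \<le> vanishing_order n curve P L"
proof (rule vanishing_order_ge[OF assms(1)])
  fix m assume "m < h q"
  obtain a where "L = linear_form n a" using assms(1) by (rule linear_formE)
  then have "poly_at L 0 = 0" by (simp add: poly_at_linear_form)
  then show "fps_nth (pullback L branch) m = 0"
    unfolding pullback_nth_linear[OF assms(1)]
    using gaps[OF assms(2) \<open>m < h q\<close>] assms(3) by (cases "jet m = 0") auto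
qed

lemma linear_order_le:
  assumes "L \<in> forms n 1" "q \<le> n" "poly_at L (jet (h q)) \<noteq> 0"
  shows "vanishing_order n curve P L \<le> enat (h q)"
  using assms by (intro vanishing_order_le[OF assms(1)]) (simp add: pullback_nth_linear)

lemma contact_order_jet:
  assumes "s < n"
  shows "contact_order n curve P (fun_space.span ((\<lambda>i. jet (h i)) ` {..s})) = enat (h (s + 1))"
  using span _ _ h assms
proof (rule contact_order_flag)
  show "enat (h q) \<le> vanishing_order n curve P L"
    if "L \<in> forms n 1" "q \<le> n" "\<And>i. i < q \<Longrightarrow> poly_at L (jet (h i)) = 0" for L q
    using that by (rule linear_order_ge)
  show "vanishing_order n curve P L \<le> enat (h q)"
    if "L \<in> forms n 1" "q \<le> n" "poly_at L (jet (h q)) \<noteq> 0" for L q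
    using that by (rule linear_order_le)
qed

lemma osculating_plane_jet:
  assumes "s < n"
  shows "osculating_plane n curve s P = fun_space.span ((\<lambda>i. jet (h i)) ` {..s})"
  using span _ _ h assms
proof (rule osculating_plane_flag)
  show "enat (h q) \<le> vanishing_order n curve P L"
    if "L \<in> forms n 1" "q \<le> n" "\<And>i. i < q \<Longrightarrow> poly_at L (jet (h i)) = 0" for L q
    using that by (rule linear_order_ge)
  show "vanishing_order n curve P L \<le> enat (h q)"
    if "L \<in> forms n 1" "q \<le> n" "poly_at L (jet (h q)) \<noteq> 0" for L q
    using that by (rule linear_order_le)
qed

end

section \<open>The flags of jets at points of either kind\<close>

lemma jet_nth:
  assumes "i \<in> {1..n + 1}" "v i \<noteq> 0"
  shows "jet m i = (if r dvd m then v i * fps_nth (root_series k) (m div r) * slope i ^ (m div r) else 0)"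
  using branch_nth[OF assms] by (simp add: jet_def)

lemma jet_generic:
  assumes "\<forall>i\<in>{1..n + 1}. v i \<noteq> 0" "i \<in> {1..n + 1}"
  shows "jet m i = v i * fps_nth (root_series k) m * slope i ^ m"
proof -
  have "r = 1" using r_cases assms(1) by blast
  then have "r dvd m" "m div r = m" by simp_all
  with jet_nth[OF assms(2)] assms show ?thesis by simp
qed

text \<open>A linear form killing the first \<open>n + 1\<close> jets satisfies a Vandermonde system
  in the \<open>n + 1\<close> different slopes, after cancelling the nonzero coefficients of
  \<open>root_series\<close>.\<close>

lemma span_jet_generic:
  assumes "\<forall>i\<in>{1..n + 1}. v i \<noteq> 0"
  shows "fun_space.span (jet ` {..n}) = coord_space n"
proof (rule span_eq_coord_space_iff_dual)
  fix a i assume a: "\<And>m. m \<in> {..n} \<Longrightarrow> dot n a (jet m) = 0" and i: "i \<in> {1..n + 1}"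
  have "(\<Sum>i\<in>{1..n + 1}. (a i * v i) * slope i ^ m) = 0" if "m < n + 1" for m
  proof -
    have "0 = (\<Sum>i = 1..n + 1. a i * jet m i)" using a[of m] that by (simp add: dot_def)
    also have "\<dots> = (\<Sum>i = 1..n + 1. fps_nth (root_series k) m * ((a i * v i) * slope i ^ m))"
      by (rule sum.cong) (use assms in \<open>simp_all add: jet_generic\<close>)
    also have "\<dots> = fps_nth (root_series k) m * (\<Sum>i = 1..n + 1. (a i * v i) * slope i ^ m)"
      by (simp only: sum_distrib_left)
    finally show ?thesis using root_series_nonzero[of m] that by simp
  qed
  then have "a i * v i = 0"
    using i slope_inj assms by (intro power_sums_zero_imp_zero[of "{1..n + 1}" slope "n + 1" "\<lambda>i. a i * v i"])
      (auto simp: inj_on_def)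
  then show "a i = 0" using assms i by simp
qed (rule jet_coord)

lemma generic_flag:
  assumes "\<forall>i\<in>{1..n + 1}. v i \<noteq> 0" "s < n"
  shows "osculating_plane n curve s P = fun_space.span (jet ` {..s})"
    "contact_order n curve P (osculating_plane n curve s P) = enat (s + 1)"
proof -
  have mono: "strict_mono (\<lambda>i::nat. i)" by (simp add: strict_mono_def)
  show o: "osculating_plane n curve s P = fun_space.span (jet ` {..s})"
    using osculating_plane_jet[OF mono span_jet_generic[OF assms(1)] _ assms(2)] by auto
  show "contact_order n curve P (osculating_plane n curve s P) = enat (s + 1)"
    using contact_order_jet[OF mono span_jet_generic[OF assms(1)] _ assms(2)] unfolding o by auto
qed

text \<open>The vanishing orders of linear forms at a fixed point: \<open>0, 1, k, 2k, \<dots>, (n - 1)k\<close>.\<close>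

definition fixed_order :: "nat \<Rightarrow> nat" where
  "fixed_order i = (if i = 0 then 0 else if i = 1 then 1 else (i - 1) * k)"

lemma fixed_order_mono: "strict_mono fixed_order"
proof (rule strict_mono_Suc_iff[THEN iffD2], rule allI)
  show "fixed_order i < fixed_order (Suc i)" for i
    using k2 by (cases i rule: nat.exhaust; cases "i - 1") (auto simp: fixed_order_def)
qed

text \<open>Index shift: the order 1 sits between 0 and \<open>k\<close>, so \<open>q * k\<close>
  has index \<open>q + 1\<close> unless \<open>q = 0\<close>.\<close>

lemma fixed_order_mult: "fixed_order (if q = 0 then 0 else q + 1) = q * k"
  by (simp add: fixed_order_def)

context
  fixes j assumes j: "j \<in> {1..n + 1}" "v j = 0"
begin

lemma jet_fixed: "jet m i = (if i \<notin> {1..n + 1} then 0 else if i = j then (if m = 1 then 1 else 0)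
   else if k dvd m then v i * fps_nth (root_series k) (m div k) * slope i ^ (m div k) else 0)"
proof -
  have r: "r dvd m \<longleftrightarrow> k dvd m" "m div r = m div k" using zero_coord[OF j] by simp_all
  consider "i \<notin> {1..n + 1}" | "i = j" | "i \<in> {1..n + 1}" "i \<noteq> j" by blast
  then show ?thesis
  proof cases
    case 1
    then show ?thesis by (auto simp: jet_def branch_def)
  next
    case 2
    then show ?thesis using j by (auto simp: jet_def branch_def)
  next
    case 3
    then have "v i \<noteq> 0" using zero_unique j by blast
    with 3 jet_nth[of i m] show ?thesis unfolding r by simp
  qed
qed

lemma fixed_gaps:
  assumes "m < fixed_order q" "jet m \<noteq> 0"
  shows "\<exists>i<q. m = fixed_order i"
proof -
  have "\<exists>i. jet m i \<noteq> 0" using assms(2) by (auto simp: fun_eq_iff)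
  then have "m = 1 \<or> k dvd m" by (auto simp: jet_fixed split: if_splits)
  then obtain i where i: "m = fixed_order i"
  proof
    assume "m = 1"
    then show ?thesis using that[of 1] by (simp add: fixed_order_def)
  next
    assume "k dvd m"
    then obtain p where "m = k * p" by (elim dvdE)
    then have "m = fixed_order (if p = 0 then 0 else p + 1)"
      unfolding fixed_order_mult by (simp only: mult.commute)
    then show ?thesis by (rule that)
  qed
  then show ?thesis using assms(1) fixed_order_mono by (auto simp: strict_mono_less)
qed

text \<open>\<open>jet 1\<close> is supported on the coordinate \<open>j\<close> alone and forces
  \<open>a j = 0\<close>. On the other \<open>n\<close> coordinates the jets at the multiples of
  \<open>k\<close> form a Vandermonde system of size \<open>n\<close>.\<close>

lemma span_jet_fixed: "fun_space.span ((\<lambda>i. jet (fixed_order i)) ` {..n}) = coord_space n"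
proof (rule span_eq_coord_space_iff_dual)
  fix a i assume a: "\<And>m. m \<in> {..n} \<Longrightarrow> dot n a (jet (fixed_order m)) = 0" and i: "i \<in> {1..n + 1}"
  have nk: "\<not> k dvd 1" using k2 by auto
  have "0 = dot n a (jet 1)" using a[of 1] n2 by (simp add: fixed_order_def)
  also have "\<dots> = (\<Sum>i = 1..n + 1. if i = j then a i else 0)"
    unfolding dot_def by (rule sum.cong) (use nk in \<open>auto simp: jet_fixed\<close>)
  also have "\<dots> = a j" using j(1) by (simp only: sum.delta finite_atLeastAtMost if_True)
  finally have aj: "a j = 0" ..
  have "(\<Sum>i\<in>{1..n + 1} - {j}. (a i * v i) * slope i ^ m) = 0" if "m < n" for m
  proof -
    have "0 = (\<Sum>i = 1..n + 1. a i * jet (m * k) i)"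
      using a[of "if m = 0 then 0 else m + 1"] that unfolding fixed_order_mult by (simp add: dot_def)
    also have "\<dots> = (\<Sum>i\<in>{1..n + 1} - {j}. a i * jet (m * k) i)"
      by (rule sum.mono_neutral_right) (use aj in auto)
    also have "\<dots> = (\<Sum>i\<in>{1..n + 1} - {j}. fps_nth (root_series k) m * ((a i * v i) * slope i ^ m))"
      by (rule sum.cong) (use k2 in \<open>simp_all add: jet_fixed\<close>)
    also have "\<dots> = fps_nth (root_series k) m * (\<Sum>i\<in>{1..n + 1} - {j}. (a i * v i) * slope i ^ m)"
      by (simp only: sum_distrib_left)
    finally show ?thesis using root_series_nonzero[of m] that by simp
  qed
  moreover have nz: "v i \<noteq> 0" if "i \<in> {1..n + 1} - {j}" for i using that zero_unique j by blast
  moreover have "inj_on slope ({1..n + 1} - {j})"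
    using slope_inj nz by (auto simp: inj_on_def)
  moreover have "card ({1..n + 1} - {j}) \<le> n" using j(1) by simp
  ultimately have "a i * v i = 0" if "i \<noteq> j"
    using i that by (intro power_sums_zero_imp_zero[of "{1..n + 1} - {j}" slope n "\<lambda>i. a i * v i"]) auto
  then show "a i = 0" using nz[of i] aj i by (cases "i = j") auto
qed (rule jet_coord)

lemma contact_order_fixed:
  "contact_order n curve P (osculating_plane n curve (n - 1) P) = enat ((n - 1) * k)"
proof -
  have "n - 1 < n" using n2 by simp
  moreover have "fixed_order (n - 1 + 1) = (n - 1) * k" using n2 by (simp add: fixed_order_def)
  ultimately show ?thesis
    using osculating_plane_jet[OF fixed_order_mono span_jet_fixed fixed_gaps, of "n - 1"]
      contact_order_jet[OF fixed_order_mono span_jet_fixed fixed_gaps, of "n - 1"] by simp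
qed

end

end

section \<open>Existence of branches, and the fixed points\<close>

context fermat
begin

lemma on_line_al: "on_line al" and on_line_be: "on_line be"
  by (auto simp: on_line_def al_def be_def)

lemma generic_branch:
  assumes "v \<noteq> 0" "v \<in> coord_space n" "on_line (\<lambda>i. v i ^ k)" "\<forall>i\<in>{1..n + 1}. v i \<noteq> 0"
  shows "fermat_branch k n l v be 1"
proof unfold_locales
  \<comment> \<open>\<open>be\<close> is the point of the line with first coordinate 0 and second
    coordinate 1, so this is just \<open>v 1 ^ k\<close>.\<close>
  show "v 1 ^ k * be 2 - v 2 ^ k * be 1 \<noteq> 0"
    using assms(4) by (simp add: be_def)
qed (use assms on_line_be in auto)

lemma fixed_branch:
  assumes v: "v \<noteq> 0" "v \<in> coord_space n" "on_line (\<lambda>i. v i ^ k)" and j: "j \<in> {1..n + 1}" "v j = 0"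
  obtains w where "fermat_branch k n l v w k"
proof -
  \<comment> \<open>A point of the line normalised to have coordinate \<open>j\<close> equal to 1:
    \<open>al\<close> is 1 at index 1, \<open>be\<close> is 1 at index 2 and \<open>- 1\<close> from
    index 3 on.\<close>
  define w where "w = (if j = 1 then al else if j = 2 then be else (\<lambda>i. - 1 * be i))"
  have w: "on_line w" using on_line_al on_line_be on_line_scale[OF on_line_be, of "- 1"] by (auto simp: w_def)
  have wj: "w j = 1" using j by (auto simp: w_def al_def be_def)
  have "\<exists>m\<in>{1..n + 1}. m \<noteq> j" using n2 by (intro bexI[of _ "if j = 1 then 2 else 1"]) auto
  then obtain m where m: "m \<in> {1..n + 1}" "m \<noteq> j" by blast
  then have "v m \<noteq> 0" using curve_zero_unique[OF v(3,1,2) _ j(1) _ j(2)] by blast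
  then have "v 1 ^ k * w 2 - v 2 ^ k * w 1 \<noteq> 0"
    using on_line_cross[OF v(3) w j(1) m(1)] wj j(2) k2 by (auto simp: power_0_left)
  then have "fermat_branch k n l v w k"
    using v w wj j by unfold_locales auto
  then show ?thesis by (rule that)
qed

text \<open>A generator fixing the point has \<open>v\<close> as an eigenvector. If all coordinates
  were nonzero, one other than \<open>j\<close> would give the eigenvalue 1 and coordinate
  \<open>j\<close> the eigenvalue \<open>z\<close>, but a primitive root is not 1 for
  \<open>k \<ge> 2\<close>.\<close>

lemma in_H0_fixed_points_iff:
  assumes v: "v \<noteq> 0" "v \<in> coord_space n" "on_line (\<lambda>i. v i ^ k)"
  shows "fun_space.span {v} \<in> H0_fixed_points k n l \<longleftrightarrow> (\<exists>j\<in>{1..n + 1}. v j = 0)"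
proof
  let ?P = "fun_space.span {v}"
  assume "?P \<in> H0_fixed_points k n l"
  then obtain j z where j: "j \<in> {1..n + 1}" and z: "is_primitive_root k z"
    and inv: "(\<lambda>x. x(j := z * x j)) ` ?P = ?P"
    unfolding H0_fixed_points_def H0_generators_def by blast
  have "v(j := z * v j) \<in> ?P"
    using inv fun_space.span_base[of v "{v}"] by blast
  then obtain c where c: "v(j := z * v j) = (\<lambda>i. c * v i)" by (auto simp: span_singleton_eq)
  show "\<exists>j\<in>{1..n + 1}. v j = 0"
  proof (rule ccontr)
    assume *: "\<not> ?thesis"
    define m :: nat where "m = (if j = 1 then 2 else 1)"
    have m: "m \<in> {1..n + 1}" "m \<noteq> j" using n2 by (auto simp: m_def)
    have "v m = c * v m" using fun_cong[OF c, of m] m by simp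
    then have "c = 1" using * m by auto
    moreover have "z * v j = c * v j" using fun_cong[OF c, of j] by simp
    ultimately have "z = 1" using * j by auto
    moreover have "0 < (1::nat) \<and> 1 < k \<longrightarrow> z ^ 1 \<noteq> 1"
      using z unfolding is_primitive_root_def by blast
    ultimately show False using k2 by simp
  qed
next
  let ?P = "fun_space.span {v}"
  assume "\<exists>j\<in>{1..n + 1}. v j = 0"
  then obtain j where j: "j \<in> {1..n + 1}" "v j = 0" by blast
  obtain z :: 'a where z: "is_primitive_root k z" using primitive_root_exists[OF k_nonzero] by blast
  have "(\<lambda>x. x(j := z * x j)) x = x" if "x \<in> ?P" for x
    using that j(2) by (auto simp: span_singleton_eq)
  then have "(\<lambda>x. x(j := z * x j)) ` ?P = ?P" by (simp add: image_cong[of ?P ?P _ "\<lambda>x. x"])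
  then show "?P \<in> H0_fixed_points k n l"
    unfolding H0_fixed_points_def H0_generators_def
    using j(1) z curve_span_iff[OF v(1,2)] v(3) by blast
qed

theorem hyper_osculating_points_eq:
  assumes "(n - 1) * (k - 1) > 2"
  shows "hyper_osculating_points n curve = H0_fixed_points k n l"
proof -
  have "P \<in> hyper_osculating_points n curve \<longleftrightarrow> P \<in> H0_fixed_points k n l" if P: "P \<in> curve" for P
  proof -
    obtain v where v: "v \<noteq> 0" "v \<in> coord_space n" "P = fun_space.span {v}" "on_line (\<lambda>i. v i ^ k)"
      using P by (rule curveE)
    show ?thesis
    proof (cases "\<exists>j\<in>{1..n + 1}. v j = 0")
      case True
      then obtain j where j: "j \<in> {1..n + 1}" "v j = 0" by blast
      obtain w where "fermat_branch k n l v w k" using fixed_branch[OF v(1,2,4) j] .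
      then interpret fermat_branch k n l v w k .
      \<comment> \<open>The bound on \<open>(n - 1) * (k - 1)\<close> enters here: it lifts the
        contact order \<open>(n - 1) * k\<close> above \<open>n\<close>.\<close>
      have "(n - 1) * k = (n - 1) * (k - 1) + (n - 1)" using k2 by (cases k) auto
      then have "n < (n - 1) * k" using assms n2 by linarith
      then have "P \<in> hyper_osculating_points n curve"
        using P contact_order_fixed[OF j] v(3) by (simp add: hyper_osculating_points_def)
      then show ?thesis using in_H0_fixed_points_iff[OF v(1,2,4)] True v(3) by simp
    next
      case False
      then have nz: "\<forall>i\<in>{1..n + 1}. v i \<noteq> 0" by blast
      interpret fermat_branch k n l v be 1 using generic_branch[OF v(1,2,4) nz] .
      have "P \<notin> hyper_osculating_points n curve"
        using generic_flag(2)[OF nz, of "n - 1"] n2 v(3) by (simp add: hyper_osculating_points_def)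
      then show ?thesis using in_H0_fixed_points_iff[OF v(1,2,4)] False v(3) by simp
    qed
  qed
  then show ?thesis by (auto simp: hyper_osculating_points_def H0_fixed_points_def)
qed

text \<open>Scale coordinate \<open>a j\<close> to 1. With coordinate \<open>j\<close> zero, the
  three-term relation prescribes the \<open>k\<close>-th power \<open>d j b\<close> of each
  coordinate \<open>b\<close>, which leaves finitely many choices.\<close>

lemma finite_H0_fixed_points: "finite (H0_fixed_points k n l)"
proof -
  define a where "a j = (if j = 1 then 2 else 1 :: nat)" for j :: nat
  define d where "d j b = - minor b j / minor j (a j)" for j b
  define X where "X j = {x. \<forall>b. (b \<in> {1..n + 1} \<longrightarrow> x b \<in> (\<Union>b\<in>{1..n + 1}. {z. z ^ k = d j b})) \<and>
      (b \<notin> {1..n + 1} \<longrightarrow> x b = 0)}" for j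
  have "finite {z :: 'a. z ^ k = y}" for y
  proof -
    have "monom 1 k - [:y:] \<noteq> 0"
      using k2 by (auto simp: poly_eq_iff intro!: exI[of _ k] simp: coeff_pCons split: nat.splits)
    then have "finite {z. poly (monom 1 k - [:y:]) z = 0}" by (rule poly_roots_finite)
    then show ?thesis by (simp add: poly_monom)
  qed
  then have "finite (X j)" for j
    unfolding X_def by (intro finite_set_of_finite_funs) auto
  then have "finite (\<Union>j\<in>{1..n + 1}. (\<lambda>x. fun_space.span {x}) ` X j)" by blast
  moreover have "H0_fixed_points k n l \<subseteq> (\<Union>j\<in>{1..n + 1}. (\<lambda>x. fun_space.span {x}) ` X j)"
  proof
    fix P assume P: "P \<in> H0_fixed_points k n l"
    then have "P \<in> curve" by (simp add: H0_fixed_points_def)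
    then obtain v where v: "v \<noteq> 0" "v \<in> coord_space n" "P = fun_space.span {v}" "on_line (\<lambda>i. v i ^ k)"
      by (rule curveE)
    have "\<exists>j\<in>{1..n + 1}. v j = 0"
      using P in_H0_fixed_points_iff[OF v(1,2,4)] unfolding v(3) by (rule iffD1[rotated])
    then obtain j where j: "j \<in> {1..n + 1}" "v j = 0" by blast
    have a: "a j \<in> {1..n + 1}" "j \<noteq> a j" using n2 by (auto simp: a_def)
    have va: "v (a j) \<noteq> 0"
      using curve_zero_unique[OF v(4,1,2) a(1) j(1) _ j(2)] a(2) by auto
    define x where "x = (\<lambda>i. inverse (v (a j)) * v i)"
    have x0: "i \<notin> {1..n + 1} \<Longrightarrow> x i = 0" for i using v(2) by (auto simp: x_def coord_space_def)
    have lx: "on_line (\<lambda>i. x i ^ k)"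
      using on_line_scale[OF v(4), of "inverse (v (a j)) ^ k"] by (simp add: x_def power_mult_distrib)
    have xa: "x (a j) = 1" "x j = 0" using va j by (simp_all add: x_def)
    have "x b ^ k = d j b" if "b \<in> {1..n + 1}" for b
    proof -
      have "minor b j + minor j (a j) * x b ^ k = 0"
        using on_line_relation[OF lx, of j "a j" b] xa j(1) a(1) that k2 by (simp add: power_0_left)
      then show ?thesis
        using minor_nonzero[OF j(1) a] by (simp add: d_def field_simps eq_neg_iff_add_eq_0)
    qed
    then have "x \<in> X j" using x0 by (auto simp: X_def)
    moreover have "fun_space.span {x} = P"
    proof -
      have "fun_space.span ((\<lambda>y i. inverse (v (a j)) * y i) ` {v}) = fun_space.span {v}"
        by (rule fun_space.span_image_scale) (use va in auto)
      then show ?thesis by (simp add: x_def v(3))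
    qed
    ultimately show "P \<in> (\<Union>j\<in>{1..n + 1}. (\<lambda>x. fun_space.span {x}) ` X j)" using j(1) by blast
  qed
  ultimately show ?thesis by (rule finite_subset[rotated])
qed

end

section \<open>Plucker vectors\<close>

lemma det_mat_scale:
  fixes \<rho> \<sigma> :: "nat \<Rightarrow> 'a::field"
  shows "det (mat N N (\<lambda>(i, j). \<rho> i * \<sigma> j * a i j)) =
    (\<Prod>i<N. \<rho> i) * (\<Prod>j<N. \<sigma> j) * det (mat N N (\<lambda>(i, j). a i j))"
proof -
  have "det (mat N N (\<lambda>(i, j). \<rho> i * \<sigma> j * a i j)) =
      (\<Sum>p | p permutes {0..<N}. signof p * (\<Prod>i = 0..<N. \<rho> i * \<sigma> (p i) * a i (p i)))"
    by (subst det_def'[of _ N]) (auto intro!: sum.cong prod.cong simp: permutes_in_image)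
  also have "\<dots> = (\<Sum>p | p permutes {0..<N}. (\<Prod>i<N. \<rho> i) * (\<Prod>j<N. \<sigma> j) *
      (signof p * (\<Prod>i = 0..<N. a i (p i))))"
  proof (rule sum.cong[OF refl])
    fix p assume "p \<in> {p. p permutes {0..<N}}"
    then have p: "p permutes {0..<N}" by simp
    have "(\<Prod>i = 0..<N. \<sigma> (p i)) = (\<Prod>j<N. \<sigma> j)"
      using prod.permute[OF p, of \<sigma>] by (simp add: atLeast0LessThan)
    then show "signof p * (\<Prod>i = 0..<N. \<rho> i * \<sigma> (p i) * a i (p i)) =
        (\<Prod>i<N. \<rho> i) * (\<Prod>j<N. \<sigma> j) * (signof p * (\<Prod>i = 0..<N. a i (p i)))"
      by (simp add: prod.distrib atLeast0LessThan mult_ac)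
  qed
  also have "\<dots> = (\<Prod>i<N. \<rho> i) * (\<Prod>j<N. \<sigma> j) * det (mat N N (\<lambda>(i, j). a i j))"
    unfolding sum_distrib_left[symmetric]
    by (subst det_def'[of _ N]) (auto intro!: sum.cong prod.cong simp: permutes_in_image)
  finally show ?thesis .
qed

lemma mem_span_image_atMost:
  fixes w :: "nat \<Rightarrow> nat \<Rightarrow> 'a::field"
  assumes "x \<in> fun_space.span (w ` {..s})"
  shows "\<exists>c. \<forall>i. x i = (\<Sum>m\<le>s. c m * w m i)"
proof -
  let ?V = "{x. \<exists>c. \<forall>i. x i = (\<Sum>m\<le>s. c m * w m i)}"
  have "fun_space.subspace ?V"
    unfolding fun_subspace_iff
  proof (intro conjI ballI allI)
    show "0 \<in> ?V" by (auto intro!: exI[of _ "\<lambda>_. 0"])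
  next
    fix x y assume "x \<in> ?V" "y \<in> ?V"
    then obtain c d where "\<forall>i. x i = (\<Sum>m\<le>s. c m * w m i)" "\<forall>i. y i = (\<Sum>m\<le>s. d m * w m i)" by blast
    then show "x + y \<in> ?V"
      by (auto intro!: exI[of _ "\<lambda>m. c m + d m"] simp: distrib_right sum.distrib)
  next
    fix a x assume "x \<in> ?V"
    then obtain c where "\<forall>i. x i = (\<Sum>m\<le>s. c m * w m i)" by blast
    then show "(\<lambda>i. a * x i) \<in> ?V"
      by (auto intro!: exI[of _ "\<lambda>m. a * c m"] simp: sum_distrib_left mult.assoc)
  qed
  moreover have "w ` {..s} \<subseteq> ?V"
  proof
    fix x assume "x \<in> w ` {..s}"
    then obtain p where "p \<le> s" "x = w p" by auto
    then have "\<forall>i. x i = (\<Sum>m\<le>s. (if m = p then 1 else 0) * w m i)"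
      by (simp add: if_distrib[of "\<lambda>c. c * _"] cong: if_cong)
    then show "x \<in> ?V" by (intro CollectI exI[of _ "\<lambda>m. if m = p then 1 else 0"])
  qed
  ultimately have "fun_space.span (w ` {..s}) \<subseteq> ?V" by (rule fun_space.span_minimal[rotated])
  then show ?thesis using assms by blast
qed

text \<open>A change of basis multiplies all maximal minors by the same determinant.\<close>

lemma plucker_vectors_proportional:
  assumes "is_plucker_vector n s W p" "is_plucker_vector n s W p'"
    and "J \<in> plucker_index n s" "J' \<in> plucker_index n s"
  shows "p J * p' J' = p' J * p J'"
proof -
  let ?mat = "\<lambda>w J. mat (s + 1) (s + 1) (\<lambda>(i, j). w i (sorted_list_of_set J ! j))"
  obtain w where w: "fun_space.span (w ` {..s}) = W" "\<forall>J \<in> plucker_index n s. p J = det (?mat w J)"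
    using assms(1) unfolding is_plucker_vector_def by blast
  obtain w' where w': "fun_space.span (w' ` {..s}) = W" "\<forall>J \<in> plucker_index n s. p' J = det (?mat w' J)"
    using assms(2) unfolding is_plucker_vector_def by blast
  have "\<exists>c. \<forall>x. w' i x = (\<Sum>m\<le>s. c m * w m x)" if "i \<le> s" for i
    using that w(1) w'(1) by (intro mem_span_image_atMost) (auto intro: fun_space.span_base)
  then obtain c where c: "\<And>i x. i \<le> s \<Longrightarrow> w' i x = (\<Sum>m\<le>s. c i m * w m x)" by metis
  have "?mat w' J = mat (s + 1) (s + 1) (\<lambda>(i, m). c i m) * ?mat w J" for J
    by (rule eq_matI) (auto simp: c scalar_prod_def atLeast0LessThan lessThan_Suc_atMost)
  then have det: "det (?mat w' J) = det (mat (s + 1) (s + 1) (\<lambda>(i, m). c i m)) * det (?mat w J)" for J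
    by (simp only: det_mult[OF mat_carrier mat_carrier])
  define D where "D = det (mat (s + 1) (s + 1) (\<lambda>(i, m). c i m))"
  have "p' X = D * p X" if "X \<in> plucker_index n s" for X
    unfolding w(2)[rule_format, OF that] w'(2)[rule_format, OF that] D_def by (rule det)
  then have "p' J = D * p J" "p' J' = D * p J'" using assms(3,4) by blast+
  then show ?thesis by (simp only: mult_ac)
qed

lemma prod_sorted_list_of_set:
  fixes f :: "nat \<Rightarrow> 'b::comm_monoid_mult"
  assumes "finite J"
  shows "(\<Prod>j<card J. f (sorted_list_of_set J ! j)) = (\<Prod>x\<in>J. f x)"
proof (rule prod.reindex_bij_betw)
  show "bij_betw ((!) (sorted_list_of_set J)) {..<card J} J"
    using bij_betw_nth[of "sorted_list_of_set J" "{..<card J}" J] assms by simp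
qed

lemma span_eq_if_subset_and_card_le:
  assumes "fun_space.subspace V" "V \<subseteq> fun_space.span S" "finite S" "card S \<le> fun_space.dim V"
  shows "V = fun_space.span S"
proof (rule ccontr)
  assume "V \<noteq> fun_space.span S"
  then obtain x where x: "x \<in> fun_space.span S" "x \<notin> V" using assms(2) by auto
  obtain A where A: "A \<subseteq> V" "fun_space.independent A" "V \<subseteq> fun_space.span A" "card A = fun_space.dim V"
    using fun_space.basis_exists by metis
  have "fun_space.span A = V" using A assms(1) fun_space.span_minimal by blast
  then have ind: "fun_space.independent (insert x A)"
    using x A(2) by (intro fun_space.independent_insertI) auto
  have "insert x A \<subseteq> fun_space.span S" using x(1) A(1) assms(2) by auto
  then have "finite (insert x A) \<and> card (insert x A) \<le> card S"
    by (rule fun_space.independent_span_bound[OF assms(3) ind])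
  moreover have "x \<notin> A" using A(1) x(2) by auto
  ultimately show False using A(4) assms(4) by (auto simp: card_insert_if)
qed

section \<open>Plucker coordinates of the osculating planes off the fixed points\<close>

context fermat
begin

text \<open>A homogeneous Vandermonde determinant: the binary monomials of degree \<open>s\<close>
  at the points \<open>(al x, be x)\<close> with \<open>x \<in> J\<close>. These are the constants
  \<open>E\<^sub>J\<close>.\<close>

definition line_minor :: "nat \<Rightarrow> nat set \<Rightarrow> 'a" where
  "line_minor s J = det (mat (s + 1) (s + 1)
     (\<lambda>(i, j). al (sorted_list_of_set J ! j) ^ (s - i) * be (sorted_list_of_set J ! j) ^ i))"

text \<open>A row relation would be a binary form of degree \<open>s\<close> with \<open>s + 1\<close> zeros on the line;
  the zero \<open>i = 1\<close> lies at infinity.\<close>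

lemma line_minor_nonzero:
  assumes J: "J \<in> plucker_index n s"
  shows "line_minor s J \<noteq> 0"
proof
  assume "line_minor s J = 0"
  let ?x = "\<lambda>j. sorted_list_of_set J ! j"
  let ?A = "mat (s + 1) (s + 1) (\<lambda>(i, j). al (?x j) ^ (s - i) * be (?x j) ^ i)"
  have fin: "finite J" and cJ: "card J = s + 1" and sub: "J \<subseteq> {1..n + 1}"
    using J by (auto simp: plucker_index_def intro: finite_subset)
  have "det (transpose_mat ?A) = 0"
    using \<open>line_minor s J = 0\<close> unfolding line_minor_def by (subst det_transpose) auto
  then obtain q where q: "q \<in> carrier_vec (s + 1)" "q \<noteq> 0\<^sub>v (s + 1)"
    and q0: "transpose_mat ?A *\<^sub>v q = 0\<^sub>v (s + 1)"
    using det_0_iff_vec_prod_zero_field[of "transpose_mat ?A" "s + 1"] by auto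
  have rel: "(\<Sum>i\<le>s. vec_index q i * (al x ^ (s - i) * be x ^ i)) = 0" if "x \<in> J" for x
  proof -
    have "x \<in> set (sorted_list_of_set J)" using that fin by simp
    then obtain j where j: "j < s + 1" "x = ?x j"
      using cJ by (metis in_set_conv_nth length_sorted_list_of_set)
    have "0 = vec_index (transpose_mat ?A *\<^sub>v q) j" using q0 j by simp
    also have "\<dots> = (\<Sum>i = 0..<s + 1. al x ^ (s - i) * be x ^ i * vec_index q i)"
      using j q(1) by (simp add: scalar_prod_def)
    also have "{0..<s + 1} = {..s}" by auto
    finally show ?thesis by (simp add: mult.commute)
  qed
  \<comment> \<open>The binary form dehomogenised by \<open>be = 1\<close>. Only \<open>be 1\<close>
    is zero: if \<open>1 \<in> J\<close>, that relation kills the coefficient of degree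
    \<open>s\<close>, while the other \<open>s\<close> roots force the degree to be
    \<open>s\<close>.\<close>
  define p where "p = (\<Sum>i\<le>s. monom (vec_index q i) (s - i))"
  have coeff: "coeff p (s - i) = vec_index q i" if "i \<le> s" for i
  proof -
    have "coeff p (s - i) = (\<Sum>m\<le>s. if m = i then vec_index q m else 0)"
      unfolding p_def coeff_sum by (rule sum.cong) (use that in auto)
    then show ?thesis using that by simp
  qed
  have "p \<noteq> 0"
  proof
    assume "p = 0"
    then have "vec_index q i = 0" if "i \<le> s" for i using coeff[OF that] by simp
    then have "q = 0\<^sub>v (s + 1)" using q(1) by (intro eq_vecI) auto
    then show False using q(2) by simp
  qed
  have deg: "degree p \<le> s"
    unfolding p_def by (intro degree_sum_le) (auto intro: order_trans[OF degree_monom_le])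
  have be0: "be x \<noteq> 0" if "x \<noteq> 1" for x using that by (simp add: be_def)
  have root: "poly p (al x / be x) = 0" if "x \<in> J - {1}" for x
  proof -
    have "poly p (al x / be x) * be x ^ s = (\<Sum>i\<le>s. vec_index q i * (al x ^ (s - i) * be x ^ i))"
      unfolding p_def poly_sum poly_monom sum_distrib_right
    proof (rule sum.cong[OF refl])
      fix i assume "i \<in> {..s}"
      then have "be x ^ s = be x ^ (s - i) * be x ^ i" by (simp flip: power_add)
      then show "vec_index q i * (al x / be x) ^ (s - i) * be x ^ s =
          vec_index q i * (al x ^ (s - i) * be x ^ i)"
        using be0 that by (simp add: power_divide)
    qed
    then show ?thesis using rel[of x] that be0[of x] by simp
  qed
  have "inj_on (\<lambda>x. al x / be x) (J - {1})"
  proof (rule inj_onI)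
    fix x y assume xy: "x \<in> J - {1}" "y \<in> J - {1}" "al x / be x = al y / be y"
    then have "minor x y = 0" using be0[of x] be0[of y] by (simp add: minor_def frac_eq_eq)
    then show "x = y" using minor_nonzero[of x y] xy sub by blast
  qed
  then have "card (J - {1}) = card ((\<lambda>x. al x / be x) ` (J - {1}))" by (simp add: card_image)
  also have "\<dots> \<le> card {z. poly p z = 0}"
    using root \<open>p \<noteq> 0\<close> by (intro card_mono poly_roots_finite) auto
  also have "\<dots> \<le> degree p" using \<open>p \<noteq> 0\<close> by (rule card_poly_roots_bound)
  finally have le: "card (J - {1}) \<le> degree p" .
  show False
  proof (cases "1 \<in> J")
    case False
    then show False using le deg cJ by simp
  next
    case True
    then have "degree p = s" using le deg cJ fin by simp
    moreover have "vec_index q 0 = 0"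
    proof -
      have "(\<Sum>i\<le>s. vec_index q i * (al 1 ^ (s - i) * be 1 ^ i)) = (\<Sum>i\<le>s. if i = 0 then vec_index q i else 0)"
        by (rule sum.cong) (auto simp: al_def be_def power_0_left)
      then show ?thesis using rel[OF True] by simp
    qed
    ultimately show False using coeff[of 0] \<open>p \<noteq> 0\<close> by (metis diff_zero le0 leading_coeff_neq_0)
  qed
qed

text \<open>The column of index \<open>x\<close> carries the factor
  \<open>v x / (v x ^ k) ^ s\<close>, which is the inverse of \<open>v x ^ (s * k - 1)\<close>.
  Multiplying by this power of all coordinates cancels the columns in \<open>J\<close> and leaves
  the coordinates outside \<open>J\<close>.\<close>

definition assoc_exp :: "nat \<Rightarrow> nat" where "assoc_exp s = s * k - 1"

definition assoc_form :: "nat \<Rightarrow> nat set \<Rightarrow> 'a mpoly" where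
  "assoc_form s J = mconst (line_minor s J) * (\<Prod>i\<in>{1..n + 1} - J. mvar i ^ assoc_exp s)"

lemma assoc_form_forms:
  assumes "J \<in> plucker_index n s"
  shows "assoc_form s J \<in> forms n ((n - s) * assoc_exp s)"
proof -
  have "card ({1..n + 1} - J) = n - s"
    using assms by (subst card_Diff_subset) (auto simp: plucker_index_def intro: finite_subset)
  moreover have "(\<Prod>i\<in>{1..n + 1} - J. mvar i ^ assoc_exp s :: 'a mpoly) \<in>
      forms n (\<Sum>i\<in>{1..n + 1} - J. 1 * assoc_exp s)"
    by (intro forms_prod forms_power mvar_forms) auto
  ultimately show ?thesis unfolding assoc_form_def by (intro forms_scale) simp
qed

lemma poly_at_assoc_form:
  "poly_at (assoc_form s J) v = line_minor s J * (\<Prod>i\<in>{1..n + 1} - J. v i ^ assoc_exp s)"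
  by (simp add: assoc_form_def poly_at_simps(6,7,9) del: sum.cl_ivl_Suc)

text \<open>At a point without zero coordinates the osculating plane is spanned by the vectors with entries
  \<open>v\<^sub>x u\<^sub>x\<^sup>-\<^sup>s al\<^sub>x\<^sup>s\<^sup>-\<^sup>i be\<^sub>x\<^sup>i\<close>, where \<open>u\<^sub>x = v\<^sub>x\<^sup>k\<close>: expand \<open>u\<^sub>x = al\<^sub>x u\<^sub>1 + be\<^sub>x u\<^sub>2\<close> binomially
  in \<open>v\<^sub>x u\<^sub>x\<^sup>-\<^sup>m be\<^sub>x\<^sup>m\<close>.\<close>

lemma plucker_generic:
  assumes v: "v \<noteq> 0" "v \<in> coord_space n" "on_line (\<lambda>i. v i ^ k)" and nz: "\<forall>i\<in>{1..n + 1}. v i \<noteq> 0"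
    and s: "0 < s" "s < n"
  shows "is_plucker_vector n s (osculating_plane n curve s (fun_space.span {v}))
    (\<lambda>J. poly_at (assoc_form s J) v)"
proof -
  interpret fermat_branch k n l v be 1 using generic_branch[OF v nz] .
  define \<kappa> where "\<kappa> = (\<Prod>x\<in>{1..n + 1}. v x ^ assoc_exp s)"
  \<comment> \<open>The factor \<open>\<kappa>\<close> that clears denominators is loaded onto row 0
    alone, so that it enters the determinant exactly once.\<close>
  define \<rho> where "\<rho> i = (if i = 0 then \<kappa> else 1)" for i :: nat
  define \<sigma> where "\<sigma> x = v x / (v x ^ k) ^ s" for x
  define w where "w i x = (if x \<in> {1..n + 1} then \<rho> i * \<sigma> x * (al x ^ (s - i) * be x ^ i) else 0)" for i x
  have \<kappa>: "\<kappa> \<noteq> 0" unfolding \<kappa>_def using nz by auto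
  then have \<rho>: "\<rho> i \<noteq> 0" for i by (simp add: \<rho>_def)
  have osc: "osculating_plane n curve s P = fun_space.span (jet ` {..s})"
    using nz s(2) by (rule generic_flag)
  have jet_mem: "jet m \<in> fun_space.span (w ` {..s})" if m: "m \<le> s" for m
  proof -
    define c where "c p = fps_nth (root_series k) m * of_nat ((s - m) choose p) * (v 1 ^ k) ^ p *
      (v 2 ^ k) ^ (s - m - p) / \<rho> (s - p)" for p
    have "jet m = (\<Sum>p\<le>s - m. (\<lambda>x. c p * w (s - p) x))"
    proof
      fix x
      show "jet m x = (\<Sum>p\<le>s - m. (\<lambda>x. c p * w (s - p) x)) x"
      proof (cases "x \<in> {1..n + 1}")
        case False
        then have "jet m x = 0" using jet_coord[of m] unfolding coord_space_def by blast
        moreover have "w i x = 0" for i using False by (simp only: w_def if_False)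
        ultimately show ?thesis by (simp add: fun_sum_apply)
      next
        case True
        let ?u = "v x ^ k"
        have u: "?u = al x * v 1 ^ k + be x * v 2 ^ k" using v(3) True unfolding on_line_def by blast
        have u0: "?u \<noteq> 0" using nz True by simp
        have "jet m x = v x * fps_nth (root_series k) m * (be x / ?u) ^ m"
          using jet_generic[OF nz True] by (simp add: slope_def)
        also have "\<dots> = fps_nth (root_series k) m * \<sigma> x * be x ^ m * ?u ^ (s - m)"
        proof -
          have "?u ^ s = ?u ^ m * ?u ^ (s - m)" using m by (simp flip: power_add)
          then show ?thesis using u0 by (simp add: \<sigma>_def power_divide divide_simps)
        qed
        also have "?u ^ (s - m) = (\<Sum>p\<le>s - m. of_nat ((s - m) choose p) * (al x * v 1 ^ k) ^ p *
            (be x * v 2 ^ k) ^ (s - m - p))"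
          unfolding u by (rule binomial_ring)
        also have "fps_nth (root_series k) m * \<sigma> x * be x ^ m * \<dots> = (\<Sum>p\<le>s - m. c p * w (s - p) x)"
          unfolding sum_distrib_left
        proof (rule sum.cong[OF refl])
          fix p assume p: "p \<in> {..s - m}"
          have "be x ^ (s - p) = be x ^ m * be x ^ (s - m - p)" "s - (s - p) = p"
            using p m by (auto simp flip: power_add)
          then show "fps_nth (root_series k) m * \<sigma> x * be x ^ m * (of_nat ((s - m) choose p) *
              (al x * v 1 ^ k) ^ p * (be x * v 2 ^ k) ^ (s - m - p)) = c p * w (s - p) x"
            using True \<rho>[of "s - p"]
            by (simp add: c_def w_def power_mult_distrib mult_ac del: atLeastAtMost_iff)
        qed
        finally show ?thesis by (simp add: fun_sum_apply)
      qed
    qed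
    also have "\<dots> \<in> fun_space.span (w ` {..s})"
      by (intro fun_space.span_sum fun_space.span_scale fun_space.span_base) auto
    finally show ?thesis .
  qed
  have plane: "fun_space.span (jet ` {..s}) \<in> planes n s"
    using flag_planes[OF span_jet_generic[OF nz]] s(2) by simp
  then have "fun_space.dim (fun_space.span (jet ` {..s})) = s + 1" by (simp add: planes_def)
  then have "fun_space.span (jet ` {..s}) = fun_space.span (w ` {..s})"
    using jet_mem card_image_le[of "{..s}" w]
    by (intro span_eq_if_subset_and_card_le fun_space.span_minimal fun_space.subspace_span) auto
  then have span_w: "fun_space.span (w ` {..s}) = osculating_plane n curve s P" by (simp add: osc)
  have "poly_at (assoc_form s J) v = det (mat (s + 1) (s + 1) (\<lambda>(i, j). w i (sorted_list_of_set J ! j)))"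
    if J: "J \<in> plucker_index n s" for J
  proof -
    let ?x = "\<lambda>j. sorted_list_of_set J ! j"
    have fin: "finite J" and cJ: "card J = s + 1" and sub: "J \<subseteq> {1..n + 1}"
      using J by (auto simp: plucker_index_def intro: finite_subset)
    have x_mem: "?x j \<in> {1..n + 1}" if "j < s + 1" for j
      using that nth_mem[of j "sorted_list_of_set J"] fin cJ sub by auto
    have "mat (s + 1) (s + 1) (\<lambda>(i, j). w i (?x j)) =
        mat (s + 1) (s + 1) (\<lambda>(i, j). \<rho> i * \<sigma> (?x j) * (al (?x j) ^ (s - i) * be (?x j) ^ i))"
      by (rule eq_matI) (use x_mem in \<open>auto simp: w_def\<close>)
    then have "det (mat (s + 1) (s + 1) (\<lambda>(i, j). w i (?x j))) =
        (\<Prod>i<s + 1. \<rho> i) * (\<Prod>j<s + 1. \<sigma> (?x j)) * line_minor s J"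
      unfolding line_minor_def using det_mat_scale[of "s + 1" \<rho> "\<lambda>j. \<sigma> (?x j)"] by simp
    also have "(\<Prod>i<s + 1. \<rho> i) = \<kappa>"
      unfolding prod.remove[of "{..<s + 1}" 0, simplified] by (simp add: \<rho>_def)
    also have "(\<Prod>j<s + 1. \<sigma> (?x j)) = (\<Prod>x\<in>J. \<sigma> x)"
      using prod_sorted_list_of_set[OF fin, of \<sigma>] cJ by simp
    also have "\<kappa> = (\<Prod>x\<in>{1..n + 1} - J. v x ^ assoc_exp s) * (\<Prod>x\<in>J. v x ^ assoc_exp s)"
      unfolding \<kappa>_def using sub by (intro prod.subset_diff) auto
    also have "(\<Prod>x\<in>{1..n + 1} - J. v x ^ assoc_exp s) * (\<Prod>x\<in>J. v x ^ assoc_exp s) * (\<Prod>x\<in>J. \<sigma> x) =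
        (\<Prod>x\<in>{1..n + 1} - J. v x ^ assoc_exp s) * (\<Prod>x\<in>J. v x ^ assoc_exp s * \<sigma> x)"
      by (simp add: prod.distrib mult_ac del: atLeastAtMost_iff)
    also have "(\<Prod>x\<in>J. v x ^ assoc_exp s * \<sigma> x) = 1"
    proof (rule prod.neutral, rule ballI)
      fix x assume "x \<in> J"
      then have "v x \<noteq> 0" using nz sub by blast
      have "s * k = Suc (assoc_exp s)" using s(1) k2 by (cases "s * k") (auto simp: assoc_exp_def)
      then have "(v x ^ k) ^ s = v x ^ assoc_exp s * v x"
        by (metis mult.commute power_Suc power_mult)
      then show "v x ^ assoc_exp s * \<sigma> x = 1" using \<open>v x \<noteq> 0\<close> by (simp add: \<sigma>_def)
    qed
    finally show ?thesis by (simp add: poly_at_assoc_form)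
  qed
  then show ?thesis
    unfolding is_plucker_vector_def using plane span_w osc by (intro conjI exI[of _ w]) auto
qed

text \<open>Points where the formula could fail have a zero coordinate by
  \<open>plucker_generic\<close>, so they are among the finitely many fixed points.\<close>

lemma represents_assoc_form:
  assumes "0 < s" "s < n" and "J \<in> plucker_index n s" "\<not> vanishes_on (assoc_form s J) P"
  shows "represents_associated_curve n curve s P (assoc_form s)"
proof -
  have "{Q \<in> curve. \<not> (\<forall>v \<in> Q - {0}. is_plucker_vector n s (osculating_plane n curve s Q)
      (\<lambda>J. poly_at (assoc_form s J) v))} \<subseteq> H0_fixed_points k n l"
  proof
    fix Q assume Q': "Q \<in> {Q \<in> curve. \<not> (\<forall>v \<in> Q - {0}. is_plucker_vector n s (osculating_plane n curve s Q)
      (\<lambda>J. poly_at (assoc_form s J) v))}"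
    then have Q: "Q \<in> curve" by simp
    obtain x where x: "x \<in> Q" "x \<noteq> 0"
      "\<not> is_plucker_vector n s (osculating_plane n curve s Q) (\<lambda>J. poly_at (assoc_form s J) x)"
      using Q' by blast
    obtain v where v: "v \<noteq> 0" "v \<in> coord_space n" "Q = fun_space.span {v}" "on_line (\<lambda>i. v i ^ k)"
      using Q by (rule curveE)
    obtain c where c: "x = (\<lambda>i. c * v i)" using x(1) v(3) by (auto simp: span_singleton_eq)
    have c0: "c \<noteq> 0" using c x(2) by (auto simp: fun_eq_iff)
    have "fun_space.span ((\<lambda>y i. c * y i) ` {v}) = fun_space.span {v}"
      by (rule fun_space.span_image_scale) (use c0 in auto)
    then have Qx: "Q = fun_space.span {x}" by (simp add: c v(3))
    have xc: "x \<in> coord_space n" using v(2) by (auto simp: c coord_space_def)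
    have xl: "on_line (\<lambda>i. x i ^ k)" using curve_span_iff[OF x(2) xc] Q Qx by simp
    have "\<exists>j\<in>{1..n + 1}. x j = 0"
      using plucker_generic[OF x(2) xc xl _ assms(1,2)] x(3) Qx by auto
    then show "Q \<in> H0_fixed_points k n l" using in_H0_fixed_points_iff[OF x(2) xc xl] Qx by simp
  qed
  then show ?thesis
    unfolding represents_associated_curve_def
    using assms(3,4) assoc_form_forms finite_H0_fixed_points finite_subset by blast
qed

end

section \<open>Ramification of the associated curves\<close>

context fermat_branch
begin

lemma span_jets: "fun_space.span (range jet) = coord_space n"
proof
  show "fun_space.span (range jet) \<subseteq> coord_space n"
    using jet_coord by (intro fun_space.span_minimal subspace_coord_space) auto
  show "coord_space n \<subseteq> fun_space.span (range jet)"
  proof (cases "\<exists>j\<in>{1..n + 1}. v j = 0")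
    case True
    then obtain j where "j \<in> {1..n + 1}" "v j = 0" by blast
    then show ?thesis
      using span_jet_fixed fun_space.span_mono[of "(\<lambda>i. jet (fixed_order i)) ` {..n}" "range jet"] by blast
  next
    case False
    then show ?thesis
      using span_jet_generic fun_space.span_mono[of "jet ` {..n}" "range jet"] by blast
  qed
qed

text \<open>A point is a proper subspace, so some form vanishes on it without vanishing on
  \<open>coord_space n\<close>. As the jets span, such a form survives along the branch.\<close>

lemma linear_form_through_point:
  assumes "Q \<in> curve"
  obtains L where "L \<in> forms n 1" "vanishes_on L Q" "pullback L branch \<noteq> 0"
proof -
  have Q: "Q \<subseteq> coord_space n" "fun_space.subspace Q" "fun_space.dim Q = 1"
    using assms by (auto simp: fermat_curve_def points_def planes_def)
  then have "Q \<noteq> coord_space n" using dim_coord_space[of n, where ?'a = 'a] n2 by auto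
  then obtain x where x: "x \<in> coord_space n" "x \<notin> Q" using Q(1) by blast
  obtain a where a: "\<And>y. y \<in> Q \<Longrightarrow> dot n a y = 0" "dot n a x \<noteq> 0"
    using separating_functional[OF Q(2,1) x] by blast
  let ?L = "linear_form n a"
  have "pullback ?L branch \<noteq> 0"
  proof
    assume "pullback ?L branch = 0"
    then have "dot n a (jet m) = 0" for m
      using pullback_nth_linear[OF linear_form_forms, of a m] by (simp add: poly_at_linear_form_dot)
    then have "dot n a x = 0" using dot_span_0[of x "range jet" n a] x(1) span_jets by auto
    with a(2) show False by simp
  qed
  moreover have "vanishes_on ?L Q" using a(1) by (simp add: vanishes_on_def poly_at_linear_form_dot)
  ultimately show ?thesis using that linear_form_forms by blast
qed

text \<open>Multiplied by one linear form through each exceptional point, \<open>B\<close> falls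
  into the ideal of the curve. The factors have nonzero pullbacks, and power series form a
  domain.\<close>

lemma pullback_eq_0_cofinite:
  assumes B: "B \<in> polys n" and S: "finite S" "S \<subseteq> curve"
    and zero: "\<And>Q x. Q \<in> curve \<Longrightarrow> Q \<notin> S \<Longrightarrow> x \<in> Q \<Longrightarrow> x \<noteq> 0 \<Longrightarrow> poly_at B x = 0"
  shows "pullback B branch = 0"
proof -
  have "\<forall>Q\<in>S. \<exists>L. L \<in> forms n 1 \<and> vanishes_on L Q \<and> pullback L branch \<noteq> 0"
    using S(2) linear_form_through_point by (metis subsetD)
  then obtain f where f: "\<And>Q. Q \<in> S \<Longrightarrow> f Q \<in> forms n 1 \<and> vanishes_on (f Q) Q \<and> pullback (f Q) branch \<noteq> 0"
    by metis
  \<comment> \<open>The factor \<open>mvar base\<close> takes care of the zero vector: it lies in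
    every point, and \<open>B\<close> with a constant term is nonzero there.\<close>
  define M where "M = mvar base * (\<Prod>Q\<in>S. f Q)"
  have "(\<Prod>Q\<in>S. f Q) \<in> forms n (\<Sum>Q\<in>S. 1)" using S(1) f by (intro forms_prod) auto
  then have M: "M \<in> polys n"
    unfolding M_def using base(1) by (intro polys_mult formsD[OF mvar_forms]) (auto dest: formsD)
  have "poly_at (M * B) x = 0" if Q: "Q \<in> curve" "x \<in> Q" for Q x
  proof (cases "x = 0 \<or> Q \<notin> S")
    case True
    then show ?thesis
      using zero[OF Q(1) _ Q(2)] by (cases "x = 0") (auto simp: M_def poly_at_simps(6))
  next
    case False
    then have "(\<Prod>Q\<in>S. poly_at (f Q) x) = 0"
      using S(1) f Q(2) by (intro prod_zero) (auto simp: vanishes_on_def)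
    then show ?thesis by (simp add: M_def poly_at_simps(6,7))
  qed
  then have "M * B \<in> vanishing_ideal n curve"
    using M B by (auto simp: vanishing_ideal_def vanishes_on_def polys_mult)
  then have "pullback M branch * pullback B branch = 0"
    using pullback_vanishing_ideal by (simp add: pullback_simps(6)[symmetric])
  moreover have "pullback M branch \<noteq> 0"
  proof -
    have "branch base \<noteq> 0" using branch_nth_0[of base] base(3) by auto
    then show ?thesis using f S(1) by (simp add: M_def pullback_simps(6,7))
  qed
  ultimately show ?thesis by simp
qed

text \<open>Off two finite sets both families are Plucker vectors of the same plane, so the
  \<open>2 x 2\<close> determinants vanish there and hence along the branch.\<close>

lemma representations_proportional:
  assumes "represents_associated_curve n curve s P1 G" "represents_associated_curve n curve s P2 G'"
    and J: "J \<in> plucker_index n s" "J' \<in> plucker_index n s"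
  shows "pullback (G J) branch * pullback (G' J') branch = pullback (G' J) branch * pullback (G J') branch"
proof -
  let ?bad = "\<lambda>G. {Q \<in> curve. \<not> (\<forall>x \<in> Q - {0}. is_plucker_vector n s (osculating_plane n curve s Q)
    (\<lambda>J. poly_at (G J) x))}"
  obtain d d' where d: "\<forall>J \<in> plucker_index n s. G J \<in> forms n d" "\<forall>J \<in> plucker_index n s. G' J \<in> forms n d'"
    using assms(1,2) unfolding represents_associated_curve_def by blast
  have fin: "finite (?bad G \<union> ?bad G')"
    using assms(1,2) unfolding represents_associated_curve_def by blast
  let ?B = "G J * G' J' - G' J * G J'"
  have "G J * G' J' \<in> forms n (d + d')" using d J by (intro forms_mult) auto
  moreover have "G' J * G J' \<in> forms n (d' + d)" using d J by (intro forms_mult) auto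
  ultimately have B: "?B \<in> polys n" by (intro formsD[OF forms_diff]) (auto simp: add.commute)
  have "pullback ?B branch = 0"
  proof (rule pullback_eq_0_cofinite[OF B fin])
    fix Q x assume Q: "Q \<in> curve" "Q \<notin> ?bad G \<union> ?bad G'" "x \<in> Q" "x \<noteq> 0"
    then have "is_plucker_vector n s (osculating_plane n curve s Q) (\<lambda>J. poly_at (G J) x)"
      "is_plucker_vector n s (osculating_plane n curve s Q) (\<lambda>J. poly_at (G' J) x)"
      by blast+
    from plucker_vectors_proportional[OF this J] show "poly_at ?B x = 0"
      by (simp add: poly_at_simps(5,6))
  qed auto
  then show ?thesis by (simp add: pullback_simps(5,6))
qed

lemma forms_combination:
  assumes "\<forall>J \<in> plucker_index n s. G J \<in> forms n d"
  shows "(\<Sum>J \<in> plucker_index n s. mconst (c J) * G J) \<in> forms n d"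
  using assms by (intro forms_sum forms_scale) auto

lemma pullback_combination:
  "pullback (\<Sum>J \<in> A. mconst (c J) * G J) branch = (\<Sum>J \<in> A. fps_const (c J) * pullback (G J) branch)"
  by (simp add: pullback_simps(6,8))

text \<open>Along the branch \<open>G'\<close> is \<open>G\<close> times the series
  \<open>\<mu>\<close>. Each family has a member that is nonzero at \<open>P\<close>, which makes
  \<open>\<mu>\<close> invertible, so orders of linear combinations can be computed with
  \<open>G\<close>.\<close>

lemma pullback_order_eq:
  assumes rep: "represents_associated_curve n curve s P G" "represents_associated_curve n curve s P G'"
    and lower: "\<And>c i. fps_nth (\<Sum>J\<in>plucker_index n s. fps_const (c J) * pullback (G J) branch) 0 = 0 \<Longrightarrow>
      i < N \<Longrightarrow> fps_nth (\<Sum>J\<in>plucker_index n s. fps_const (c J) * pullback (G J) branch) i = 0"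
    and upper: "fps_nth (\<Sum>J\<in>plucker_index n s. fps_const (c0 J) * pullback (G J) branch) 0 = 0"
      "fps_nth (\<Sum>J\<in>plucker_index n s. fps_const (c0 J) * pullback (G J) branch) N \<noteq> 0"
  shows "pullback_order n curve P (plucker_index n s) G' = enat N"
proof -
  let ?A = "plucker_index n s"
  let ?p = "\<lambda>J. pullback (G J) branch" and ?p' = "\<lambda>J. pullback (G' J) branch"
  let ?S = "\<lambda>c. \<Sum>J\<in>?A. fps_const (c J) * ?p J" and ?S' = "\<lambda>c. \<Sum>J\<in>?A. fps_const (c J) * ?p' J"
  obtain d where d: "\<forall>J \<in> ?A. G J \<in> forms n d" using rep(1) unfolding represents_associated_curve_def by blast
  obtain d' where d': "\<forall>J \<in> ?A. G' J \<in> forms n d'" using rep(2) unfolding represents_associated_curve_def by blast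
  obtain J0 where J0: "J0 \<in> ?A" "\<not> vanishes_on (G J0) P" using rep(1) unfolding represents_associated_curve_def by blast
  obtain J1 where J1: "J1 \<in> ?A" "\<not> vanishes_on (G' J1) P" using rep(2) unfolding represents_associated_curve_def by blast
  have p0: "fps_nth (?p J0) 0 \<noteq> 0"
    using J0 d vanishes_on_P_iff by (auto simp: pullback_0_at)
  have p1: "fps_nth (?p' J1) 0 \<noteq> 0"
    using J1 d' vanishes_on_P_iff by (auto simp: pullback_0_at)
  have swap: "?p J * ?p' J' = ?p' J * ?p J'" if "J \<in> ?A" "J' \<in> ?A" for J J'
    using representations_proportional[OF rep that] .
  define \<mu> where "\<mu> = ?p' J0 * inverse (?p J0)"
  have p': "?p' J = \<mu> * ?p J" if "J \<in> ?A" for J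
  proof -
    have "\<mu> * ?p J = inverse (?p J0) * (?p J * ?p' J0)" by (simp add: \<mu>_def mult_ac)
    also have "\<dots> = inverse (?p J0) * ?p J0 * ?p' J" using swap[OF that J0(1)] by (simp add: mult_ac)
    also have "inverse (?p J0) * ?p J0 = 1" using p0 by (rule inverse_mult_eq_1)
    finally show ?thesis by simp
  qed
  have \<mu>0: "fps_nth \<mu> 0 \<noteq> 0"
  proof -
    have "fps_nth (?p J0) 0 * fps_nth (?p' J1) 0 = fps_nth (?p' J0) 0 * fps_nth (?p J1) 0"
      using arg_cong[OF swap[OF J0(1) J1(1)], of "\<lambda>f. fps_nth f 0"] by simp
    then have "fps_nth (?p' J0) 0 \<noteq> 0" using p0 p1 by auto
    then show ?thesis using p0 by (simp add: \<mu>_def)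
  qed
  have S': "?S' c = \<mu> * ?S c" for c
    by (simp add: p' sum_distrib_left mult_ac)
  have S'0: "fps_nth (?S' c) 0 = 0 \<longleftrightarrow> fps_nth (?S c) 0 = 0" for c
    unfolding S' using \<mu>0 by simp
  let ?F = "\<lambda>c. \<Sum>J\<in>?A. mconst (c J) * G' J"
  have F: "?F c \<in> forms n d'" for c using d' by (rule forms_combination)
  have van: "vanishes_on (?F c) P \<longleftrightarrow> fps_nth (?S c) 0 = 0" for c
    unfolding vanishes_on_P_iff[OF F] pullback_0_at[symmetric] pullback_combination by (rule S'0)
  show ?thesis
  proof (rule antisym)
    have "fps_nth (?S' c0) N = fps_nth \<mu> 0 * fps_nth (?S c0) N"
    proof -
      have "fps_nth (?S' c0) N = (\<Sum>i=0..N. fps_nth \<mu> i * fps_nth (?S c0) (N - i))"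
        unfolding S' by (rule fps_mult_nth)
      also have "\<dots> = (\<Sum>i\<in>{0}. fps_nth \<mu> i * fps_nth (?S c0) (N - i))"
        by (rule sum.mono_neutral_right) (use lower[OF upper(1)] in auto)
      finally show ?thesis by simp
    qed
    then have "vanishing_order n curve P (?F c0) \<le> enat N"
      using upper(2) \<mu>0 by (intro vanishing_order_le[OF F]) (simp add: pullback_combination)
    moreover have "pullback_order n curve P ?A G' \<le> vanishing_order n curve P (?F c0)"
      unfolding pullback_order_def using van[of c0] upper(1) by (intro Inf_lower) blast
    ultimately show "pullback_order n curve P ?A G' \<le> enat N" by order
    show "enat N \<le> pullback_order n curve P ?A G'"
      unfolding pullback_order_def
    proof (rule Inf_greatest, clarify)
      fix c assume "vanishes_on (?F c) P"
      then have "fps_nth (?S c) 0 = 0" using van by blast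
      then have low: "fps_nth (?S c) i = 0" if "i < N" for i using lower that by blast
      show "enat N \<le> vanishing_order n curve P (?F c)"
        by (intro vanishing_order_ge[OF F]) (simp only: pullback_combination S' fps_mult_nth_eq_0[OF low])
    qed
  qed
qed

section \<open>Power series in \<open>t ^ k\<close>\<close>

definition sparse :: "'a fps \<Rightarrow> bool" where
  "sparse f \<longleftrightarrow> (\<forall>m. \<not> k dvd m \<longrightarrow> fps_nth f m = 0)"

lemma sparse_const: "sparse (fps_const c)"
  by (auto simp: sparse_def)

lemma sparse_mult: "sparse f \<Longrightarrow> sparse g \<Longrightarrow> sparse (f * g)"
  unfolding sparse_def fps_mult_nth
proof (intro allI impI sum.neutral ballI)
  fix m i assume *: "\<forall>m. \<not> k dvd m \<longrightarrow> fps_nth f m = 0" "\<forall>m. \<not> k dvd m \<longrightarrow> fps_nth g m = 0"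
    "\<not> k dvd m" "i \<in> {0..m}"
  then have "\<not> k dvd i \<or> \<not> k dvd (m - i)" by (metis atLeastAtMost_iff dvd_diffD)
  then show "fps_nth f i * fps_nth g (m - i) = 0" using * by auto
qed

lemma sparse_power: "sparse f \<Longrightarrow> sparse (f ^ e)"
  by (induction e) (auto simp: sparse_mult sparse_const[of 1, simplified])

lemma sparse_prod: "(\<And>x. x \<in> A \<Longrightarrow> sparse (f x)) \<Longrightarrow> sparse (prod f A)"
  by (induction A rule: infinite_finite_induct) (auto simp: sparse_mult sparse_const[of 1, simplified])

lemma sparse_nth:
  assumes "sparse f" "0 < i" "i < k"
  shows "fps_nth f i = 0"
proof -
  have "\<not> k dvd i" using assms(2,3) by (auto dest: dvd_imp_le)
  then show ?thesis using assms(1) by (simp add: sparse_def)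
qed

text \<open>On series in \<open>X ^ k\<close> the coefficient at \<open>k\<close> obeys the product
  rule of a derivative, since those strictly between 0 and \<open>k\<close> vanish.\<close>

lemma sparse_mult_nth_k:
  assumes "sparse f" "sparse g"
  shows "fps_nth (f * g) k = fps_nth f 0 * fps_nth g k + fps_nth f k * fps_nth g 0"
proof -
  have "fps_nth (f * g) k = (\<Sum>i\<in>{0, k}. fps_nth f i * fps_nth g (k - i))"
    unfolding fps_mult_nth
    by (rule sum.mono_neutral_right) (use sparse_nth[OF assms(1)] in auto)
  then show ?thesis using k2 by simp
qed

lemma sparse_power_nth_k:
  assumes "sparse f"
  shows "fps_nth (f ^ e) k = of_nat e * fps_nth f 0 ^ (e - 1) * fps_nth f k"
proof (induction e)
  case (Suc e)
  have "fps_nth (f ^ Suc e) k = fps_nth f 0 * fps_nth (f ^ e) k + fps_nth f k * fps_nth f 0 ^ e"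
    using sparse_mult_nth_k[OF assms sparse_power[OF assms]] by (simp add: fps_nth_power_0)
  with Suc show ?case by (cases e) (simp_all add: algebra_simps)
qed (use k2 in simp)

section \<open>The associated curves at a fixed point\<close>

context
  fixes j s assumes j: "j \<in> {1..n + 1}" "v j = 0" and s: "0 < s" "s < n"
begin

lemma nonzero_coord: "i \<in> {1..n + 1} \<Longrightarrow> i \<noteq> j \<Longrightarrow> v i \<noteq> 0"
  using zero_unique j by blast

lemma branch_sparse: "i \<in> {1..n + 1} \<Longrightarrow> i \<noteq> j \<Longrightarrow> sparse (branch i)"
  using jet_fixed[OF j, of _ i] by (auto simp: sparse_def jet_def)

lemma branch_j: "branch j = fps_X"
  using j by (simp add: branch_def)

lemma branch_nth_k:
  assumes "i \<in> {1..n + 1}" "i \<noteq> j"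
  shows "fps_nth (branch i) k = v i * fps_nth (root_series k) 1 * slope i"
  using jet_fixed[OF j, of k i] assms k2 by (simp add: jet_def)

lemma exp_pos: "assoc_exp s = s * k - 1" "0 < assoc_exp s" "s = 1 \<Longrightarrow> assoc_exp s = k - 1"
  "s \<noteq> 1 \<Longrightarrow> k < assoc_exp s" "of_nat (assoc_exp s) \<noteq> (0::'a)"
proof -
  show "assoc_exp s = s * k - 1" by (simp add: assoc_exp_def)
  have "1 * 2 \<le> s * k" using s k2 by (intro mult_le_mono) auto
  then show "0 < assoc_exp s" by (simp add: assoc_exp_def)
  show "s = 1 \<Longrightarrow> assoc_exp s = k - 1" by (simp add: assoc_exp_def)
  show "k < assoc_exp s" if "s \<noteq> 1"
  proof -
    have "2 * k \<le> s * k" using s that by (intro mult_le_mono) auto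
    then have "k + 2 \<le> s * k" using k2 by linarith
    then show ?thesis by (simp add: assoc_exp_def)
  qed
  show "of_nat (assoc_exp s) \<noteq> (0::'a)"
    using mult_k_minus_1_nonzero[of s] s by (simp add: assoc_exp_def)
qed

lemma pullback_assoc_form:
  "pullback (assoc_form s J) branch =
    fps_const (line_minor s J) * (\<Prod>i\<in>{1..n + 1} - J. branch i ^ assoc_exp s)"
  by (simp add: assoc_form_def pullback_simps(6,7,9) del: sum.cl_ivl_Suc)

lemma pullback_assoc_form_sparse:
  "j \<in> J \<Longrightarrow> sparse (pullback (assoc_form s J) branch)"
  unfolding pullback_assoc_form
  by (intro sparse_mult sparse_const sparse_prod sparse_power branch_sparse) auto

lemma pullback_assoc_form_X:
  assumes "j \<notin> J"
  shows "pullback (assoc_form s J) branch = fps_X ^ assoc_exp s *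
    (fps_const (line_minor s J) * (\<Prod>i\<in>{1..n + 1} - J - {j}. branch i ^ assoc_exp s))"
proof -
  have "(\<Prod>i\<in>{1..n + 1} - J. branch i ^ assoc_exp s) =
      branch j ^ assoc_exp s * (\<Prod>i\<in>{1..n + 1} - J - {j}. branch i ^ assoc_exp s)"
    using assms j(1) by (intro prod.remove) auto
  then show ?thesis by (simp add: pullback_assoc_form branch_j mult_ac)
qed

lemma pullback_assoc_form_nth:
  assumes "0 < i" "i < k" "i < assoc_exp s"
  shows "fps_nth (pullback (assoc_form s J) branch) i = 0"
proof (cases "j \<in> J")
  case True
  then show ?thesis using sparse_nth[OF pullback_assoc_form_sparse assms(1,2)] by blast
next
  case False
  then show ?thesis using assms(3) by (simp add: pullback_assoc_form_X fps_X_power_mult_nth)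
qed

lemma assoc_form_nonzero:
  assumes "J \<in> plucker_index n s" "j \<in> J"
  shows "poly_at (assoc_form s J) v \<noteq> 0"
proof -
  have "(\<Prod>i\<in>{1..n + 1} - J. v i ^ assoc_exp s) \<noteq> 0"
  proof (subst prod_zero_iff)
    have "v i \<noteq> 0" if "i \<in> {1..n + 1} - J" for i using nonzero_coord[of i] assms(2) that by blast
    then show "\<not> (\<exists>i\<in>{1..n + 1} - J. v i ^ assoc_exp s = 0)" by auto
  qed simp
  then show ?thesis using line_minor_nonzero[OF assms(1)] by (simp add: poly_at_assoc_form)
qed

text \<open>Two index sets through \<open>j\<close> that differ in one element give coordinates
  whose constant terms are nonzero and can be balanced against each other. Since
  \<open>s > 0\<close>, a set of \<open>s + 1\<close> elements avoiding \<open>j\<close> contains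
  the two elements to be exchanged.\<close>

lemma exchange_sets:
  obtains M a b where "insert a M \<in> plucker_index n s" "insert b M \<in> plucker_index n s"
    "j \<in> M" "a \<notin> M" "b \<notin> M" "a \<noteq> b" "a \<in> {1..n + 1}" "b \<in> {1..n + 1}"
proof -
  have "card ({1..n + 1} - {j}) = n" using j(1) by simp
  then obtain U where U: "U \<subseteq> {1..n + 1} - {j}" "card U = s + 1"
    using obtain_subset_with_card_n[of "s + 1" "{1..n + 1} - {j}"] s by auto
  have finU: "finite U" using U(1) finite_subset by blast
  have "U \<noteq> {}" using U(2) by auto
  then obtain a where a: "a \<in> U" by blast
  have "card (U - {a}) = s" using U(2) a finU by simp
  then have "U - {a} \<noteq> {}" using s(1) by (intro notI) simp
  then obtain b where b: "b \<in> U - {a}" by blast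
  define M where "M = insert j (U - {a, b})"
  have "card (U - {a, b}) = s - 1"
    using finU a b U(2) by (subst card_Diff_subset) auto
  then have "card M = s" using finU U(1) s by (auto simp: M_def card_insert_if)
  moreover have "finite M" using finU by (simp add: M_def)
  moreover have "M \<subseteq> {1..n + 1}" "a \<in> {1..n + 1}" "b \<in> {1..n + 1}" "j \<in> M" "a \<notin> M" "b \<notin> M"
    using U(1) a b j(1) by (auto simp: M_def)
  ultimately show ?thesis using that[of a M b] b by (auto simp: plucker_index_def)
qed

lemma represents_assoc_form_fixed: "represents_associated_curve n curve s P (assoc_form s)"
proof -
  obtain M a b where M: "insert a M \<in> plucker_index n s" "j \<in> M"
    using exchange_sets by metis
  then have "\<not> vanishes_on (assoc_form s (insert a M)) P"
    using assoc_form_nonzero[OF M(1)] vanishes_on_P_iff[OF assoc_form_forms[OF M(1)]] by simp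
  then show ?thesis using represents_assoc_form[OF s M(1)] by blast
qed

lemma fin_plucker_index: "finite (plucker_index n s)"
  unfolding plucker_index_def by (rule finite_subset[of _ "Pow {1..n + 1}"]) auto

lemma combination_single:
  assumes "J \<in> plucker_index n s"
  shows "(\<Sum>J'\<in>plucker_index n s. fps_const (if J' = J then 1 else 0) * g J') = (g J :: 'a fps)"
proof -
  have "(\<Sum>J'\<in>plucker_index n s. fps_const (if J' = J then 1 else 0) * g J') =
      (\<Sum>J'\<in>plucker_index n s. if J' = J then g J' else 0)"
    by (rule sum.cong) auto
  then show ?thesis using assms fin_plucker_index by simp
qed

text \<open>Nonconstant terms start at order at least \<open>k\<close> in coordinates with
  \<open>j \<in> J\<close> and at \<open>s * k - 1\<close> in the others; the latter is below
  \<open>k\<close> exactly for \<open>s = 1\<close>.\<close>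

definition ram_order :: nat where
  "ram_order = (if s = 1 then k - 1 else k)"

lemma combination_lower:
  assumes "fps_nth (\<Sum>J\<in>plucker_index n s. fps_const (c J) * pullback (assoc_form s J) branch) 0 = 0"
    "i < ram_order"
  shows "fps_nth (\<Sum>J\<in>plucker_index n s. fps_const (c J) * pullback (assoc_form s J) branch) i = 0"
proof (cases "i = 0")
  case False
  have "i < k" "i < assoc_exp s" using assms(2) exp_pos(3,4) by (auto simp: ram_order_def split: if_splits)
  then show ?thesis using False by (simp add: fps_sum_nth pullback_assoc_form_nth)
qed (use assms in simp)

text \<open>For \<open>s = 1\<close> a single coordinate with \<open>j \<notin> J\<close> has order
  exactly \<open>k - 1\<close>. Otherwise two coordinates from \<open>exchange_sets\<close> are
  weighted by each other's constant terms, so that these cancel but the terms of order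
  \<open>k\<close> do not.\<close>

lemma combination_upper:
  "\<exists>c. fps_nth (\<Sum>J\<in>plucker_index n s. fps_const (c J) * pullback (assoc_form s J) branch) 0 = 0 \<and>
    fps_nth (\<Sum>J\<in>plucker_index n s. fps_const (c J) * pullback (assoc_form s J) branch) ram_order \<noteq> 0"
proof (cases "s = 1")
  case True
  have "card ({1..n + 1} - {j}) = n" using j(1) by simp
  then obtain J where J: "J \<subseteq> {1..n + 1} - {j}" "card J = s + 1"
    using obtain_subset_with_card_n[of "s + 1" "{1..n + 1} - {j}"] s by auto
  then have J': "J \<in> plucker_index n s" "j \<notin> J" by (auto simp: plucker_index_def)
  let ?R = "fps_const (line_minor s J) * (\<Prod>i\<in>{1..n + 1} - J - {j}. branch i ^ assoc_exp s)"
  have "(\<Prod>i\<in>{1..n + 1} - J - {j}. v i ^ assoc_exp s) \<noteq> 0"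
  proof (subst prod_zero_iff)
    have "v i \<noteq> 0" if "i \<in> {1..n + 1} - J - {j}" for i using nonzero_coord[of i] that by blast
    then show "\<not> (\<exists>i\<in>{1..n + 1} - J - {j}. v i ^ assoc_exp s = 0)" by auto
  qed simp
  then have "fps_nth ?R 0 \<noteq> 0"
    using line_minor_nonzero[OF J'(1)] by (simp add: fps_nth_0_prod fps_nth_power_0 branch_nth_0)
  moreover have "ram_order = assoc_exp s" unfolding ram_order_def using exp_pos(3)[OF True] True by simp
  ultimately have "fps_nth (pullback (assoc_form s J) branch) 0 = 0"
    "fps_nth (pullback (assoc_form s J) branch) ram_order \<noteq> 0"
    using exp_pos(2) unfolding pullback_assoc_form_X[OF J'(2)] by (simp_all add: fps_X_power_mult_nth)
  then show ?thesis
    by (intro exI[of _ "\<lambda>J'. if J' = J then 1 else 0"]) (simp only: combination_single[OF J'(1)] simp_thms)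
next
  case False
  obtain M a b where M: "insert a M \<in> plucker_index n s" "insert b M \<in> plucker_index n s"
    "j \<in> M" "a \<notin> M" "b \<notin> M" "a \<noteq> b" and ab: "a \<in> {1..n + 1}" "b \<in> {1..n + 1}"
    using exchange_sets by metis
  have aj: "a \<noteq> j" "b \<noteq> j" using M by auto
  let ?e = "assoc_exp s"
  define R where "R = (\<Prod>i\<in>{1..n + 1} - M - {a, b}. branch i ^ ?e)"
  have R: "sparse R" unfolding R_def using M(3) by (intro sparse_prod sparse_power branch_sparse) auto
  have R0: "fps_nth R 0 \<noteq> 0"
  proof -
    have "(\<Prod>i\<in>{1..n + 1} - M - {a, b}. v i ^ ?e) \<noteq> 0"
    proof (subst prod_zero_iff)
      have "v i \<noteq> 0" if "i \<in> {1..n + 1} - M - {a, b}" for i using nonzero_coord[of i] M(3) that by blast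
      then show "\<not> (\<exists>i\<in>{1..n + 1} - M - {a, b}. v i ^ ?e = 0)" by auto
    qed simp
    then show ?thesis by (simp add: R_def fps_nth_0_prod fps_nth_power_0 branch_nth_0)
  qed
  have form: "pullback (assoc_form s (insert x M)) branch =
      fps_const (line_minor s (insert x M)) * (R * branch y ^ ?e)"
    if "{x, y} = {a, b}" for x y
  proof -
    have set: "{1..n + 1} - insert x M - {y} = {1..n + 1} - M - {a, b}" "y \<in> {1..n + 1} - insert x M"
      using that M ab by (auto simp: doubleton_eq_iff)
    have "(\<Prod>i\<in>{1..n + 1} - insert x M. branch i ^ ?e) = branch y ^ ?e * R"
      unfolding R_def set(1)[symmetric] using set(2) by (intro prod.remove) auto
    then show ?thesis by (simp add: pullback_assoc_form mult_ac)
  qed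
  define p where "p = pullback (assoc_form s (insert a M)) branch"
  define q where "q = pullback (assoc_form s (insert b M)) branch"
  define c where "c J = (if J = insert a M then fps_nth q 0 else if J = insert b M then - fps_nth p 0 else 0)" for J
  let ?S = "\<Sum>J\<in>plucker_index n s. fps_const (c J) * pullback (assoc_form s J) branch"
  have neq: "insert a M \<noteq> insert b M" using M by auto
  have S: "?S = fps_const (fps_nth q 0) * p - fps_const (fps_nth p 0) * q"
  proof -
    have "?S = (\<Sum>J\<in>{insert a M, insert b M}. fps_const (c J) * pullback (assoc_form s J) branch)"
      by (rule sum.mono_neutral_right) (use M fin_plucker_index in \<open>auto simp: c_def\<close>)
    also have "\<dots> = fps_const (fps_nth q 0) * p + fps_const (- fps_nth p 0) * q"
      using neq by (simp add: c_def p_def q_def)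
    finally show ?thesis by (simp flip: fps_const_neg)
  qed
  let ?E = "line_minor s (insert a M)" and ?E' = "line_minor s (insert b M)"
  let ?\<phi> = "fps_nth (root_series k) 1 :: 'a"
  have coeff: "fps_nth (R * branch y ^ ?e) 0 = fps_nth R 0 * v y ^ ?e"
    "fps_nth (R * branch y ^ ?e) k = fps_nth R 0 * (of_nat ?e * v y ^ ?e * ?\<phi> * slope y) + fps_nth R k * v y ^ ?e"
    if "y \<in> {1..n + 1}" "y \<noteq> j" for y
  proof -
    show "fps_nth (R * branch y ^ ?e) 0 = fps_nth R 0 * v y ^ ?e"
      by (simp add: fps_nth_power_0 branch_nth_0)
    have "v y ^ ?e = v y ^ (?e - 1) * v y" using exp_pos(2) by (cases ?e) auto
    then show "fps_nth (R * branch y ^ ?e) k = fps_nth R 0 * (of_nat ?e * v y ^ ?e * ?\<phi> * slope y) + fps_nth R k * v y ^ ?e"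
      using sparse_mult_nth_k[OF R sparse_power[OF branch_sparse[OF that]]]
        sparse_power_nth_k[OF branch_sparse[OF that]] branch_nth_k[OF that]
      by (simp add: fps_nth_power_0 branch_nth_0 mult_ac)
  qed
  have pq: "p = fps_const ?E * (R * branch b ^ ?e)" "q = fps_const ?E' * (R * branch a ^ ?e)"
    unfolding p_def q_def by (rule form; auto)+
  have "fps_nth ?S 0 = 0" unfolding S by simp
  \<comment> \<open>By the product rule the contributions of the common factor \<open>R\<close>
    cancel. What remains is the difference of the logarithmic derivatives of the two branch powers,
    hence \<open>slope b - slope a\<close>.\<close>
  moreover have "fps_nth ?S k = ?E * ?E' * fps_nth R 0 ^ 2 * v a ^ ?e * v b ^ ?e * of_nat ?e * ?\<phi> * (slope b - slope a)"
    unfolding S fps_sub_nth fps_mult_left_const_nth pq coeff[OF ab(1) aj(1)] coeff[OF ab(2) aj(2)]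
    by (simp add: algebra_simps power2_eq_square)
  moreover have "slope b - slope a \<noteq> 0"
    using slope_inj[OF ab(2,1)] nonzero_coord ab aj M(6) by auto
  moreover have "?\<phi> \<noteq> 0" using root_series_nonzero[of 1] n2 by simp
  ultimately show ?thesis
    using False R0 line_minor_nonzero[OF M(1)] line_minor_nonzero[OF M(2)] exp_pos(5)
      nonzero_coord[OF ab(1) aj(1)] nonzero_coord[OF ab(2) aj(2)]
    by (intro exI[of _ c]) (simp add: ram_order_def)
qed

text \<open>All representations have pullback order \<open>ram_order\<close> by
  \<open>pullback_order_eq\<close>, so \<open>THE\<close> is well defined. The subtraction of 1 is
  exact because \<open>ram_order\<close> is positive.\<close>

lemma ramification_index_fixed: "ramification_index n curve s P = ram_order - 1"
  unfolding ramification_index_def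
proof (rule the_equality)
  obtain c where c: "fps_nth (\<Sum>J\<in>plucker_index n s. fps_const (c J) * pullback (assoc_form s J) branch) 0 = 0"
    "fps_nth (\<Sum>J\<in>plucker_index n s. fps_const (c J) * pullback (assoc_form s J) branch) ram_order \<noteq> 0"
    using combination_upper by blast
  have order: "pullback_order n curve P (plucker_index n s) G = enat ram_order"
    if "represents_associated_curve n curve s P G" for G
    using pullback_order_eq[OF represents_assoc_form_fixed that combination_lower c] by blast
  have pos: "ram_order - 1 + 1 = ram_order" using k2 by (auto simp: ram_order_def)
  show "\<exists>G. represents_associated_curve n curve s P G \<and>
      pullback_order n curve P (plucker_index n s) G = enat (ram_order - 1 + 1)"
    unfolding pos using represents_assoc_form_fixed order by blast
  show "b = ram_order - 1" if "\<exists>G. represents_associated_curve n curve s P G \<and>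
      pullback_order n curve P (plucker_index n s) G = enat (b + 1)" for b
    using that order by auto
qed

end

end

theorem theorem17:
  fixes k n :: nat and l :: "nat \<Rightarrow> 'a::alg_closed_field"
  assumes "k \<ge> 2" and "n \<ge> 2" and "(n - 1) * (k - 1) > 2"
    and "CHAR('a) = 0 \<or> CHAR('a) > k ^ (n - 1)"
    and "\<forall>i \<in> {1..n - 2}. l i \<noteq> 0 \<and> l i \<noteq> 1"
    and "inj_on l {1..n - 2}"
  shows "hyper_osculating_points n (fermat_curve k n l) = H0_fixed_points k n l \<and>
    (\<forall>P \<in> H0_fixed_points k n l.
       ramification_index n (fermat_curve k n l) 1 P = k - 2 \<and>
       (\<forall>s \<in> {2..n - 1}. ramification_index n (fermat_curve k n l) s P = k - 1))"
proof -
  interpret fermat k n l using assms by unfold_locales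
  have "ramification_index n curve s P = (if s = 1 then k - 2 else k - 1)"
    if P: "P \<in> H0_fixed_points k n l" and s: "0 < s" "s < n" for P s
  proof -
    have "P \<in> curve" using P by (simp add: H0_fixed_points_def)
    then obtain v where v: "v \<noteq> 0" "v \<in> coord_space n" "P = fun_space.span {v}" "on_line (\<lambda>i. v i ^ k)"
      by (rule curveE)
    then obtain j where j: "j \<in> {1..n + 1}" "v j = 0"
      using P in_H0_fixed_points_iff[OF v(1,2,4)] by blast
    obtain w where "fermat_branch k n l v w k" using fixed_branch[OF v(1,2,4) j] .
    then interpret fermat_branch k n l v w k .
    show ?thesis
      using ramification_index_fixed[OF j s] v(3) by (simp add: ram_order_def[OF j s] numeral_2_eq_2)
  qed
  then show ?thesis
    using hyper_osculating_points_eq[OF assms(3)] assms(2) by auto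
qed

end
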